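(* Let $X$ be an infinite-dimensional separable real Banach space. The following are equivalent: (1) the dual space $X^*$ is separable; (2) for every continuous mapping $f:X\to\mathbb{R}$ and for every continuous function $\varepsilon:X\to(0,\infty)$, there exists a $C^1$ smooth mapping $g:X\to\mathbb{R}$ such that $|f(x)-g(x)|\le\varepsilon(x)$ for all $x\in X$ and $g$ has no critical points, i.e. $g'(x)\neq 0$ for all $x\in X$.
   Context: Smoothness is in the Fréchet sense: $g$ is $C^1$ smooth if it is Fréchet differentiable on $X$ with continuous derivative $g':X\to X^*$. A critical point of $g$ is a point $x$ with $g'(x)=0$. *)

theory Defs
  imports "HOL-Analysis.Analysis"
begin

definition infinite_dimensional :: "'a::real_vector itself \<Rightarrow> bool" where
  "infinite_dimensional _ \<longleftrightarrow>
     \<not> (\<exists>B :: 'a set. finite_dimensional_vector_space ((*\<^sub>R) :: real \<Rightarrow> 'a \<Rightarrow> 'a) B)"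

(* The dual space X* is the type of bounded linear functionals with the operator norm,
   and continuity of the derivative is with respect to that norm. *)
definition C1_smooth :: "('a::real_normed_vector \<Rightarrow> real) \<Rightarrow> bool" where
  "C1_smooth g \<longleftrightarrow>
     (\<exists>g' :: 'a \<Rightarrow> 'a \<Rightarrow>\<^sub>L real.
        (\<forall>x. (g has_derivative blinfun_apply (g' x)) (at x)) \<and> continuous_on UNIV g')"

definition critical_point :: "('a::real_normed_vector \<Rightarrow> real) \<Rightarrow> 'a \<Rightarrow> bool" where
  "critical_point g x \<longleftrightarrow> (g has_derivative (\<lambda>h. 0)) (at x)"

end

theory Submission
  imports Defs
begin

text \<open>
  If the condition holds, approximate \<open>\<parallel>x\<parallel>\<^sup>2\<close> by a smooth \<open>g\<close>: for every functional \<open>\<phi>\<close> the function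
  \<open>g - \<phi>\<close> is bounded below, so by Ekeland's principle \<open>\<phi>\<close> is a norm limit of values of \<open>g'\<close>. Thus the
  continuous image of \<open>X\<close> under \<open>g'\<close> is dense in the dual.

  Conversely, let the dual be separable. As in Kadec's renorming, adding to the squared dual norm the
  squared distances to compact convex sets with dense union makes it so strongly convex that its
  conjugate \<open>N\<close> is a \<open>C\<^sup>1\<close> function on \<open>X\<close> comparable to the squared norm; the same works on the
  quotient by any finite-dimensional subspace. Approximate \<open>f\<close> near finitely many centres by functions
  \<open>G n\<close> of finitely many functionals, add to \<open>G n\<close> a small multiple of \<open>arctan\<close> of one further
  functional, and glue these along the increasing unions of the \<open>N\<close>-balls about the first \<open>n\<close> centres. The
  radii increase with \<open>n\<close>, so that at every point at most one cut-off function \<open>\<theta> n\<close> has a nonzero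
  derivative. It remains to arrange that \<open>\<theta>'\<close> never lies in the span of the finitely many functionals
  involved, unless it vanishes. Critical points of a positive combination of the \<open>N (x - x i)\<close> along the
  fibres of these functionals are minimizers, and these can be confined to a neighbourhood of a
  finite-dimensional subspace. In infinite dimensions such a neighbourhood is pushed off to infinity by
  a \<open>C\<^sup>1\<close> map of \<open>X\<close> into its complement that is close to the identity, and composing with this map
  removes the critical points.
\<close>

subsection \<open>Hahn--Banach\<close>

text \<open>Where two neighbouring pieces are blended, the derivative is a combination of finitely
  many known functionals plus \<open>c *\<^sub>R \<theta>'\<close>. A general partition of unity
  would contribute several terms of the last kind, which could cancel each other; the nested unions
  leave one. The known functionals disappear on their common kernel, so it is enough that \<theta>
  has no critical point along a fibre of that kernel, except where its derivative vanishes
  altogether. Along a fibre, the gauges alone do not tell where critical points lie. The extra term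
  \<open>\<kappa> * M\<close>, with \<open>M\<close> a gauge modulo \<open>span E\<close>, penalizes
  distance from \<open>span E\<close> and confines them to small values of \<open>M\<close>. That
  region is bounded in the quotient by \<open>span E\<close>, which is infinite-dimensional and
  therefore has room to push it away. Of the pushing map only this is used: its values avoid the
  region, it moves points little, and its derivative maps the kernel onto itself. The size of the
  displacement has to be independent of \<open>E\<close>, because \<open>E\<close> is chosen after
  the admissible displacement is known.\<close>

definition dominated_graph :: "('a::real_vector \<Rightarrow> real) \<Rightarrow> ('a \<times> real) set \<Rightarrow> bool" where
  "dominated_graph p G \<longleftrightarrow> subspace G \<and> (\<forall>(x, a) \<in> G. a \<le> p x)"

text \<open>The admissible values at \<open>x\<close> lie between all \<open>a - p (y - x)\<close>
  and all \<open>p (z + x) - b\<close>; subadditivity makes this interval nonempty, and its lower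
  end is taken. Homogeneity reduces the check at \<open>y + t *\<^sub>R x\<close> to
  \<open>t = 1\<close> and \<open>t = -1\<close>.\<close>

lemma dominated_graph_extend:
  fixes p :: "'a::real_vector \<Rightarrow> real"
  assumes M: "dominated_graph p M"
    and add: "\<And>x y. p (x + y) \<le> p x + p y" and scale: "\<And>t x. p (t *\<^sub>R x) = \<bar>t\<bar> * p x"
  shows "\<exists>c M'. dominated_graph p M' \<and> M \<subseteq> M' \<and> (x, c) \<in> M'"
proof -
  have sub: "subspace M" and dom: "\<And>y a. (y, a) \<in> M \<Longrightarrow> a \<le> p y"
    using M by (auto simp: dominated_graph_def)
  have zero: "(0, 0) \<in> M" using subspace_0[OF sub] by (simp add: zero_prod_def)
  define S where "S = {a - p (y - x) | y a. (y, a) \<in> M}"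
  define c where "c = Sup S"
  have key: "a - p (y - x) \<le> p (z + x) - b" if "(y, a) \<in> M" "(z, b) \<in> M" for y z a b
  proof -
    have "(y, a) + (z, b) \<in> M" using subspace_add[OF sub that] .
    then have "a + b \<le> p (y + z)" using dom by simp
    also have "\<dots> = p ((y - x) + (z + x))" by (simp add: algebra_simps)
    also have "\<dots> \<le> p (y - x) + p (z + x)" by (rule add)
    finally show ?thesis by simp
  qed
  have ne: "S \<noteq> {}" using zero by (auto simp: S_def)
  have bdd: "bdd_above S"
    using key[OF _ zero] by (auto simp: S_def bdd_above_def intro!: exI[of _ "p (0 + x) - 0"])
  have lo: "a - p (y - x) \<le> c" if "(y, a) \<in> M" for y a
    unfolding c_def by (rule cSup_upper[OF _ bdd]) (use that in \<open>auto simp: S_def\<close>)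
  have hi: "c \<le> p (z + x) - b" if "(z, b) \<in> M" for z b
    unfolding c_def by (rule cSup_least[OF ne]) (use key that in \<open>auto simp: S_def\<close>)
  define M' where "M' = {u + v | u v. u \<in> M \<and> v \<in> span {(x, c)}}"
  have sub': "subspace M'"
    unfolding M'_def by (rule subspace_sums[OF sub subspace_span])
  have "b \<le> p w" if wb: "(w, b) \<in> M'" for w b
  proof -
    obtain y a t where ya: "(y, a) \<in> M" and w: "w = y + t *\<^sub>R x" and b: "b = a + t * c"
      using wb by (auto simp: M'_def span_singleton)
    consider "t = 0" | "t > 0" | "t < 0" by linarith
    then show ?thesis
    proof cases
      case 1
      then show ?thesis using dom[OF ya] w b by simp
    next
      case 2
      have "(y /\<^sub>R t, a / t) \<in> M" using subspace_scale[OF sub ya, of "1/t"] by (simp add: divide_inverse_commute)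
      from hi[OF this] have "c + a / t \<le> p (y /\<^sub>R t + x)" by simp
      then have "t * (c + a / t) \<le> t * p (y /\<^sub>R t + x)" using 2 by simp
      also have "\<dots> = p (t *\<^sub>R (y /\<^sub>R t + x))" using 2 by (simp add: scale)
      also have "t *\<^sub>R (y /\<^sub>R t + x) = w" using 2 by (simp add: w algebra_simps)
      finally show ?thesis using 2 by (simp add: b algebra_simps)
    next
      case 3
      define s where "s = -t"
      have s: "s > 0" using 3 by (simp add: s_def)
      have "(y /\<^sub>R s, a / s) \<in> M" using subspace_scale[OF sub ya, of "1/s"] by (simp add: divide_inverse_commute)
      from lo[OF this] have "a / s - c \<le> p (y /\<^sub>R s - x)" by simp
      then have "s * (a / s - c) \<le> s * p (y /\<^sub>R s - x)" using s by simp
      also have "\<dots> = p (s *\<^sub>R (y /\<^sub>R s - x))" using s by (simp add: scale)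
      also have "s *\<^sub>R (y /\<^sub>R s - x) = w" using s by (simp add: w s_def algebra_simps)
      finally show ?thesis using s by (simp add: b s_def algebra_simps)
    qed
  qed
  then have "dominated_graph p M'" using sub' by (auto simp: dominated_graph_def)
  moreover have "M \<subseteq> M'"
  proof
    fix u assume "u \<in> M"
    moreover have "u = u + 0" by simp
    ultimately show "u \<in> M'" unfolding M'_def using span_zero by blast
  qed
  moreover have "(x, c) \<in> M'"
  proof -
    have "(x, c) = (0, 0) + (x, c)" by simp
    then show ?thesis unfolding M'_def using zero span_base[of "(x,c)" "{(x,c)}"] by blast
  qed
  ultimately show ?thesis by blast
qed

text \<open>Encoding partial functionals as graphs turns extension into inclusion, so unions of
  chains serve as upper bounds for Zorn's lemma. A maximal graph is defined everywhere by
  \<open>dominated_graph_extend\<close>.\<close>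

lemma Hahn_Banach_seminorm:
  fixes p :: "'a::real_vector \<Rightarrow> real"
  assumes add: "\<And>x y. p (x + y) \<le> p x + p y" and scale: "\<And>t x. p (t *\<^sub>R x) = \<bar>t\<bar> * p x"
  shows "\<exists>f. linear f \<and> (\<forall>y. \<bar>f y\<bar> \<le> p y) \<and> f x = p x"
proof -
  have p0: "p 0 = 0" using scale[of 0 0] by simp
  have pos: "p y \<ge> 0" for y
    using add[of y "-y"] scale[of "-1" y] p0 by simp
  define G0 where "G0 = span {(x, p x)}"
  have dom0: "dominated_graph p G0"
  proof -
    have "a \<le> p y" if ya: "(y, a) \<in> G0" for y a
    proof -
      obtain t where "y = t *\<^sub>R x" "a = t * p x" using ya unfolding G0_def span_singleton by auto
      then show ?thesis using pos[of x] scale[of t x] by (simp add: mult_right_mono)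
    qed
    moreover have "subspace G0" unfolding G0_def by (rule subspace_span)
    ultimately show ?thesis unfolding dominated_graph_def by auto
  qed
  define A where "A = {G. dominated_graph p G \<and> G0 \<subseteq> G}"
  have "\<exists>M\<in>A. \<forall>X\<in>A. M \<subseteq> X \<longrightarrow> X = M"
  proof (rule subset_Zorn_nonempty)
    show "A \<noteq> {}" using dom0 by (auto simp: A_def)
    fix C assume C: "C \<noteq> {}" "subset.chain A C"
    have CA: "\<And>G. G \<in> C \<Longrightarrow> dominated_graph p G \<and> G0 \<subseteq> G"
      using C(2) by (auto simp: subset_chain_def A_def)
    have dir: "\<exists>G\<in>C. u \<in> G \<and> v \<in> G" if uv: "u \<in> \<Union>C" "v \<in> \<Union>C" for u v
    proof -
      obtain G H where "G \<in> C" "u \<in> G" "H \<in> C" "v \<in> H" using uv by auto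
      moreover have "G \<subseteq> H \<or> H \<subseteq> G" using calculation C(2) by (simp add: subset_chain_def)
      ultimately show ?thesis by blast
    qed
    have "subspace (\<Union>C)"
    proof (rule subspaceI)
      show "0 \<in> \<Union>C"
      proof -
        obtain G where "G \<in> C" using C(1) by auto
        then show ?thesis using CA[of G] subspace_0 unfolding dominated_graph_def by blast
      qed
      show "u + v \<in> \<Union>C" if uv: "u \<in> \<Union>C" "v \<in> \<Union>C" for u v
      proof -
        obtain G where "G \<in> C" "u \<in> G" "v \<in> G" using dir[OF uv] by auto
        then show ?thesis using CA[of G] subspace_add unfolding dominated_graph_def by blast
      qed
      show "c *\<^sub>R u \<in> \<Union>C" if u: "u \<in> \<Union>C" for u c
      proof -
        obtain G where "G \<in> C" "u \<in> G" using u by auto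
        then show ?thesis using CA[of G] subspace_scale unfolding dominated_graph_def by blast
      qed
    qed
    moreover have "G0 \<subseteq> \<Union>C" using C(1) CA by blast
    moreover have "a \<le> p y" if ya: "(y, a) \<in> \<Union>C" for y a
    proof -
      obtain G where "G \<in> C" "(y, a) \<in> G" using ya by auto
      then show ?thesis using CA[of G] unfolding dominated_graph_def by auto
    qed
    ultimately show "\<Union>C \<in> A"
      unfolding A_def dominated_graph_def by auto
  qed
  then obtain M where M: "dominated_graph p M" "G0 \<subseteq> M"
    and max: "\<And>X. dominated_graph p X \<Longrightarrow> G0 \<subseteq> X \<Longrightarrow> M \<subseteq> X \<Longrightarrow> X = M"
    by (auto simp: A_def)
  have sub: "subspace M" and dom: "\<And>y a. (y, a) \<in> M \<Longrightarrow> a \<le> p y"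
    using M by (auto simp: dominated_graph_def)
  have ex: "\<exists>c. (y, c) \<in> M" for y
  proof -
    obtain c M' where M': "dominated_graph p M'" "M \<subseteq> M'" "(y, c) \<in> M'"
      using dominated_graph_extend[OF M(1) add scale] by blast
    then have "M' = M" using max M(2) by (meson order_trans)
    then show ?thesis using M'(3) by blast
  qed
  \<comment> \<open>Single-valuedness is no part of \<open>dominated_graph\<close>. It follows from
    domination: \<open>(0, a - b)\<close> and \<open>(0, b - a)\<close> both lie in
    \<open>M\<close>, and \<open>p 0 = 0\<close>.\<close>
  have uniq: "a = b" if "(y, a) \<in> M" "(y, b) \<in> M" for y a b
  proof -
    have "(0, a - b) \<in> M" "(0, b - a) \<in> M"
      using subspace_diff[OF sub that] subspace_diff[OF sub that(2,1)] by auto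
    then show ?thesis using dom[of 0 "a - b"] dom[of 0 "b - a"] p0 by simp
  qed
  define f where "f y = (THE c. (y, c) \<in> M)" for y
  have fM: "(y, f y) \<in> M" for y
    unfolding f_def by (rule theI') (use ex uniq in blast)
  have feq: "f y = c" if "(y, c) \<in> M" for y c using uniq fM that by blast
  have lin: "linear f"
  proof (rule linearI)
    show "f (u + v) = f u + f v" for u v
      using subspace_add[OF sub fM[of u] fM[of v]] by (intro feq) simp
    show "f (c *\<^sub>R u) = c *\<^sub>R f u" for c u
      using subspace_scale[OF sub fM[of u], of c] by (intro feq) simp
  qed
  have "\<bar>f y\<bar> \<le> p y" for y
  proof -
    have "f y \<le> p y" using dom fM by blast
    moreover have "- f y \<le> p y"
      using dom[OF fM[of "-y"]] linear_neg[OF lin, of y] scale[of "-1" y] by simp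
    ultimately show ?thesis by linarith
  qed
  moreover have "f x = p x"
    by (rule feq) (use M(2) in \<open>auto simp: G0_def intro: span_base\<close>)
  ultimately show ?thesis using lin by blast
qed

section \<open>The distance to a subspace as a seminorm\<close>

lemma infdist_almost_attained:
  fixes x :: "'a::metric_space"
  assumes "S \<noteq> {}" "e > 0"
  shows "\<exists>a\<in>S. dist x a < infdist x S + e"
proof -
  have "bdd_below ((\<lambda>a. dist x a) ` S)" by (auto intro!: bdd_belowI[of _ 0])
  moreover have "infdist x S = (INF a\<in>S. dist x a)" using assms by (simp add: infdist_def)
  ultimately show ?thesis
    using cINF_less_iff[of S "\<lambda>a. dist x a" "infdist x S + e"] assms
    by auto
qed

lemma infdist_subspace_triangle:
  fixes S :: "'a::real_normed_vector set"
  assumes "subspace S"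
  shows "infdist (x + y) S \<le> infdist x S + infdist y S"
proof (rule field_le_epsilon)
  fix e :: real assume e: "e > 0"
  have ne: "S \<noteq> {}" using subspace_0[OF assms] by auto
  obtain a where a: "a \<in> S" "dist x a < infdist x S + e/2"
    using infdist_almost_attained[OF ne, where x=x and e="e/2"] e by auto
  obtain b where b: "b \<in> S" "dist y b < infdist y S + e/2"
    using infdist_almost_attained[OF ne, where x=y and e="e/2"] e by auto
  have "infdist (x + y) S \<le> dist (x + y) (a + b)"
    by (rule infdist_le) (use a b assms in \<open>auto intro: subspace_add\<close>)
  also have "\<dots> \<le> dist x a + dist y b"
    by (rule dist_triangle_add)
  finally show "infdist (x + y) S \<le> infdist x S + infdist y S + e" using a b by linarith
qed

lemma infdist_subspace_scale:
  fixes S :: "'a::real_normed_vector set"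
  assumes "subspace S"
  shows "infdist (t *\<^sub>R x) S = \<bar>t\<bar> * infdist x S"
proof -
  have ne: "S \<noteq> {}" using subspace_0[OF assms] by auto
  have le: "infdist (t *\<^sub>R x) S \<le> \<bar>t\<bar> * infdist x S" for t x
  proof (rule field_le_epsilon)
    fix e :: real assume e: "e > 0"
    define d where "d = e / (\<bar>t\<bar> + 1)"
    have d: "d > 0" "\<bar>t\<bar> * d \<le> e" using e by (auto simp: d_def field_simps)
    obtain a where a: "a \<in> S" "dist x a < infdist x S + d"
      using infdist_almost_attained[OF ne, where x=x and e=d] d by auto
    have "infdist (t *\<^sub>R x) S \<le> dist (t *\<^sub>R x) (t *\<^sub>R a)"
      by (rule infdist_le) (use a assms in \<open>auto intro: subspace_scale\<close>)
    also have "\<dots> = \<bar>t\<bar> * dist x a" by (simp add: dist_norm flip: scaleR_diff_right)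
    also have "\<dots> \<le> \<bar>t\<bar> * (infdist x S + d)" using a by (intro mult_left_mono) auto
    finally show "infdist (t *\<^sub>R x) S \<le> \<bar>t\<bar> * infdist x S + e" using d by (simp add: algebra_simps)
  qed
  show ?thesis
  proof (cases "t = 0")
    case True
    then show ?thesis using infdist_zero[of 0 S] subspace_0[OF assms] by simp
  next
    case False
    have "infdist x S \<le> \<bar>1/t\<bar> * infdist (t *\<^sub>R x) S" using le[of "1/t" "t *\<^sub>R x"] False by simp
    then show ?thesis using le[of t x] False by (simp add: field_simps)
  qed
qed

lemma infdist_span_empty [simp]: "infdist (x::'a::real_normed_vector) {0} = norm x"
  by (simp add: infdist_def)

lemma infdist_span_le_norm: "infdist (x::'a::real_normed_vector) (span E) \<le> norm x"
  using infdist_le[OF span_zero, of x E] by (simp add: dist_norm)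

text \<open>Hahn-Banach for the seminorm \<open>infdist y (span E)\<close>: domination by it yields
  both the norm bound and the vanishing on \<open>span E\<close>. The case \<open>E = {}\<close>
  gives norming functionals.\<close>

lemma separating_functional:
  fixes x :: "'a::real_normed_vector"
  obtains f :: "'a \<Rightarrow>\<^sub>L real" where "norm f \<le> 1" "f x = infdist x (span E)" "\<And>v. v \<in> span E \<Longrightarrow> f v = 0"
proof -
  obtain f where f: "linear f" "\<And>y. \<bar>f y\<bar> \<le> infdist y (span E)" "f x = infdist x (span E)"
    using Hahn_Banach_seminorm[of "\<lambda>y. infdist y (span E)" x]
      infdist_subspace_triangle[OF subspace_span] infdist_subspace_scale[OF subspace_span] by metis
  have bl: "bounded_linear f"
    by (rule bounded_linear_intro[of f 1])
      (use f(1,2) infdist_span_le_norm in \<open>auto simp: linear_add linear_scale intro: order_trans\<close>)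
  show ?thesis
  proof (rule that[of "Blinfun f"])
    show "norm (Blinfun f) \<le> 1"
      using f(2) infdist_span_le_norm bl
      by (intro norm_blinfun_bound) (auto simp: bounded_linear_Blinfun_apply intro: order_trans)
    show "blinfun_apply (Blinfun f) x = infdist x (span E)"
      using f bl by (simp add: bounded_linear_Blinfun_apply)
    show "blinfun_apply (Blinfun f) v = 0" if "v \<in> span E" for v
      using f(2)[of v] infdist_zero[OF that] bl by (simp add: bounded_linear_Blinfun_apply)
  qed
qed

lemma norming_functional:
  fixes x :: "'a::real_normed_vector"
  obtains f :: "'a \<Rightarrow>\<^sub>L real" where "norm f \<le> 1" "f x = norm x"
  using separating_functional[of x "{}"] by auto

subsection \<open>Finitely many functionals\<close>

definition kern :: "('a::real_normed_vector \<Rightarrow>\<^sub>L real) set \<Rightarrow> 'a set" where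
  "kern \<Phi> = {v. \<forall>\<phi>\<in>\<Phi>. blinfun_apply \<phi> v = 0}"

lemma subspace_kern: "subspace (kern \<Phi>)"
  by (auto simp: kern_def subspace_def blinfun.bilinear_simps)

lemma kern_anti_mono: "\<Phi> \<subseteq> \<Psi> \<Longrightarrow> kern \<Psi> \<subseteq> kern \<Phi>"
  by (auto simp: kern_def)

abbreviation dual_sum :: "('a::real_normed_vector \<Rightarrow>\<^sub>L real) set \<Rightarrow> (('a \<Rightarrow>\<^sub>L real) \<Rightarrow> 'b) \<Rightarrow> 'a \<Rightarrow> 'b::real_vector" where
  "dual_sum \<Phi> v x \<equiv> \<Sum>\<psi>\<in>\<Phi>. blinfun_apply \<psi> x *\<^sub>R v \<psi>"

text \<open>\<open>dual_sum \<Phi> v\<close> carries points into a fixed finite-dimensional space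
  without changing their values under \<Phi>. In the induction, either the old section already
  respects \<phi>, or some \<open>u - P u\<close> can be normalized to a vector dual to \<phi> and
  killed by the old functionals. Linear dependence in \<Phi> is thus harmless.\<close>

lemma finite_functionals_section:
  fixes \<Phi> :: "('a::real_normed_vector \<Rightarrow>\<^sub>L real) set"
  assumes "finite \<Phi>"
  shows "\<exists>v. \<forall>x. \<forall>\<phi>\<in>\<Phi>. blinfun_apply \<phi> (dual_sum \<Phi> v x) = blinfun_apply \<phi> x"
  using assms
proof (induction \<Phi> rule: finite_induct)
  case empty
  then show ?case by simp
next
  case (insert \<phi> \<Phi>)
  from insert.IH obtain v
    where "\<forall>x. \<forall>\<phi>\<in>\<Phi>. blinfun_apply \<phi> (dual_sum \<Phi> v x) = blinfun_apply \<phi> x" ..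
  then have v: "blinfun_apply \<psi> (dual_sum \<Phi> v x) = blinfun_apply \<psi> x" if "\<psi> \<in> \<Phi>" for x \<psi>
    using that by simp
  define P where "P x = dual_sum \<Phi> v x" for x
  show ?case
  proof (cases "\<forall>x. blinfun_apply \<phi> (P x) = blinfun_apply \<phi> x")
    case True
    define v' where "v' \<psi> = (if \<psi> = \<phi> then 0 else v \<psi>)" for \<psi>
    have "(\<Sum>\<psi>\<in>insert \<phi> \<Phi>. blinfun_apply \<psi> x *\<^sub>R v' \<psi>) = P x" for x
      using insert.hyps by (auto simp: P_def v'_def intro!: sum.cong)
    then show ?thesis using True v by (intro exI[of _ v']) (auto simp: P_def)
  next
    case False
    then obtain u where "blinfun_apply \<phi> (P u) \<noteq> blinfun_apply \<phi> u" by blast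
    then have u: "blinfun_apply \<phi> (u - P u) \<noteq> 0" by (simp add: blinfun.bilinear_simps)
    define w where "w = (1 / blinfun_apply \<phi> (u - P u)) *\<^sub>R (u - P u)"
    have w1: "blinfun_apply \<phi> w = 1" using u by (simp add: w_def blinfun.bilinear_simps)
    have w0: "blinfun_apply \<psi> w = 0" if "\<psi> \<in> \<Phi>" for \<psi>
      using v[OF that, of u] by (simp add: w_def blinfun.bilinear_simps P_def)
    define v' where "v' \<psi> = (if \<psi> = \<phi> then w else v \<psi> - blinfun_apply \<phi> (v \<psi>) *\<^sub>R w)" for \<psi>
    have eq: "(\<Sum>\<psi>\<in>insert \<phi> \<Phi>. blinfun_apply \<psi> x *\<^sub>R v' \<psi>) = P x + (blinfun_apply \<phi> x - blinfun_apply \<phi> (P x)) *\<^sub>R w" for x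
    proof -
      have "(\<Sum>\<psi>\<in>insert \<phi> \<Phi>. blinfun_apply \<psi> x *\<^sub>R v' \<psi>)
          = blinfun_apply \<phi> x *\<^sub>R w + (\<Sum>\<psi>\<in>\<Phi>. blinfun_apply \<psi> x *\<^sub>R v' \<psi>)"
        using insert.hyps by (simp add: v'_def)
      also have "(\<Sum>\<psi>\<in>\<Phi>. blinfun_apply \<psi> x *\<^sub>R v' \<psi>) =
          (\<Sum>\<psi>\<in>\<Phi>. blinfun_apply \<psi> x *\<^sub>R v \<psi> - (blinfun_apply \<psi> x * blinfun_apply \<phi> (v \<psi>)) *\<^sub>R w)"
        using insert.hyps by (intro sum.cong) (auto simp: v'_def algebra_simps)
      also have "\<dots> = P x - blinfun_apply \<phi> (P x) *\<^sub>R w"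
        by (simp add: P_def sum_subtractf scaleR_sum_left blinfun.sum_right blinfun.scaleR_right)
      finally show ?thesis by (simp add: algebra_simps)
    qed
    show ?thesis
      using v w1 w0 unfolding P_def[symmetric]
      by (intro exI[of _ v']) (auto simp: eq blinfun.bilinear_simps)
  qed
qed

text \<open>With a trivial kernel, \<open>x\<close> would equal \<open>dual_sum \<Phi> v x\<close>,
  and finitely many vectors would span the space.\<close>

lemma kern_nontrivial:
  fixes \<Phi> :: "('a::real_normed_vector \<Rightarrow>\<^sub>L real) set"
  assumes inf: "infinite_dimensional TYPE('a)" and fin: "finite \<Phi>"
  obtains x where "x \<in> kern \<Phi>" "x \<noteq> 0"
proof -
  obtain v where "\<forall>x. \<forall>\<phi>\<in>\<Phi>. blinfun_apply \<phi> (dual_sum \<Phi> v x) = blinfun_apply \<phi> x"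
    using finite_functionals_section[OF fin] ..
  then have v: "blinfun_apply \<phi> (dual_sum \<Phi> v x) = blinfun_apply \<phi> x" if "\<phi> \<in> \<Phi>" for x \<phi>
    using that by simp
  have "\<exists>x. x \<in> kern \<Phi> \<and> x \<noteq> 0"
  proof (rule ccontr)
    assume no: "\<nexists>x. x \<in> kern \<Phi> \<and> x \<noteq> 0"
    have eq: "x = dual_sum \<Phi> v x" for x
    proof -
      have "x - (dual_sum \<Phi> v x) \<in> kern \<Phi>"
        using v by (simp add: kern_def blinfun.diff_right)
      then show ?thesis using no by force
    qed
    have sp: "span (v ` \<Phi>) = UNIV"
    proof -
      have "x \<in> span (v ` \<Phi>)" for x
        by (subst eq) (intro span_sum span_scale span_base imageI)
      then show ?thesis by blast
    qed
    obtain B where B: "B \<subseteq> v ` \<Phi>" "independent B" "v ` \<Phi> \<subseteq> span B"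
      using maximal_independent_subset by blast
    have "span B = UNIV"
      using B(3) sp span_minimal[OF B(3) subspace_span] by auto
    moreover have "finite B" using B(1) fin finite_subset by blast
    ultimately have "finite_dimensional_vector_space ((*\<^sub>R) :: real \<Rightarrow> 'a \<Rightarrow> 'a) B"
      using B(2) unfolding finite_dimensional_vector_space_def finite_dimensional_vector_space_axioms_def
      by (simp add: dependent_raw_def span_raw_def real_vector.vector_space_axioms)
    then show False using inf by (auto simp: infinite_dimensional_def)
  qed
  then show ?thesis using that by blast
qed

text \<open>Rounding all values to multiples of \<delta> leaves finitely many patterns, and one
  point per pattern is enough. This stands in for compactness of balls when only finitely many
  functions matter.\<close>

lemma finite_net_bounded_functions:
  fixes \<Gamma> :: "('a \<Rightarrow> real) set"
  assumes fin: "finite \<Gamma>" and bdd: "\<And>\<gamma>. \<gamma> \<in> \<Gamma> \<Longrightarrow> bounded (\<gamma> ` B)" and \<delta>: "\<delta> > 0"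
  obtains Y where "finite Y" "Y \<subseteq> B" "\<And>x. x \<in> B \<Longrightarrow> \<exists>y\<in>Y. \<forall>\<gamma>\<in>\<Gamma>. \<bar>\<gamma> x - \<gamma> y\<bar> < \<delta>"
proof -
  define q where "q x = restrict (\<lambda>\<gamma>. \<lfloor>\<gamma> x / \<delta>\<rfloor>) \<Gamma>" for x
  have "\<exists>c. \<forall>x\<in>B. \<bar>\<gamma> x\<bar> \<le> c" if "\<gamma> \<in> \<Gamma>" for \<gamma>
    using bdd[OF that] by (auto simp: bounded_iff)
  then obtain c where c: "\<And>\<gamma> x. \<gamma> \<in> \<Gamma> \<Longrightarrow> x \<in> B \<Longrightarrow> \<bar>\<gamma> x\<bar> \<le> c \<gamma>" by metis
  have "q ` B \<subseteq> (\<Pi>\<^sub>E \<gamma>\<in>\<Gamma>. {\<lfloor>- c \<gamma> / \<delta>\<rfloor> .. \<lfloor>c \<gamma> / \<delta>\<rfloor>})"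
  proof
    fix z assume "z \<in> q ` B"
    then obtain x where x: "x \<in> B" "z = q x" by auto
    have "\<lfloor>- c \<gamma> / \<delta>\<rfloor> \<le> \<lfloor>\<gamma> x / \<delta>\<rfloor> \<and> \<lfloor>\<gamma> x / \<delta>\<rfloor> \<le> \<lfloor>c \<gamma> / \<delta>\<rfloor>" if "\<gamma> \<in> \<Gamma>" for \<gamma>
    proof -
      have "- c \<gamma> \<le> \<gamma> x" "\<gamma> x \<le> c \<gamma>" using c[OF that x(1)] by auto
      then show ?thesis using \<delta> by (intro conjI floor_mono divide_right_mono) auto
    qed
    then show "z \<in> (\<Pi>\<^sub>E \<gamma>\<in>\<Gamma>. {\<lfloor>- c \<gamma> / \<delta>\<rfloor> .. \<lfloor>c \<gamma> / \<delta>\<rfloor>})"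
      unfolding x(2) q_def by (simp add: PiE_iff)
  qed
  then have finq: "finite (q ` B)" by (rule finite_subset) (intro finite_PiE fin, auto)
  show ?thesis
  proof (rule that[of "inv_into B q ` q ` B"])
    show "finite (inv_into B q ` q ` B)" using finq by simp
    show "inv_into B q ` q ` B \<subseteq> B" by (auto intro: inv_into_into)
    fix x assume x: "x \<in> B"
    define y where "y = inv_into B q (q x)"
    have y: "y \<in> B" "q y = q x" using x by (auto simp: y_def inv_into_into f_inv_into_f)
    have "\<bar>\<gamma> x - \<gamma> y\<bar> < \<delta>" if "\<gamma> \<in> \<Gamma>" for \<gamma>
    proof -
      have "\<lfloor>\<gamma> x / \<delta>\<rfloor> = \<lfloor>\<gamma> y / \<delta>\<rfloor>" using fun_cong[OF y(2), of \<gamma>] that by (simp add: q_def)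
      then have "\<bar>\<gamma> x / \<delta> - \<gamma> y / \<delta>\<bar> < 1" by linarith
      then have "\<bar>(\<gamma> x - \<gamma> y) / \<delta>\<bar> < 1" by (simp add: diff_divide_distrib)
      then show ?thesis using \<delta> by (simp add: abs_divide)
    qed
    then show "\<exists>y\<in>inv_into B q ` q ` B. \<forall>\<gamma>\<in>\<Gamma>. \<bar>\<gamma> x - \<gamma> y\<bar> < \<delta>"
      using x by (auto simp: y_def)
  qed
qed

text \<open>Continuity of the coordinates obtained so far makes \<open>span E\<close> closed, so a
  new vector has positive distance from it and a functional separates the two. A redundant vector
  gets coordinate 0.\<close>

lemma finite_span_coordinates:
  fixes E :: "'a::real_normed_vector set"
  assumes "finite E"
  shows "\<exists>g :: 'a \<Rightarrow> 'a \<Rightarrow>\<^sub>L real. \<forall>e\<in>span E. e = (\<Sum>v\<in>E. g v e *\<^sub>R v)"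
  using assms
proof (induction E rule: finite_induct)
  case empty
  then show ?case by auto
next
  case (insert w E)
  from insert.IH obtain g :: "'a \<Rightarrow> 'a \<Rightarrow>\<^sub>L real"
    where "\<forall>e\<in>span E. e = (\<Sum>v\<in>E. g v e *\<^sub>R v)" ..
  then have g: "e = (\<Sum>v\<in>E. g v e *\<^sub>R v)" if "e \<in> span E" for e
    using that by (rule bspec)
  have closed: "w \<in> span E" if "infdist w (span E) = 0"
  proof -
    have "w \<in> closure (span E)" using that span_zero[of E] in_closure_iff_infdist_zero[of "span E" w] by blast
    then obtain s where s: "\<And>n. s n \<in> span E" "s \<longlonglongrightarrow> w" by (auto simp: closure_sequential)
    have "(\<lambda>n. \<Sum>v\<in>E. g v (s n) *\<^sub>R v) \<longlonglongrightarrow> (\<Sum>v\<in>E. g v w *\<^sub>R v)"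
      by (intro tendsto_intros s)
    moreover have "(\<lambda>n. \<Sum>v\<in>E. g v (s n) *\<^sub>R v) = s"
      using g[OF s(1)] by (intro ext) (rule sym)
    ultimately have "s \<longlonglongrightarrow> (\<Sum>v\<in>E. g v w *\<^sub>R v)" by simp
    from LIMSEQ_unique[OF this s(2)] have "(\<Sum>v\<in>E. g v w *\<^sub>R v) = w" .
    moreover have "(\<Sum>v\<in>E. g v w *\<^sub>R v) \<in> span E"
      by (intro span_sum span_scale span_base)
    ultimately show ?thesis by simp
  qed
  show ?case
  proof (cases "w \<in> span E")
    case True
    have "e = (\<Sum>v\<in>insert w E. blinfun_apply ((g(w := 0)) v) e *\<^sub>R v)" if "e \<in> span (insert w E)" for e
    proof -
      have "e \<in> span E" using that True by (simp add: span_redundant)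
      then have "e = (\<Sum>v\<in>E. g v e *\<^sub>R v)" by (rule g)
      also have "\<dots> = (\<Sum>v\<in>insert w E. blinfun_apply ((g(w := 0)) v) e *\<^sub>R v)"
        using insert.hyps by (auto intro!: sum.cong)
      finally show ?thesis .
    qed
    then show ?thesis by blast
  next
    case False
    then have d: "infdist w (span E) \<noteq> 0" using closed by blast
    obtain f0 :: "'a \<Rightarrow>\<^sub>L real" where f0: "f0 w = infdist w (span E)" "\<And>v. v \<in> span E \<Longrightarrow> f0 v = 0"
      using separating_functional[of w E] by blast
    define f where "f = (1 / infdist w (span E)) *\<^sub>R f0"
    have f: "blinfun_apply f w = 1" "\<And>v. v \<in> span E \<Longrightarrow> blinfun_apply f v = 0"
      using d f0 by (auto simp: f_def blinfun.bilinear_simps)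
    define g' where "g' v = (if v = w then f else g v - (g v w) *\<^sub>R f)" for v
    have "e = (\<Sum>v\<in>insert w E. blinfun_apply (g' v) e *\<^sub>R v)" if e: "e \<in> span (insert w E)" for e
    proof -
      obtain t where t: "e - t *\<^sub>R w \<in> span E" using span_breakdown_eq[of e w E] e by auto
      define u where "u = e - t *\<^sub>R w"
      have e: "e = u + t *\<^sub>R w" by (simp add: u_def)
      have fe: "blinfun_apply f e = t" using f t by (simp add: e blinfun.bilinear_simps u_def[symmetric])
      have "(\<Sum>v\<in>insert w E. blinfun_apply (g' v) e *\<^sub>R v) = t *\<^sub>R w + (\<Sum>v\<in>E. blinfun_apply (g' v) e *\<^sub>R v)"
        using insert.hyps fe by (simp add: g'_def)
      also have "(\<Sum>v\<in>E. blinfun_apply (g' v) e *\<^sub>R v) = (\<Sum>v\<in>E. g v u *\<^sub>R v)"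
        using insert.hyps(2) fe by (intro sum.cong) (auto simp: g'_def u_def blinfun.bilinear_simps)
      also have "\<dots> = u" using g[of u] t by (simp add: u_def)
      finally show ?thesis by (simp add: e)
    qed
    then show ?thesis by blast
  qed
qed

text \<open>Mazur's argument: functionals norming a \<open>1/4\<close>-net of the unit ball of
  \<open>span E\<close> detect at least half of the norm of every \<open>e\<close>. They do not see
  \<open>w\<close>, so \<open>norm e \<le> 2 * norm (e + w)\<close>, and the triangle inequality
  turns 2 into 3 for \<open>w\<close>.\<close>

lemma finite_norming_functionals:
  fixes E :: "'a::real_normed_vector set"
  assumes "finite E"
  obtains \<Psi> :: "('a \<Rightarrow>\<^sub>L real) set" where "finite \<Psi>"
    "\<And>e w. e \<in> span E \<Longrightarrow> w \<in> kern \<Psi> \<Longrightarrow> norm w \<le> 3 * norm (e + w)"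
proof -
  obtain g :: "'a \<Rightarrow> 'a \<Rightarrow>\<^sub>L real"
    where "\<forall>e\<in>span E. e = (\<Sum>v\<in>E. g v e *\<^sub>R v)"
    using finite_span_coordinates[OF assms] ..
  then have g: "e = (\<Sum>v\<in>E. g v e *\<^sub>R v)" if "e \<in> span E" for e
    using that by (rule bspec)
  define B where "B = {e \<in> span E. norm e \<le> 1}"
  define s where "s = (\<Sum>v\<in>E. norm v) + 1"
  have s: "s > 0" by (simp add: s_def sum_nonneg add_nonneg_pos)
  have bdd: "bounded (\<gamma> ` B)" if \<gamma>: "\<gamma> \<in> (\<lambda>v. blinfun_apply (g v)) ` E" for \<gamma>
  proof -
    obtain v where "\<gamma> = blinfun_apply (g v)" using \<gamma> by auto
    moreover have "bounded B" by (auto simp: B_def bounded_iff)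
    ultimately show ?thesis by (simp add: bounded_linear_image blinfun.bounded_linear_right)
  qed
  \<comment> \<open>A mesh of \<open>1 / (4 * s)\<close> in each coordinate is a mesh of
    \<open>1/4\<close> in norm, as \<open>s\<close> exceeds the sum of the
    \<open>norm v\<close>.\<close>
  obtain Y where Y: "finite Y" "Y \<subseteq> B"
    and net: "\<And>x. x \<in> B \<Longrightarrow> \<exists>y\<in>Y. \<forall>\<gamma>\<in>(\<lambda>v. blinfun_apply (g v)) ` E. \<bar>\<gamma> x - \<gamma> y\<bar> < 1 / (4 * s)"
    using finite_net_bounded_functions[of "(\<lambda>v. blinfun_apply (g v)) ` E" B "1 / (4 * s)"] assms bdd s
    by auto
  have "\<exists>\<psi> :: 'a \<Rightarrow>\<^sub>L real. norm \<psi> \<le> 1 \<and> blinfun_apply \<psi> y = norm y" for y :: 'a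
    using norming_functional[of y] by blast
  then obtain \<psi> :: "'a \<Rightarrow> 'a \<Rightarrow>\<^sub>L real" where \<psi>: "\<And>y. norm (\<psi> y) \<le> 1" "\<And>y. \<psi> y y = norm y" by metis
  have \<psi>b: "\<bar>\<psi> y x\<bar> \<le> norm x" for x y
  proof -
    have "\<bar>\<psi> y x\<bar> \<le> norm (\<psi> y) * norm x" using norm_blinfun[of "\<psi> y" x] by simp
    also have "\<dots> \<le> 1 * norm x" using \<psi>(1) by (rule mult_right_mono) auto
    finally show ?thesis by simp
  qed
  have unit: "\<exists>y\<in>Y. 1/2 \<le> \<psi> y e" if e: "e \<in> span E" "norm e = 1" for e
  proof -
    obtain y where y: "y \<in> Y" "\<And>v. v \<in> E \<Longrightarrow> \<bar>g v e - g v y\<bar> < 1 / (4 * s)"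
      using net[of e] e by (auto simp: B_def)
    have "y \<in> span E" using y(1) Y(2) by (auto simp: B_def)
    have "e - y = (\<Sum>v\<in>E. g v e *\<^sub>R v) - (\<Sum>v\<in>E. g v y *\<^sub>R v)"
      by (rule arg_cong2[OF g[OF e(1)] g[OF \<open>y \<in> span E\<close>]])
    also have "\<dots> = (\<Sum>v\<in>E. (g v e - g v y) *\<^sub>R v)"
      by (simp add: sum_subtractf scaleR_diff_left)
    finally have "norm (e - y) \<le> (\<Sum>v\<in>E. \<bar>g v e - g v y\<bar> * norm v)"
      by (simp add: sum_norm_le)
    also have "\<dots> \<le> (\<Sum>v\<in>E. 1 / (4 * s) * norm v)"
      by (intro sum_mono mult_right_mono less_imp_le[OF y(2)]) auto
    also have "\<dots> = 1 / (4 * s) * (s - 1)" unfolding s_def by (simp only: sum_distrib_left add_diff_cancel_right')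
    also have "\<dots> \<le> 1/4" using s by (simp add: field_simps)
    finally have d: "norm (e - y) \<le> 1/4" .
    have "norm y \<ge> 3/4" using d e(2) norm_triangle_ineq2[of e y] by linarith
    moreover have "\<psi> y e = \<psi> y y + \<psi> y (e - y)" by (simp add: blinfun.diff_right)
    moreover have "\<bar>\<psi> y (e - y)\<bar> \<le> 1/4" using \<psi>b[of y "e - y"] d by linarith
    ultimately show ?thesis using y(1) \<psi>(2)[of y] by (intro bexI[of _ y]) auto
  qed
  have half: "\<exists>y\<in>Y. norm e \<le> 2 * \<bar>\<psi> y e\<bar>" if e: "e \<in> span E" "e \<noteq> 0" for e
  proof -
    have "e /\<^sub>R norm e \<in> span E" using e by (simp add: span_scale)
    then obtain y where "y \<in> Y" "1/2 \<le> \<psi> y (e /\<^sub>R norm e)" using unit e by force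
    then show ?thesis using e by (intro bexI[of _ y]) (auto simp: blinfun.scaleR_right field_simps)
  qed
  show ?thesis
  proof (rule that[of "\<psi> ` Y"])
    show "finite (\<psi> ` Y)" using Y by simp
    fix e w assume e: "e \<in> span E" and w: "w \<in> kern (\<psi> ` Y)"
    show "norm w \<le> 3 * norm (e + w)"
    proof (cases "e = 0")
      case False
      then obtain y where y: "y \<in> Y" "norm e \<le> 2 * \<bar>\<psi> y e\<bar>" using half e by blast
      have "\<psi> y (e + w) = \<psi> y e" using w y by (auto simp: kern_def blinfun.add_right)
      then have "norm e \<le> 2 * norm (e + w)" using y(2) \<psi>b[of y "e + w"] by simp
      then show ?thesis using norm_triangle_ineq4[of "e + w" e] by simp
    qed simp
  qed
qed

subsection \<open>Smooth convex functions on a space with separable dual\<close>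

lemma blinfun_abs_le: "\<bar>blinfun_apply (f :: 'a::real_normed_vector \<Rightarrow>\<^sub>L real) x\<bar> \<le> norm f * norm x"
  using norm_blinfun[of f x] by simp

lemma infdist_midpoint:
  fixes C :: "'a::real_normed_vector set"
  assumes "convex C" "C \<noteq> {}"
  shows "infdist ((1/2) *\<^sub>R (x + y)) C \<le> (infdist x C + infdist y C) / 2"
proof (rule field_le_epsilon)
  fix e :: real assume e: "e > 0"
  obtain a where a: "a \<in> C" "dist x a < infdist x C + e"
    using infdist_almost_attained[OF assms(2) e] by auto
  obtain b where b: "b \<in> C" "dist y b < infdist y C + e"
    using infdist_almost_attained[OF assms(2) e] by auto
  have "(1/2) *\<^sub>R a + (1/2) *\<^sub>R b \<in> C"
    using assms(1) a b by (intro convexD) auto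
  then have "infdist ((1/2) *\<^sub>R (x + y)) C \<le> dist ((1/2) *\<^sub>R (x + y)) ((1/2) *\<^sub>R a + (1/2) *\<^sub>R b)"
    by (rule infdist_le)
  also have "\<dots> = norm ((1/2) *\<^sub>R ((x - a) + (y - b)))"
    by (simp add: dist_norm algebra_simps)
  also have "\<dots> = norm ((x - a) + (y - b)) / 2" by simp
  also have "\<dots> \<le> (dist x a + dist y b) / 2"
    using norm_triangle_ineq[of "x - a" "y - b"] by (simp add: dist_norm)
  finally show "infdist ((1/2) *\<^sub>R (x + y)) C \<le> (infdist x C + infdist y C) / 2 + e"
    using add_strict_mono[OF a(2) b(2)] by (simp add: field_simps)
qed

text \<open>For \<open>m = (a + b) / 2\<close> this is an identity. It is the source of the strong
  convexity of \<open>R\<close>: a small midpoint defect forces \<open>a\<close> and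
  \<open>b\<close> together.\<close>

lemma square_midpoint_gap:
  fixes a b m :: real
  assumes "0 \<le> m" "m \<le> (a + b) / 2"
  shows "((a - b) / 2)\<^sup>2 \<le> a\<^sup>2 / 2 + b\<^sup>2 / 2 - m\<^sup>2"
proof -
  have "m\<^sup>2 \<le> ((a + b) / 2)\<^sup>2" using assms by (intro power_mono) auto
  then show ?thesis by (simp add: power2_eq_square field_simps)
qed

section \<open>Pointwise convergence in the dual: semicontinuity and passage to norm
  convergence\<close>

lemma pointwise_limit_norm_le:
  fixes \<phi> :: "nat \<Rightarrow> ('a::real_normed_vector \<Rightarrow>\<^sub>L real)"
  assumes lim: "\<And>y. (\<lambda>k. \<phi> k y) \<longlonglongrightarrow> blinfun_apply \<psi> y"
    and le: "\<And>k. norm (\<phi> k) \<le> B"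
  shows "norm \<psi> \<le> B"
proof (rule norm_blinfun_bound)
  show "0 \<le> B" using le[of 0] norm_ge_zero order_trans by blast
  fix y
  have "\<bar>\<phi> k y\<bar> \<le> B * norm y" for k
    using blinfun_abs_le[of "\<phi> k" y] mult_right_mono[OF le[of k], of "norm y"] by simp
  moreover have "(\<lambda>k. \<bar>\<phi> k y\<bar>) \<longlonglongrightarrow> \<bar>blinfun_apply \<psi> y\<bar>"
    by (intro tendsto_intros lim)
  ultimately show "norm (blinfun_apply \<psi> y) \<le> B * norm y"
    by (auto intro: LIMSEQ_le_const2)
qed

lemma pointwise_limit_norm_lsc:
  fixes \<phi> :: "nat \<Rightarrow> ('a::real_normed_vector \<Rightarrow>\<^sub>L real)"
  assumes lim: "\<And>y. (\<lambda>k. \<phi> k y) \<longlonglongrightarrow> blinfun_apply \<psi> y" and e: "e > 0"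
  shows "\<forall>\<^sub>F k in sequentially. norm \<psi> < norm (\<phi> k) + e"
proof (rule ccontr)
  assume "\<not> ?thesis"
  then obtain r :: "nat \<Rightarrow> nat" where r: "strict_mono r" "\<And>k. \<not> norm \<psi> < norm (\<phi> (r k)) + e"
    using not_eventually_sequentiallyD by blast
  have "norm \<psi> \<le> norm \<psi> - e"
  proof (rule pointwise_limit_norm_le)
    show "(\<lambda>k. blinfun_apply (\<phi> (r k)) y) \<longlonglongrightarrow> blinfun_apply \<psi> y" for y
      using LIMSEQ_subseq_LIMSEQ[OF lim r(1)] by (simp add: o_def)
    show "norm (\<phi> (r k)) \<le> norm \<psi> - e" for k using r(2)[of k] by linarith
  qed
  then show False using e by simp
qed

text \<open>The points \<open>h k\<close> of the compact set converge in norm along a subsequence,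
  so the differences still converge pointwise and their norm bound survives in the limit.\<close>

lemma pointwise_limit_compact_difference:
  fixes \<phi> :: "nat \<Rightarrow> ('a::real_normed_vector \<Rightarrow>\<^sub>L real)"
  assumes lim: "\<And>y. (\<lambda>k. \<phi> k y) \<longlonglongrightarrow> blinfun_apply \<psi> y" and r: "strict_mono (r :: nat \<Rightarrow> nat)"
    and C: "compact C" "\<And>k. h k \<in> C" and B: "\<And>k. dist (\<phi> (r k)) (h k) \<le> B"
  obtains l s where "l \<in> C" "(h \<circ> s) \<longlonglongrightarrow> l" "norm (\<psi> - l) \<le> B"
proof -
  obtain l s where ls: "l \<in> C" "strict_mono s" "(h \<circ> s) \<longlonglongrightarrow> l"
    using C unfolding compact_def by blast
  have "norm (\<psi> - l) \<le> B"
  proof (rule pointwise_limit_norm_le[of "\<lambda>k. \<phi> (r (s k)) - h (s k)"])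
    fix y
    have "(\<lambda>k. \<phi> (r (s k)) y) \<longlonglongrightarrow> blinfun_apply \<psi> y"
      using LIMSEQ_subseq_LIMSEQ[OF lim strict_mono_o[OF r ls(2)]] by (simp add: o_def)
    moreover have "(\<lambda>k. h (s k) y) \<longlonglongrightarrow> blinfun_apply l y"
      using ls(3) by (intro tendsto_intros) (simp add: o_def)
    ultimately show "(\<lambda>k. blinfun_apply (\<phi> (r (s k)) - h (s k)) y) \<longlonglongrightarrow> blinfun_apply (\<psi> - l) y"
      by (simp add: blinfun.diff_left tendsto_diff)
    show "norm (\<phi> (r (s k)) - h (s k)) \<le> B" for k
      using B[of "s k"] by (simp add: dist_norm)
  qed
  then show ?thesis using that ls by blast
qed

lemma pointwise_limit_infdist_lsc:
  fixes \<phi> :: "nat \<Rightarrow> ('a::real_normed_vector \<Rightarrow>\<^sub>L real)"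
  assumes lim: "\<And>y. (\<lambda>k. \<phi> k y) \<longlonglongrightarrow> blinfun_apply \<psi> y" and e: "e > 0"
    and C: "compact C" "C \<noteq> {}"
  shows "\<forall>\<^sub>F k in sequentially. infdist \<psi> C < infdist (\<phi> k) C + e"
proof (rule ccontr)
  assume "\<not> ?thesis"
  then obtain r :: "nat \<Rightarrow> nat" where r: "strict_mono r" "\<And>k. \<not> infdist \<psi> C < infdist (\<phi> (r k)) C + e"
    using not_eventually_sequentiallyD by blast
  have "\<exists>h\<in>C. dist (\<phi> (r k)) h < infdist (\<phi> (r k)) C + e / 2" for k
    using infdist_almost_attained[OF C(2)] e by simp
  then obtain h where h: "\<And>k. h k \<in> C" "\<And>k. dist (\<phi> (r k)) (h k) < infdist (\<phi> (r k)) C + e / 2"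
    by metis
  have le: "dist (\<phi> (r k)) (h k) \<le> infdist \<psi> C - e / 2" for k using h(2)[of k] r(2)[of k] by linarith
  obtain l where l: "l \<in> C" "norm (\<psi> - l) \<le> infdist \<psi> C - e / 2"
    by (rule pointwise_limit_compact_difference[OF lim r(1) C(1) h(1) le])
  have "infdist \<psi> C \<le> norm (\<psi> - l)" using infdist_le[OF l(1), of \<psi>] by (simp add: dist_norm)
  then show False using l(2) e by simp
qed

text \<open>A Kadec-Klee property: once the \<open>\<phi> k\<close> are within \<open>e\<close> of
  one compact set, their approximants there accumulate at some \<open>l\<close>, and
  \<open>l\<close> is within \<open>e\<close> of \<psi> by semicontinuity. Hence some
  \<open>\<phi> k\<close> of any given subsequence is within \<open>3 * e\<close> of \<psi>.\<close>

lemma pointwise_limit_strong: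
  fixes \<phi> :: "nat \<Rightarrow> ('a::real_normed_vector \<Rightarrow>\<^sub>L real)"
  assumes lim: "\<And>y. (\<lambda>k. \<phi> k y) \<longlonglongrightarrow> blinfun_apply \<psi> y"
    and C: "\<And>n. compact (C n)" "\<And>n. C n \<noteq> {}"
    and dense: "\<And>e. e > 0 \<Longrightarrow> \<exists>n. infdist \<psi> (C n) < e"
    and conv: "\<And>n. (\<lambda>k. infdist (\<phi> k) (C n)) \<longlonglongrightarrow> infdist \<psi> (C n)"
  shows "\<phi> \<longlonglongrightarrow> \<psi>"
proof (rule tendstoI)
  fix e' :: real assume e': "e' > 0"
  define e where "e = e' / 5"
  have e: "e > 0" using e' by (simp add: e_def)
  obtain n where n: "infdist \<psi> (C n) < e" using dense[OF e] by blast
  have ev: "\<forall>\<^sub>F k in sequentially. infdist (\<phi> k) (C n) < e"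
    using order_tendstoD(2)[OF conv n] .
  show "\<forall>\<^sub>F k in sequentially. dist (\<phi> k) \<psi> < e'"
  proof (rule ccontr)
    assume "\<not> ?thesis"
    have "\<not> (\<forall>\<^sub>F k in sequentially. infdist (\<phi> k) (C n) < e \<longrightarrow> dist (\<phi> k) \<psi> < e')"
    proof
      assume "\<forall>\<^sub>F k in sequentially. infdist (\<phi> k) (C n) < e \<longrightarrow> dist (\<phi> k) \<psi> < e'"
      with ev have "\<forall>\<^sub>F k in sequentially. dist (\<phi> k) \<psi> < e'" by eventually_elim simp
      with \<open>\<not> (\<forall>\<^sub>F k in sequentially. dist (\<phi> k) \<psi> < e')\<close> show False ..
    qed
    then obtain r :: "nat \<Rightarrow> nat" where r0: "strict_mono r"
      "\<forall>k. \<not> (infdist (\<phi> (r k)) (C n) < e \<longrightarrow> dist (\<phi> (r k)) \<psi> < e')"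
      using not_eventually_sequentiallyD by blast
    then have r: "strict_mono r" "\<And>k. infdist (\<phi> (r k)) (C n) < e" "\<And>k. \<not> dist (\<phi> (r k)) \<psi> < e'"
      by auto
    have "\<exists>h\<in>C n. dist (\<phi> (r k)) h < e" for k
      using infdist_almost_attained[OF C(2)[of n], where e="e - infdist (\<phi> (r k)) (C n)" and x="\<phi> (r k)"] r(2)[of k] by auto
    then obtain h where h: "\<And>k. h k \<in> C n" "\<And>k. dist (\<phi> (r k)) (h k) < e" by metis
    obtain l s where ls: "l \<in> C n" "(h \<circ> s) \<longlonglongrightarrow> l" "norm (\<psi> - l) \<le> e"
      by (rule pointwise_limit_compact_difference[OF lim r(1) C(1) h(1) less_imp_le[OF h(2)]])
    have "\<forall>\<^sub>F k in sequentially. dist ((h \<circ> s) k) l < e"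
      using ls(2) e by (rule tendstoD)
    then obtain k where "dist (h (s k)) l < e"
      by (auto simp: eventually_sequentially)
    moreover have "dist (\<phi> (r (s k))) \<psi> \<le> dist (\<phi> (r (s k))) (h (s k)) + dist (h (s k)) l + dist l \<psi>"
      by metric
    ultimately have "dist (\<phi> (r (s k))) \<psi> < e + e + e"
      using h(2)[of "s k"] ls(3) by (simp add: dist_norm norm_minus_commute)
    then show False using r(3)[of "s k"] e' by (simp add: e_def)
  qed
qed

text \<open>Takes the place of weak-star compactness: maximizing sequences will turn out to be
  Cauchy at every \<open>d n\<close>, so boundedness alone produces the limit functional.\<close>

lemma bounded_pointwise_Cauchy_limit:
  fixes \<phi> :: "nat \<Rightarrow> ('a::real_normed_vector \<Rightarrow>\<^sub>L real)"
  assumes bdd: "\<And>k. norm (\<phi> k) \<le> B"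
    and dense: "\<And>y e. e > 0 \<Longrightarrow> \<exists>n. norm (y - d n) < e"
    and Cau: "\<And>n. Cauchy (\<lambda>k. \<phi> k (d n))"
  obtains \<psi> where "\<And>y. (\<lambda>k. \<phi> k y) \<longlonglongrightarrow> blinfun_apply \<psi> y"
proof -
  have B: "B \<ge> 0" using bdd[of 0] norm_ge_zero order_trans by blast
  have "Cauchy (\<lambda>k. \<phi> k y)" for y
  proof (rule metric_CauchyI)
    fix e :: real assume e: "e > 0"
    obtain n where n: "norm (y - d n) < e / (3 * (B + 1))"
      using dense[of "e / (3 * (B + 1))" y] e B by auto
    have "B * norm (y - d n) \<le> (B + 1) * (e / (3 * (B + 1)))"
      using n B by (intro mult_mono) auto
    moreover have "(B + 1) * (e / (3 * (B + 1))) = e / 3" using B by (auto simp: field_simps)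
    ultimately have Bn: "B * norm (y - d n) \<le> e / 3" by linarith
    have c: "\<bar>\<phi> k (y - d n)\<bar> \<le> e / 3" for k
      using blinfun_abs_le[of "\<phi> k" "y - d n"] mult_right_mono[OF bdd[of k], of "norm (y - d n)"] Bn by simp
    obtain M where M: "\<And>i j. i \<ge> M \<Longrightarrow> j \<ge> M \<Longrightarrow> dist (\<phi> i (d n)) (\<phi> j (d n)) < e / 3"
      using metric_CauchyD[OF Cau[of n], of "e / 3"] e by auto
    have "dist (\<phi> i y) (\<phi> j y) < e" if "i \<ge> M" "j \<ge> M" for i j
      using M[OF that] c[of i] c[of j] unfolding dist_real_def blinfun.diff_right by linarith
    then show "\<exists>M. \<forall>i\<ge>M. \<forall>j\<ge>M. dist (\<phi> i y) (\<phi> j y) < e" by blast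
  qed
  then have "\<exists>l. (\<lambda>k. \<phi> k y) \<longlonglongrightarrow> l" for y
    using Cauchy_convergent convergent_def by blast
  then obtain g where g: "\<And>y. (\<lambda>k. \<phi> k y) \<longlonglongrightarrow> g y" by metis
  have "bounded_linear g"
  proof (rule bounded_linear_intro[of g B])
    show "g (x + y) = g x + g y" for x y
    proof -
      have "(\<lambda>k. \<phi> k (x + y)) \<longlonglongrightarrow> g x + g y"
        unfolding blinfun.add_right by (intro tendsto_intros g)
      then show ?thesis using g LIMSEQ_unique by blast
    qed
    show "g (r *\<^sub>R x) = r *\<^sub>R g x" for r x
    proof -
      have "(\<lambda>k. \<phi> k (r *\<^sub>R x)) \<longlonglongrightarrow> r *\<^sub>R g x"
        unfolding blinfun.scaleR_right by (intro tendsto_intros g)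
      then show ?thesis using g LIMSEQ_unique by blast
    qed
    show "norm (g y) \<le> norm y * B" for y
    proof -
      have "norm (\<phi> k y) \<le> norm y * B" for k
        using norm_blinfun[of "\<phi> k" y] mult_right_mono[OF bdd[of k], of "norm y"] by (simp add: mult.commute)
      moreover have "(\<lambda>k. norm (\<phi> k y)) \<longlonglongrightarrow> norm (g y)"
        by (intro tendsto_intros g)
      ultimately show ?thesis by (auto intro: LIMSEQ_le_const2)
    qed
  qed
  then show ?thesis using g that[of "Blinfun g"] by (simp add: bounded_linear_Blinfun_apply)
qed

section \<open>Kadec-type renorming of the dual\<close>

locale dense_sequences =
  fixes d :: "nat \<Rightarrow> 'a::real_normed_vector" and f :: "nat \<Rightarrow> 'a \<Rightarrow>\<^sub>L real"
  assumes d_dense: "\<And>y e. e > 0 \<Longrightarrow> \<exists>n. norm (y - d n) < e"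
    and f_dense: "\<And>\<phi> e. e > 0 \<Longrightarrow> \<exists>n. norm (\<phi> - f n) < e"
begin

text \<open>Sums of the segments from 0 to \<open>f k\<close> with \<open>k < n\<close>: an explicit
  increasing family of compact convex sets containing 0, whose union is dense because it contains
  every \<open>f n\<close>.\<close>

fun C :: "nat \<Rightarrow> ('a \<Rightarrow>\<^sub>L real) set" where
  "C 0 = {0}"
| "C (Suc n) = {a + b | a b. a \<in> C n \<and> b \<in> (\<lambda>t. t *\<^sub>R f n) ` {0..1}}"

lemma zero_in_C: "0 \<in> C n"
  by (induction n) (auto intro!: exI[of _ 0] image_eqI[of _ _ 0])

lemma C_nonempty: "C n \<noteq> {}" using zero_in_C by auto

lemma compact_C: "compact (C n)"
proof (induction n)
  case (Suc n)
  have "compact ((\<lambda>t. t *\<^sub>R f n) ` {0..1::real})"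
    by (intro compact_continuous_image continuous_intros compact_Icc)
  then show ?case using compact_sums[OF Suc] by simp
qed simp

lemma convex_C: "convex (C n)"
proof (induction n)
  case (Suc n)
  have "convex ((\<lambda>t. t *\<^sub>R f n) ` {0..1::real})"
    by (rule convex_linear_image) (auto simp: linear_scaleR_left)
  then have "convex (\<Union>x\<in>C n. \<Union>y\<in>(\<lambda>t. t *\<^sub>R f n) ` {0..1::real}. {x + y})"
    by (rule convex_sums[OF Suc])
  moreover have "(\<Union>x\<in>C n. \<Union>y\<in>(\<lambda>t. t *\<^sub>R f n) ` {0..1::real}. {x + y}) = C (Suc n)" by auto
  ultimately show ?case by simp
qed simp

lemma f_in_C: "f n \<in> C (Suc n)"
proof -
  have "f n = 0 + 1 *\<^sub>R f n" by simp
  moreover have "1 *\<^sub>R f n \<in> (\<lambda>t. t *\<^sub>R f n) ` {0..1::real}" by (rule imageI) simp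
  ultimately show ?thesis unfolding C.simps using zero_in_C[of n] by blast
qed

lemma C_dense: "e > 0 \<Longrightarrow> \<exists>n. infdist \<phi> (C n) < e"
  using f_dense[of e \<phi>] infdist_le[OF f_in_C, of \<phi>] by (metis dist_norm le_less_trans)

definition q :: "nat \<Rightarrow> ('a \<Rightarrow>\<^sub>L real) \<Rightarrow> real" where "q n \<phi> = infdist \<phi> (C n)"
definition u :: "nat \<Rightarrow> ('a \<Rightarrow>\<^sub>L real) \<Rightarrow> real" where "u n \<phi> = blinfun_apply \<phi> (d n) / (1 + norm (d n))"
text \<open>The \<open>u\<close> terms will make maximizing sequences converge pointwise, and the
  \<open>q\<close> terms will upgrade this to norm convergence. All terms are bounded by the squared
  norm, which is why \<open>u\<close> is normalized; hence \<open>R\<close> lies between one and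
  three times the squared norm.\<close>

definition R :: "('a \<Rightarrow>\<^sub>L real) \<Rightarrow> real" where
  "R \<phi> = (norm \<phi>)\<^sup>2 + (\<Sum>n. (1/2) ^ Suc n * ((q n \<phi>)\<^sup>2 + (u n \<phi>)\<^sup>2))"

lemma q_nonneg: "0 \<le> q n \<phi>" by (simp add: q_def infdist_nonneg)

lemma q_le: "q n \<phi> \<le> norm \<phi>"
  using infdist_le[OF zero_in_C, of \<phi> n] by (simp add: q_def dist_norm)

lemma u_le: "\<bar>u n \<phi>\<bar> \<le> norm \<phi>"
proof -
  have "\<bar>u n \<phi>\<bar> = \<bar>blinfun_apply \<phi> (d n)\<bar> / (1 + norm (d n))" by (simp add: u_def abs_divide add_nonneg_pos)
  also have "\<dots> \<le> (norm \<phi> * norm (d n)) / (1 + norm (d n))"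
    by (intro divide_right_mono blinfun_abs_le) simp
  also have "\<dots> \<le> norm \<phi>"
    using add_pos_nonneg[of 1 "norm (d n)"] by (simp add: divide_le_eq algebra_simps)
  finally show ?thesis .
qed

lemma term_le: "(q n \<phi>)\<^sup>2 + (u n \<phi>)\<^sup>2 \<le> 2 * (norm \<phi>)\<^sup>2"
  using power_mono[OF q_le q_nonneg, of n \<phi> 2] power_mono[OF u_le[of n \<phi>], of 2] by simp

lemma geo_sums: "(\<lambda>n. (1/2::real) ^ Suc n * c) sums c"
  using sums_mult2[OF power_half_series, of c] by simp

lemma R_summable: "summable (\<lambda>n. (1/2) ^ Suc n * ((q n \<phi>)\<^sup>2 + (u n \<phi>)\<^sup>2))"
proof (rule summable_comparison_test'[where N = 0])
  show "summable (\<lambda>n. (1/2) ^ Suc n * (2 * (norm \<phi>)\<^sup>2))" using geo_sums sums_summable by blast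
  show "norm ((1/2) ^ Suc n * ((q n \<phi>)\<^sup>2 + (u n \<phi>)\<^sup>2)) \<le> (1/2) ^ Suc n * (2 * (norm \<phi>)\<^sup>2)" for n
    unfolding norm_mult using term_le[of n \<phi>] by (intro mult_mono) auto
qed

lemma R_ge: "(norm \<phi>)\<^sup>2 \<le> R \<phi>"
proof -
  have "0 \<le> (\<Sum>n. (1/2) ^ Suc n * ((q n \<phi>)\<^sup>2 + (u n \<phi>)\<^sup>2))"
    by (rule suminf_nonneg[OF R_summable]) simp
  then show ?thesis unfolding R_def by linarith
qed

lemma R_le: "R \<phi> \<le> 3 * (norm \<phi>)\<^sup>2"
proof -
  have "(\<Sum>n. (1/2) ^ Suc n * ((q n \<phi>)\<^sup>2 + (u n \<phi>)\<^sup>2)) \<le> (\<Sum>n. (1/2) ^ Suc n * (2 * (norm \<phi>)\<^sup>2))"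
    by (intro suminf_le R_summable mult_left_mono term_le sums_summable[OF geo_sums]) simp
  also have "\<dots> = 2 * (norm \<phi>)\<^sup>2" using geo_sums sums_unique by metis
  finally show ?thesis by (simp add: R_def)
qed

text \<open>Every summand of \<open>R\<close> has a nonnegative midpoint defect, so the defect of
  the sum dominates that of the single term \<open>n\<close>.\<close>

lemma R_gap:
  "(1/2) ^ Suc n * (((q n \<phi> - q n \<psi>) / 2)\<^sup>2 + ((u n \<phi> - u n \<psi>) / 2)\<^sup>2)
    \<le> R \<phi> / 2 + R \<psi> / 2 - R ((1/2) *\<^sub>R (\<phi> + \<psi>))"
proof -
  define m where "m = (1/2) *\<^sub>R (\<phi> + \<psi>)"
  define t where "t \<eta> n = (1/2) ^ Suc n * ((q n \<eta>)\<^sup>2 + (u n \<eta>)\<^sup>2)" for \<eta> n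
  define g where "g n = t \<phi> n / 2 + t \<psi> n / 2 - t m n" for n
  have gap: "(1/2) ^ Suc n * (((q n \<phi> - q n \<psi>) / 2)\<^sup>2 + ((u n \<phi> - u n \<psi>) / 2)\<^sup>2) \<le> g n" for n
  proof -
    have 1: "((q n \<phi> - q n \<psi>) / 2)\<^sup>2 \<le> (q n \<phi>)\<^sup>2 / 2 + (q n \<psi>)\<^sup>2 / 2 - (q n m)\<^sup>2"
      unfolding m_def by (rule square_midpoint_gap[OF q_nonneg])
        (use infdist_midpoint[OF convex_C C_nonempty] in \<open>simp add: q_def\<close>)
    have "u n m = (u n \<phi> + u n \<psi>) / 2"
      by (simp add: m_def u_def blinfun.bilinear_simps add_divide_distrib mult.commute)
    then have 2: "((u n \<phi> - u n \<psi>) / 2)\<^sup>2 = (u n \<phi>)\<^sup>2 / 2 + (u n \<psi>)\<^sup>2 / 2 - (u n m)\<^sup>2"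
      by (simp only:) (simp add: power2_eq_square field_simps)
    have "(1/2) ^ Suc n * (((q n \<phi> - q n \<psi>) / 2)\<^sup>2 + ((u n \<phi> - u n \<psi>) / 2)\<^sup>2) \<le>
        (1/2) ^ Suc n * (((q n \<phi>)\<^sup>2 / 2 + (q n \<psi>)\<^sup>2 / 2 - (q n m)\<^sup>2) + ((u n \<phi>)\<^sup>2 / 2 + (u n \<psi>)\<^sup>2 / 2 - (u n m)\<^sup>2))"
      using 1 2 by (intro mult_left_mono) auto
    also have "\<dots> = g n" unfolding g_def t_def by (simp add: algebra_simps add_divide_distrib)
    finally show ?thesis .
  qed
  have g0: "0 \<le> g n" for n by (rule order_trans[OF _ gap]) simp
  have st: "summable (t \<eta>)" for \<eta> unfolding t_def by (rule R_summable)
  have sg: "summable g" unfolding g_def by (intro summable_diff summable_add summable_divide st)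
  have "g n = (\<Sum>k\<in>{n}. g k)" by simp
  also have "\<dots> \<le> suminf g" by (rule sum_le_suminf[OF sg]) (use g0 in auto)
  also have "\<dots> = suminf (t \<phi>) / 2 + suminf (t \<psi>) / 2 - suminf (t m)"
    unfolding g_def using st
    by (simp add: suminf_diff suminf_add suminf_divide summable_add summable_divide flip: suminf_diff suminf_add suminf_divide)
  also have "\<dots> \<le> R \<phi> / 2 + R \<psi> / 2 - R m"
  proof -
    have "norm m \<le> (norm \<phi> + norm \<psi>) / 2" using norm_triangle_ineq[of \<phi> \<psi>] by (simp add: m_def)
    from square_midpoint_gap[OF norm_ge_zero this]
    have "0 \<le> (norm \<phi>)\<^sup>2 / 2 + (norm \<psi>)\<^sup>2 / 2 - (norm m)\<^sup>2" by (rule order_trans[rotated]) simp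
    then show ?thesis unfolding R_def t_def by (simp add: add_divide_distrib)
  qed
  finally show ?thesis using gap[of n] by (simp add: m_def)
qed

section \<open>The conjugate function on a quotient\<close>

definition ann :: "'a set \<Rightarrow> ('a \<Rightarrow>\<^sub>L real) set" where
  "ann E = {\<phi>. \<forall>v\<in>E. blinfun_apply \<phi> v = 0}"
definition val :: "'a \<Rightarrow> ('a \<Rightarrow>\<^sub>L real) \<Rightarrow> real" where
  "val x \<phi> = 2 * blinfun_apply \<phi> x - R \<phi>"
text \<open>Up to the factor 2, the Fenchel conjugate of \<open>R\<close> restricted to the
  annihilator of \<open>E\<close>. As the annihilator is the dual of the quotient by the closed
  span, this is a function on the quotient, expressed without a quotient type; with the squared norm
  in place of \<open>R\<close> it would be the squared distance to \<open>span E\<close>.\<close>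

definition conj_fun :: "'a set \<Rightarrow> 'a \<Rightarrow> real" where
  "conj_fun E x = Sup (val x ` ann E)"

lemma zero_in_ann: "0 \<in> ann E" by (simp add: ann_def)

lemma ann_bound:
  assumes "\<phi> \<in> ann E"
  shows "\<bar>\<phi> x\<bar> \<le> norm \<phi> * infdist x (span E)"
proof (rule field_le_epsilon)
  fix e :: real assume e: "e > 0"
  have ne: "span E \<noteq> {}" using span_zero by auto
  have nz: "norm \<phi> + 1 > 0" by (simp add: add_nonneg_pos)
  obtain a where a: "a \<in> span E" "dist x a < infdist x (span E) + e / (norm \<phi> + 1)"
    using infdist_almost_attained[OF ne, where e = "e / (norm \<phi> + 1)" and x = x] e nz by auto
  have "\<phi> a = 0"
    using a(1)
  proof (induction rule: span_induct_alt)
    case (step c y z)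
    then show ?case using assms by (simp add: ann_def blinfun.bilinear_simps)
  qed simp
  then have "\<bar>\<phi> x\<bar> = \<bar>\<phi> (x - a)\<bar>" by (simp add: blinfun.diff_right)
  also have "\<dots> \<le> norm \<phi> * dist x a" using blinfun_abs_le[of \<phi> "x - a"] by (simp add: dist_norm)
  also have "\<dots> \<le> norm \<phi> * (infdist x (span E) + e / (norm \<phi> + 1))"
    using a(2) by (intro mult_left_mono) auto
  also have "norm \<phi> * (e / (norm \<phi> + 1)) \<le> e" using e nz by (simp add: divide_le_eq algebra_simps)
  then have "norm \<phi> * (infdist x (span E) + e / (norm \<phi> + 1)) \<le> norm \<phi> * infdist x (span E) + e"
    by (simp add: algebra_simps)
  finally show "\<bar>\<phi> x\<bar> \<le> norm \<phi> * infdist x (span E) + e" .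
qed

lemma val_le_norm:
  assumes "\<phi> \<in> ann E"
  shows "val x \<phi> \<le> 2 * (norm \<phi> * infdist x (span E)) - (norm \<phi>)\<^sup>2"
  using ann_bound[OF assms, of x] R_ge[of \<phi>] by (simp add: val_def)

lemma val_le:
  assumes "\<phi> \<in> ann E"
  shows "val x \<phi> \<le> (infdist x (span E))\<^sup>2"
proof -
  have "0 \<le> (norm \<phi> - infdist x (span E))\<^sup>2" by simp
  then show ?thesis using val_le_norm[OF assms, of x] by (simp add: power2_diff)
qed

lemma bdd_val: "bdd_above (val x ` ann E)"
  using val_le by (auto intro!: bdd_aboveI)

lemma conj_fun_upper: "\<phi> \<in> ann E \<Longrightarrow> val x \<phi> \<le> conj_fun E x"
  unfolding conj_fun_def by (rule cSup_upper[OF _ bdd_val]) simp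

lemma conj_fun_le: "conj_fun E x \<le> (infdist x (span E))\<^sup>2"
  unfolding conj_fun_def by (rule cSup_least) (use val_le zero_in_ann[of E] in auto)

lemma conj_fun_ge: "(infdist x (span E))\<^sup>2 / 4 \<le> conj_fun E x"
proof -
  define D where "D = infdist x (span E)"
  obtain \<phi> :: "'a \<Rightarrow>\<^sub>L real" where \<phi>: "norm \<phi> \<le> 1" "\<phi> x = D"
      "\<And>v. v \<in> span E \<Longrightarrow> \<phi> v = 0"
    using separating_functional[of x E] unfolding D_def by metis
  have D: "D \<ge> 0" by (simp add: D_def infdist_nonneg)
  \<comment> \<open>Since \<open>R\<close> is at most three times the squared norm, the multiple
    \<open>t\<close> of \<phi> has value at least \<open>2 * t * D - 3 * t\<^sup>2\<close>, which is
    largest at \<open>t = D / 3\<close>.\<close>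
  define \<psi> where "\<psi> = (D / 3) *\<^sub>R \<phi>"
  have "\<psi> \<in> ann E" using \<phi>(3) by (auto simp: \<psi>_def ann_def blinfun.scaleR_left span_base)
  have "norm \<psi> \<le> D / 3" using \<phi>(1) D by (simp add: \<psi>_def mult_left_le)
  then have "(norm \<psi>)\<^sup>2 \<le> (D / 3)\<^sup>2" by (rule power_mono) simp
  then have "R \<psi> \<le> D\<^sup>2 / 3" using R_le[of \<psi>] by (simp add: power_divide)
  moreover have "\<psi> x = D\<^sup>2 / 3"
    by (simp add: \<psi>_def blinfun.scaleR_left \<phi>(2) power2_eq_square)
  ultimately have "D\<^sup>2 / 3 \<le> val x \<psi>" by (simp add: val_def)
  then have "D\<^sup>2 / 3 \<le> conj_fun E x" using conj_fun_upper[OF \<open>\<psi> \<in> ann E\<close>, of x] by linarith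
  moreover have "D\<^sup>2 / 4 \<le> D\<^sup>2 / 3" by simp
  ultimately show ?thesis unfolding D_def by linarith
qed

lemma conj_fun_nonneg: "0 \<le> conj_fun E x"
  using conj_fun_ge[of x E] by (rule order_trans[rotated]) simp

text \<open>The midpoint of two competitors is a competitor, so the convexity defect of
  \<open>R\<close> is at most their average distance from the supremum.\<close>

lemma maximizing_gap:
  assumes "\<phi> \<in> ann E" "\<psi> \<in> ann E"
  shows "(1/2) ^ Suc n * (((q n \<phi> - q n \<psi>) / 2)\<^sup>2 + ((u n \<phi> - u n \<psi>) / 2)\<^sup>2)
    \<le> ((conj_fun E x - val x \<phi>) + (conj_fun E x - val x \<psi>)) / 2"
proof -
  have "(1/2) *\<^sub>R (\<phi> + \<psi>) \<in> ann E" using assms by (simp add: ann_def blinfun.bilinear_simps)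
  from conj_fun_upper[OF this, of x]
  have "\<phi> x + \<psi> x - R ((1/2) *\<^sub>R (\<phi> + \<psi>)) \<le> conj_fun E x"
    by (simp add: val_def blinfun.bilinear_simps add_divide_distrib)
  moreover have "((conj_fun E x - val x \<phi>) + (conj_fun E x - val x \<psi>)) / 2
      = conj_fun E x - (\<phi> x + \<psi> x) + (R \<phi> / 2 + R \<psi> / 2)"
    by (simp add: val_def field_simps)
  ultimately show ?thesis by (intro order_trans[OF R_gap[of n \<phi> \<psi>]]) linarith
qed

lemma maximizing_diff:
  assumes "\<phi> \<in> ann E" "\<psi> \<in> ann E" and e: "e > 0"
    and "conj_fun E x - val x \<phi> < (1/2) ^ Suc n * (e / 2)\<^sup>2" "conj_fun E x - val x \<psi> < (1/2) ^ Suc n * (e / 2)\<^sup>2"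
  shows "\<bar>q n \<phi> - q n \<psi>\<bar> < e" "\<bar>u n \<phi> - u n \<psi>\<bar> < e"
proof -
  have "(1/2) ^ Suc n * (((q n \<phi> - q n \<psi>) / 2)\<^sup>2 + ((u n \<phi> - u n \<psi>) / 2)\<^sup>2) < (1/2) ^ Suc n * (e / 2)\<^sup>2"
  proof (rule le_less_trans[OF maximizing_gap[OF assms(1,2), of n x]])
    have "(a + b) / 2 < c" if "a < c" "b < c" for a b c :: real using that by simp
    then show "((conj_fun E x - val x \<phi>) + (conj_fun E x - val x \<psi>)) / 2 < (1/2) ^ Suc n * (e / 2)\<^sup>2"
      using assms(4,5) by blast
  qed
  then have *: "((q n \<phi> - q n \<psi>) / 2)\<^sup>2 + ((u n \<phi> - u n \<psi>) / 2)\<^sup>2 < (e / 2)\<^sup>2"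
    by (rule mult_left_less_imp_less) simp
  have "\<bar>q n \<phi> - q n \<psi>\<bar>\<^sup>2 < e\<^sup>2" "\<bar>u n \<phi> - u n \<psi>\<bar>\<^sup>2 < e\<^sup>2"
  proof -
    have "a < c" "b < c" if "a + b < c" "0 \<le> a" "0 \<le> b" for a b c :: real using that by auto
    from this[OF *[unfolded power_divide, simplified] zero_le_power2 zero_le_power2]
    show "\<bar>q n \<phi> - q n \<psi>\<bar>\<^sup>2 < e\<^sup>2" "\<bar>u n \<phi> - u n \<psi>\<bar>\<^sup>2 < e\<^sup>2" by simp_all
  qed
  then show "\<bar>q n \<phi> - q n \<psi>\<bar> < e" "\<bar>u n \<phi> - u n \<psi>\<bar> < e"
    using e by (auto intro: power2_less_imp_less)
qed

lemma maximizing_bounded: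
  assumes "\<phi> \<in> ann E" "- B \<le> val x \<phi>" "B \<ge> 0"
  shows "norm \<phi> \<le> 2 * norm x + B + 1"
proof (rule ccontr)
  assume "\<not> ?thesis"
  then have less: "B + 1 < norm \<phi> - 2 * norm x" and 1: "1 < norm \<phi>"
    using assms(3) norm_ge_zero[of x] by linarith+
  have "1 * (B + 1) \<le> norm \<phi> * (norm \<phi> - 2 * norm x)"
    using less 1 assms(3) by (intro mult_mono) auto
  moreover have "norm \<phi> * infdist x (span E) \<le> norm \<phi> * norm x"
    by (intro mult_left_mono infdist_span_le_norm) simp
  ultimately show False
    using val_le_norm[OF assms(1), of x] assms(2) by (simp add: power2_eq_square algebra_simps)
qed

text \<open>Well-posedness of the maximization, from which attainment, uniqueness and continuity all
  follow. The gap makes the \<open>u\<close> values Cauchy; semicontinuity of \<open>R\<close> shows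
  that the pointwise limit is a maximizer; the gap between the sequence and this maximizer then
  gives convergence of all \<open>q n\<close>, hence norm convergence.\<close>

lemma maximizing_sequence_converges:
  assumes K: "\<And>k. \<phi> k \<in> ann E" and max: "(\<lambda>k. val x (\<phi> k)) \<longlonglongrightarrow> conj_fun E x"
  obtains \<psi> where "\<psi> \<in> ann E" "val x \<psi> = conj_fun E x" "\<phi> \<longlonglongrightarrow> \<psi>"
proof -
  have ev: "\<forall>\<^sub>F k in sequentially. conj_fun E x - val x (\<phi> k) < e" if "e > 0" for e
    using order_tendstoD(1)[OF max, of "conj_fun E x - e"] that by (auto elim: eventually_mono)
  obtain B0 where B0: "\<And>k. \<bar>val x (\<phi> k)\<bar> \<le> B0"
    using max by (metis Bseq_def convergentI convergent_imp_Bseq real_norm_def)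
  have bdd: "norm (\<phi> k) \<le> 2 * norm x + \<bar>B0\<bar> + 1" for k
    by (rule maximizing_bounded[OF K]) (use B0[of k] in auto)
  have Cau: "Cauchy (\<lambda>k. \<phi> k (d n))" for n
  proof -
    have pos: "1 + norm (d n) > 0" by (simp add: add_pos_nonneg)
    have "Cauchy (\<lambda>k. u n (\<phi> k))"
    proof (rule metric_CauchyI)
      fix e :: real assume e: "e > 0"
      then obtain M where "\<And>k. k \<ge> M \<Longrightarrow> conj_fun E x - val x (\<phi> k) < (1/2) ^ Suc n * (e / 2)\<^sup>2"
        using ev[of "(1/2) ^ Suc n * (e / 2)\<^sup>2"] by (auto simp: eventually_sequentially)
      then show "\<exists>M. \<forall>i\<ge>M. \<forall>j\<ge>M. dist (u n (\<phi> i)) (u n (\<phi> j)) < e"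
        using maximizing_diff(2)[OF K K e, where n = n and x = x] unfolding dist_real_def by blast
    qed
    then have "convergent (\<lambda>k. u n (\<phi> k) * (1 + norm (d n)))"
      by (intro convergent_mult convergent_const) (rule Cauchy_convergent)
    then show ?thesis using pos by (simp add: u_def convergent_Cauchy)
  qed
  obtain \<psi> :: "'a \<Rightarrow>\<^sub>L real" where \<psi>: "\<And>y. (\<lambda>k. \<phi> k y) \<longlonglongrightarrow> \<psi> y"
    using bounded_pointwise_Cauchy_limit[OF bdd d_dense Cau] by blast
  have \<psi>K: "\<psi> \<in> ann E"
  proof -
    have "\<psi> v = 0" if "v \<in> E" for v
      using \<psi>[of v] K that by (simp add: ann_def LIMSEQ_const_iff)
    then show ?thesis by (simp add: ann_def)
  qed
  define c where "c = 2 * \<psi> x - conj_fun E x"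
  have Rlim: "(\<lambda>k. R (\<phi> k)) \<longlonglongrightarrow> c"
  proof -
    have "(\<lambda>k. 2 * \<phi> k x - val x (\<phi> k)) \<longlonglongrightarrow> c"
      unfolding c_def by (intro tendsto_intros \<psi> max)
    then show ?thesis by (simp add: val_def)
  qed
  have qlsc: "\<forall>\<^sub>F k in sequentially. q n \<psi> < q n (\<phi> k) + e" if "e > 0" for n e
    unfolding q_def by (rule pointwise_limit_infdist_lsc[OF \<psi> that compact_C C_nonempty])
  define tm where "tm n \<eta> = (1/2) ^ Suc n * ((q n \<eta>)\<^sup>2 + (u n \<eta>)\<^sup>2)" for n \<eta>
  have sqlsc: "\<forall>\<^sub>F k in sequentially. a\<^sup>2 < (b k)\<^sup>2 + e"
    if lsc: "\<And>e. e > 0 \<Longrightarrow> \<forall>\<^sub>F k in sequentially. a < b k + e" and "e > 0" "a \<ge> 0" and bn: "\<And>k. b k \<ge> 0"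
    for a :: real and b :: "nat \<Rightarrow> real" and e
  proof -
    define e' where "e' = e / (2 * a + 1)"
    have e': "e' > 0" "2 * a * e' < e" using that by (auto simp: e'_def field_simps)
    show ?thesis using lsc[OF e'(1)]
    proof eventually_elim
      case (elim k)
      show ?case
      proof (cases "a \<le> e'")
        case True
        then have "a * a \<le> a * e'" using that(3) by (rule mult_left_mono)
        moreover have "a * e' \<le> 2 * a * e'" using that(3) e'(1) by simp
        ultimately show ?thesis using e'(2) zero_le_power2[of "b k"] unfolding power2_eq_square by linarith
      next
        case False
        have "(a - e')\<^sup>2 \<le> (b k)\<^sup>2" using False elim by (intro power_mono) auto
        then show ?thesis using e'(2) zero_le_power2[of e'] unfolding power2_diff by linarith
      qed
    qed
  qed
  have tmlsc: "\<forall>\<^sub>F k in sequentially. tm n \<psi> < tm n (\<phi> k) + e" if "e > 0" for n e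
  proof -
    have "\<forall>\<^sub>F k in sequentially. (q n \<psi>)\<^sup>2 < (q n (\<phi> k))\<^sup>2 + e"
      by (rule sqlsc[OF qlsc that q_nonneg q_nonneg])
    moreover have "(\<lambda>k. (u n (\<phi> k))\<^sup>2) \<longlonglongrightarrow> (u n \<psi>)\<^sup>2"
      unfolding u_def by (intro tendsto_intros \<psi>) (metis add_pos_nonneg less_numeral_extra(1,3) norm_ge_zero)
    then have "\<forall>\<^sub>F k in sequentially. (u n \<psi>)\<^sup>2 - e < (u n (\<phi> k))\<^sup>2"
      using that by (intro order_tendstoD) auto
    ultimately show ?thesis
    proof eventually_elim
      case (elim k)
      have "(1/2) ^ Suc n * ((q n \<psi>)\<^sup>2 + (u n \<psi>)\<^sup>2) < (1/2) ^ Suc n * (((q n (\<phi> k))\<^sup>2 + (u n (\<phi> k))\<^sup>2) + 2 * e)"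
        using elim by (intro mult_strict_left_mono) auto
      also have "\<dots> = tm n (\<phi> k) + (1/2) ^ n * e" by (simp add: tm_def algebra_simps)
      also have "\<dots> \<le> tm n (\<phi> k) + e"
        using that by (simp add: power_le_one mult_left_le_one_le)
      finally show ?case by (simp add: tm_def)
    qed
  qed
  \<comment> \<open>Only finitely many eventual inequalities can be combined, so semicontinuity is
    shown for partial sums. The error is shared by the \<open>m\<close> terms, the norm and
    \<open>R\<close>, whence \<open>real m + 2\<close>.\<close>
  have partial: "(norm \<psi>)\<^sup>2 + (\<Sum>n<m. tm n \<psi>) \<le> c" for m
  proof (rule field_le_epsilon)
    fix e :: real assume e: "e > 0"
    define e' where "e' = e / (real m + 2)"
    have e': "e' > 0" "e' * (real m + 2) = e" using e by (auto simp: e'_def)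
    have 1: "\<forall>\<^sub>F k in sequentially. (norm \<psi>)\<^sup>2 < (norm (\<phi> k))\<^sup>2 + e'"
      by (rule sqlsc[OF pointwise_limit_norm_lsc[OF \<psi>] e'(1)]) auto
    have 2: "\<forall>\<^sub>F k in sequentially. \<forall>n\<in>{..<m}. tm n \<psi> < tm n (\<phi> k) + e'"
      using tmlsc[OF e'(1)] by (intro eventually_ball_finite) auto
    have 3: "\<forall>\<^sub>F k in sequentially. R (\<phi> k) < c + e'"
      using e'(1) by (intro order_tendstoD(2)[OF Rlim]) auto
    have "\<forall>\<^sub>F k in sequentially. (norm \<psi>)\<^sup>2 + (\<Sum>n<m. tm n \<psi>) \<le> c + e"
      using 1 2 3
    proof eventually_elim
      case (elim k)
      have "(\<Sum>n<m. tm n \<psi>) \<le> (\<Sum>n<m. tm n (\<phi> k) + e')"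
        using elim(2) by (intro sum_mono) force
      also have "\<dots> = (\<Sum>n<m. tm n (\<phi> k)) + real m * e'" by (simp add: sum.distrib)
      also have "(\<Sum>n<m. tm n (\<phi> k)) \<le> (\<Sum>n. tm n (\<phi> k))"
        unfolding tm_def by (rule sum_le_suminf[OF R_summable]) auto
      finally have "(norm \<psi>)\<^sup>2 + (\<Sum>n<m. tm n \<psi>) \<le> R (\<phi> k) + e' + real m * e'"
        using elim(1) unfolding R_def tm_def by linarith
      also have "\<dots> \<le> c + e' * (real m + 2)" using elim(3) by (simp add: algebra_simps)
      finally show ?case by (simp add: e'(2))
    qed
    then show "(norm \<psi>)\<^sup>2 + (\<Sum>n<m. tm n \<psi>) \<le> c + e" by (simp add: eventually_sequentially) blast
  qed
  have "(\<Sum>n. tm n \<psi>) \<le> c - (norm \<psi>)\<^sup>2"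
  proof (rule suminf_le_const)
    show "summable (\<lambda>n. tm n \<psi>)" unfolding tm_def by (rule R_summable)
    show "(\<Sum>n<m. tm n \<psi>) \<le> c - (norm \<psi>)\<^sup>2" for m using partial[of m] by simp
  qed
  then have "R \<psi> \<le> c" by (simp add: R_def tm_def)
  then have "conj_fun E x \<le> val x \<psi>" by (simp add: c_def val_def)
  then have \<psi>max: "val x \<psi> = conj_fun E x" using conj_fun_upper[OF \<psi>K, of x] by simp
  have "(\<lambda>k. q n (\<phi> k)) \<longlonglongrightarrow> q n \<psi>" for n
  proof (rule tendstoI)
    fix e :: real assume e: "e > 0"
    define \<delta> where "\<delta> = (1/2) ^ Suc n * (e / 2)\<^sup>2"
    have \<delta>: "\<delta> > 0" using e by (simp add: \<delta>_def)
    show "\<forall>\<^sub>F k in sequentially. dist (q n (\<phi> k)) (q n \<psi>) < e"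
      using ev[OF \<delta>]
    proof eventually_elim
      case (elim k)
      show ?case
        using maximizing_diff(1)[OF K \<psi>K e, of x k n] elim \<delta> \<psi>max by (simp add: \<delta>_def dist_real_def)
    qed
  qed
  then have "\<phi> \<longlonglongrightarrow> \<psi>"
    unfolding q_def by (intro pointwise_limit_strong[OF \<psi> compact_C C_nonempty C_dense])
  then show ?thesis using \<psi>K \<psi>max that by blast
qed

lemma conj_fun_attained: "\<exists>\<psi>\<in>ann E. val x \<psi> = conj_fun E x"
proof -
  have "\<exists>\<phi>\<in>ann E. conj_fun E x - 1 / real (Suc k) < val x \<phi>" for k
  proof -
    have "conj_fun E x - 1 / real (Suc k) < Sup (val x ` ann E)" by (simp add: conj_fun_def)
    moreover have "val x ` ann E \<noteq> {}" using zero_in_ann by blast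
    ultimately show ?thesis using less_cSup_iff[OF _ bdd_val] by blast
  qed
  then obtain \<phi> where \<phi>: "\<And>k. \<phi> k \<in> ann E" "\<And>k. conj_fun E x - 1 / real (Suc k) < val x (\<phi> k)"
    by metis
  have "(\<lambda>k. conj_fun E x - 1 / real (Suc k)) \<longlonglongrightarrow> conj_fun E x - 0"
    by (intro tendsto_intros LIMSEQ_inverse_real_of_nat[unfolded inverse_eq_divide])
  then have lim: "(\<lambda>k. conj_fun E x - 1 / real (Suc k)) \<longlonglongrightarrow> conj_fun E x" by simp
  have "(\<lambda>k. val x (\<phi> k)) \<longlonglongrightarrow> conj_fun E x"
    by (rule tendsto_sandwich[OF _ _ lim tendsto_const])
      (intro always_eventually allI less_imp_le[OF \<phi>(2)] conj_fun_upper[OF \<phi>(1)])+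
  then show ?thesis using maximizing_sequence_converges[of \<phi> E x] \<phi>(1) by blast
qed

text \<open>Alternating between two maximizers is a maximizing sequence, and it can converge only if
  they agree.\<close>

lemma maximizer_unique:
  assumes "\<phi> \<in> ann E" "val x \<phi> = conj_fun E x" "\<psi> \<in> ann E" "val x \<psi> = conj_fun E x"
  shows "\<phi> = \<psi>"
proof -
  define s where "s k = (if even k then \<phi> else \<psi>)" for k :: nat
  have "(\<lambda>k. val x (s k)) = (\<lambda>k. conj_fun E x)" using assms by (auto simp: s_def)
  then have "(\<lambda>k. val x (s k)) \<longlonglongrightarrow> conj_fun E x" by simp
  moreover have "s k \<in> ann E" for k using assms by (simp add: s_def)
  ultimately obtain l where l: "s \<longlonglongrightarrow> l"
    using maximizing_sequence_converges[of s E x] by blast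
  have "(s \<circ> (\<lambda>k. 2 * k)) \<longlonglongrightarrow> l" "(s \<circ> (\<lambda>k. 2 * k + 1)) \<longlonglongrightarrow> l"
    by (rule LIMSEQ_subseq_LIMSEQ[OF l], simp add: strict_mono_def)+
  then have "(\<lambda>k::nat. \<phi>) \<longlonglongrightarrow> l" "(\<lambda>k::nat. \<psi>) \<longlonglongrightarrow> l" by (simp_all add: s_def o_def)
  then show ?thesis by (simp add: LIMSEQ_const_iff)
qed

definition maxf :: "'a set \<Rightarrow> 'a \<Rightarrow> ('a \<Rightarrow>\<^sub>L real)" where
  "maxf E x = (SOME \<psi>. \<psi> \<in> ann E \<and> val x \<psi> = conj_fun E x)"

lemma maxf: "maxf E x \<in> ann E" "val x (maxf E x) = conj_fun E x"
proof -
  have "\<exists>\<psi>. \<psi> \<in> ann E \<and> val x \<psi> = conj_fun E x" using conj_fun_attained by blast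
  from someI_ex[OF this] show "maxf E x \<in> ann E" "val x (maxf E x) = conj_fun E x"
    by (auto simp: maxf_def)
qed

lemma conj_fun_subgradient: "conj_fun E y \<ge> conj_fun E x + 2 * maxf E x (y - x)"
  using conj_fun_upper[OF maxf(1), of y E x] maxf(2)[of x E]
  by (simp add: val_def blinfun.diff_right)

lemma norm_maxf: "norm (maxf E x) \<le> 2 * infdist x (span E)"
proof -
  have "0 \<le> 2 * (norm (maxf E x) * infdist x (span E)) - (norm (maxf E x))\<^sup>2"
    using val_le_norm[OF maxf(1), of x E x] maxf(2)[of x E] conj_fun_nonneg[of E x] by linarith
  then have "norm (maxf E x) * norm (maxf E x) \<le> norm (maxf E x) * (2 * infdist x (span E))"
    by (simp add: power2_eq_square algebra_simps)
  then show ?thesis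
    by (cases "norm (maxf E x) = 0") (auto simp: infdist_nonneg mult_le_cancel_left_pos)
qed

text \<open>The maximizers at \<open>s k\<close> form a maximizing sequence at the limit
  \<open>x\<close>: the subgradient inequality bounds their value at \<open>x\<close> from below by
  \<open>lo k\<close>, which tends to the supremum.\<close>

lemma continuous_maxf: "continuous_on UNIV (maxf E)"
proof (rule continuous_on_sequentiallyI)
  fix s :: "nat \<Rightarrow> 'a" and x assume s: "s \<longlonglongrightarrow> x"
  have bnd: "norm (maxf E (s k)) \<le> 2 * norm (s k)" for k
    using norm_maxf[of E "s k"] infdist_span_le_norm[of "s k" E] by linarith
  define lo where "lo k = conj_fun E x + 2 * maxf E x (s k - x) - 2 * (2 * norm (s k)) * norm (s k - x)" for k
  have lo: "lo k \<le> val x (maxf E (s k))" for k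
  proof -
    have "val x (maxf E (s k)) = conj_fun E (s k) - 2 * maxf E (s k) (s k - x)"
      using maxf(2)[of "s k" E] by (simp add: val_def blinfun.diff_right)
    moreover have "maxf E (s k) (s k - x) \<le> (2 * norm (s k)) * norm (s k - x)"
      using blinfun_abs_le[of "maxf E (s k)" "s k - x"] mult_right_mono[OF bnd[of k], of "norm (s k - x)"] by simp
    ultimately show ?thesis using conj_fun_subgradient[of E x "s k"] by (simp add: lo_def)
  qed
  have "lo \<longlonglongrightarrow> conj_fun E x + 2 * maxf E x (x - x) - 2 * (2 * norm x) * norm (x - x)"
    unfolding lo_def by (intro tendsto_intros s)
  then have lim: "lo \<longlonglongrightarrow> conj_fun E x" by simp
  have "(\<lambda>k. val x (maxf E (s k))) \<longlonglongrightarrow> conj_fun E x"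
    by (rule tendsto_sandwich[OF _ _ lim tendsto_const])
      (intro always_eventually allI lo conj_fun_upper[OF maxf(1)])+
  then obtain \<psi> where "\<psi> \<in> ann E" "val x \<psi> = conj_fun E x" "(\<lambda>k. maxf E (s k)) \<longlonglongrightarrow> \<psi>"
    using maximizing_sequence_converges[of "\<lambda>k. maxf E (s k)" E x] maxf(1) by blast
  moreover have "\<psi> = maxf E x"
    by (rule maximizer_unique[OF calculation(1,2) maxf])
  ultimately show "(\<lambda>k. maxf E (s k)) \<longlonglongrightarrow> maxf E x" by simp
qed

text \<open>A convex function with a continuous selection of subgradients is differentiable: the
  subgradient inequalities at \<open>x\<close> and at \<open>y\<close> enclose the remainder between
  0 and the variation of the selection.\<close>

lemma conj_fun_has_derivative:
  "(conj_fun E has_derivative blinfun_apply (2 *\<^sub>R maxf E x)) (at x)"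
proof (rule has_derivativeI_sandwich[of 1])
  show "bounded_linear (blinfun_apply (2 *\<^sub>R maxf E x))" by (rule blinfun.bounded_linear_right)
  show "(\<lambda>y. 2 * norm (maxf E y - maxf E x)) \<midarrow>x\<rightarrow> 0"
  proof -
    have "(maxf E) \<midarrow>x\<rightarrow> maxf E x"
      using continuous_maxf[of E] by (simp add: continuous_on_eq_continuous_at isCont_def)
    then have "(\<lambda>y. 2 * norm (maxf E y - maxf E x)) \<midarrow>x\<rightarrow> 2 * norm (maxf E x - maxf E x)"
      by (intro tendsto_intros)
    then show ?thesis by simp
  qed
  fix y assume "y \<noteq> x"
  have 1: "0 \<le> conj_fun E y - conj_fun E x - blinfun_apply (2 *\<^sub>R maxf E x) (y - x)"
    using conj_fun_subgradient[of E x y] by (simp add: blinfun.scaleR_left)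
  have "conj_fun E y - conj_fun E x - blinfun_apply (2 *\<^sub>R maxf E x) (y - x)
      \<le> 2 * blinfun_apply (maxf E y - maxf E x) (y - x)"
    using conj_fun_subgradient[of E y x] by (simp add: blinfun.bilinear_simps)
  also have "\<dots> \<le> 2 * (norm (maxf E y - maxf E x) * norm (y - x))"
    using blinfun_abs_le[of "maxf E y - maxf E x" "y - x"] by simp
  finally show "norm (conj_fun E y - conj_fun E x - blinfun_apply (2 *\<^sub>R maxf E x) (y - x)) / norm (y - x)
      \<le> 2 * norm (maxf E y - maxf E x)"
    using 1 \<open>y \<noteq> x\<close> by (simp add: divide_le_eq algebra_simps)
qed simp

end

text \<open>A smooth convex substitute for the squared distance to \<open>span E\<close>. Convexity
  is recorded as the gradient inequality, the form in which minimizers are compared later; all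
  constants are independent of \<open>E\<close>.\<close>

definition smooth_gauge :: "'a::real_normed_vector set \<Rightarrow> ('a \<Rightarrow> real) \<Rightarrow> ('a \<Rightarrow> 'a \<Rightarrow>\<^sub>L real) \<Rightarrow> bool" where
  "smooth_gauge E N N' \<longleftrightarrow>
     (\<forall>x. (N has_derivative blinfun_apply (N' x)) (at x)) \<and> continuous_on UNIV N' \<and>
     (\<forall>x y. N x + N' x (y - x) \<le> N y) \<and>
     (\<forall>x. (infdist x (span E))\<^sup>2 / 4 \<le> N x \<and> N x \<le> (infdist x (span E))\<^sup>2) \<and>
     (\<forall>x. norm (N' x) \<le> 4 * infdist x (span E))"

lemma separable_sequence:
  assumes "separable_space (euclidean :: 'b::metric_space topology)"
  obtains s :: "nat \<Rightarrow> 'b::metric_space" where "\<And>y e. e > 0 \<Longrightarrow> \<exists>n. dist y (s n) < e"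
proof -
  obtain S :: "'b set" where S: "countable S" "closure S = UNIV"
    using assms by (auto simp: separable_space_def)
  have ne: "S \<noteq> {}" using S(2) by auto
  show ?thesis
  proof (rule that[of "from_nat_into S"])
    fix y :: 'b and e :: real assume "e > 0"
    then obtain z where "z \<in> S" "dist z y < e"
      using S(2) closure_approachable[of y S] by auto
    then show "\<exists>n. dist y (from_nat_into S n) < e"
      using S(1) ne from_nat_into_surj[OF S(1)] by (metis dist_commute)
  qed
qed

theorem smooth_gauge_exists:
  assumes "separable_space (euclidean :: 'a::real_normed_vector topology)"
    and "separable_space (euclidean :: ('a \<Rightarrow>\<^sub>L real) topology)"
  shows "\<exists>N N'. smooth_gauge (E :: 'a::real_normed_vector set) N N'"
proof -
  obtain d :: "nat \<Rightarrow> 'a" where d: "\<And>y e. e > 0 \<Longrightarrow> \<exists>n. dist y (d n) < e"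
    using separable_sequence[OF assms(1)] by blast
  obtain f :: "nat \<Rightarrow> 'a \<Rightarrow>\<^sub>L real" where f: "\<And>y e. e > 0 \<Longrightarrow> \<exists>n. dist y (f n) < e"
    using separable_sequence[OF assms(2)] by blast
  interpret dense_sequences d f
    by unfold_locales (use d f in \<open>auto simp: dist_norm\<close>)
  have "smooth_gauge E (conj_fun E) (\<lambda>x. 2 *\<^sub>R maxf E x)"
    unfolding smooth_gauge_def
    using conj_fun_has_derivative conj_fun_subgradient[of E] conj_fun_ge conj_fun_le norm_maxf[of E]
    by (auto simp: blinfun.scaleR_left intro!: continuous_intros continuous_maxf)
  then show ?thesis by blast
qed

subsection \<open>Continuously differentiable maps\<close>

definition C1_deriv ::
  "('a::real_normed_vector \<Rightarrow> 'b::real_normed_vector) \<Rightarrow> ('a \<Rightarrow> 'a \<Rightarrow>\<^sub>L 'b) \<Rightarrow> bool" where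
  "C1_deriv g g' \<longleftrightarrow> (\<forall>x. (g has_derivative blinfun_apply (g' x)) (at x)) \<and> continuous_on UNIV g'"

lemma C1_smooth_iff: "C1_smooth g \<longleftrightarrow> (\<exists>g'. C1_deriv g g')"
  by (simp add: C1_smooth_def C1_deriv_def)

lemma C1_deriv_has_derivative: "C1_deriv g g' \<Longrightarrow> (g has_derivative blinfun_apply (g' x)) (at x)"
  by (simp add: C1_deriv_def)

lemma C1_deriv_continuous_on: "C1_deriv g g' \<Longrightarrow> continuous_on UNIV g"
  by (meson C1_deriv_has_derivative continuous_at_imp_continuous_on has_derivative_continuous)

lemma C1_deriv_unique:
  assumes "(g has_derivative blinfun_apply A) (at x)" "(g has_derivative blinfun_apply B) (at x)"
  shows "A = B"
  using has_derivative_unique[OF assms] by (simp add: blinfun_apply_inject)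

lemma C1_deriv_const: "C1_deriv (\<lambda>x. c) (\<lambda>x. 0)"
  using has_derivative_const[of c] by (simp add: C1_deriv_def zero_blinfun.rep_eq[abs_def])

lemma C1_deriv_id: "C1_deriv (\<lambda>x. x) (\<lambda>x. id_blinfun)"
  by (simp add: C1_deriv_def has_derivative_ident)

lemma C1_deriv_blinfun: "C1_deriv (blinfun_apply f) (\<lambda>x. f)"
  by (simp add: C1_deriv_def bounded_linear_imp_has_derivative blinfun.bounded_linear_right)

lemma C1_deriv_add:
  assumes "C1_deriv f f'" "C1_deriv g g'"
  shows "C1_deriv (\<lambda>x. f x + g x) (\<lambda>x. f' x + g' x)"
  using assms by (auto simp: C1_deriv_def plus_blinfun.rep_eq intro!: continuous_intros has_derivative_add)

lemma C1_deriv_diff: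
  assumes "C1_deriv f f'" "C1_deriv g g'"
  shows "C1_deriv (\<lambda>x. f x - g x) (\<lambda>x. f' x - g' x)"
  using assms by (auto simp: C1_deriv_def minus_blinfun.rep_eq intro!: continuous_intros has_derivative_diff)

lemma C1_deriv_mult:
  fixes f g :: "'a::real_normed_vector \<Rightarrow> real"
  assumes "C1_deriv f f'" "C1_deriv g g'"
  shows "C1_deriv (\<lambda>x. f x * g x) (\<lambda>x. f x *\<^sub>R g' x + g x *\<^sub>R f' x)"
proof -
  have "((\<lambda>x. f x * g x) has_derivative blinfun_apply (f x *\<^sub>R g' x + g x *\<^sub>R f' x)) (at x)" for x
    using has_derivative_mult[OF C1_deriv_has_derivative[OF assms(1), of x] C1_deriv_has_derivative[OF assms(2), of x]]
    by (rule has_derivative_eq_rhs) (auto simp: blinfun.bilinear_simps)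
  moreover have "continuous_on UNIV (\<lambda>x. f x *\<^sub>R g' x + g x *\<^sub>R f' x)"
    using assms by (intro continuous_intros) (auto simp: C1_deriv_def intro: C1_deriv_continuous_on[OF assms(1)] C1_deriv_continuous_on[OF assms(2)])
  ultimately show ?thesis by (simp add: C1_deriv_def)
qed

lemma C1_deriv_scaleR_left:
  fixes f :: "'a::real_normed_vector \<Rightarrow> real"
  assumes "C1_deriv f f'"
  shows "C1_deriv (\<lambda>x. f x *\<^sub>R w) (\<lambda>x. blinfun_scaleR_left w o\<^sub>L f' x)"
proof -
  have "((\<lambda>x. f x *\<^sub>R w) has_derivative blinfun_apply (blinfun_scaleR_left w o\<^sub>L f' x)) (at x)" for x
    using has_derivative_scaleR_left[OF C1_deriv_has_derivative[OF assms, of x], of w]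
    by (rule has_derivative_eq_rhs) auto
  moreover have "continuous_on UNIV (\<lambda>x. blinfun_scaleR_left w o\<^sub>L f' x)"
    using assms by (intro bounded_linear.continuous_on[OF bounded_bilinear.bounded_linear_right[OF bounded_bilinear_blinfun_compose]])
      (auto simp: C1_deriv_def)
  ultimately show ?thesis by (simp add: C1_deriv_def)
qed

lemma C1_deriv_compose:
  assumes "C1_deriv g g'" "C1_deriv h h'"
  shows "C1_deriv (\<lambda>x. g (h x)) (\<lambda>x. g' (h x) o\<^sub>L h' x)"
proof -
  have "((\<lambda>x. g (h x)) has_derivative blinfun_apply (g' (h x) o\<^sub>L h' x)) (at x)" for x
    using has_derivative_compose[OF C1_deriv_has_derivative[OF assms(2), of x] C1_deriv_has_derivative[OF assms(1), of "h x"]]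
    by (rule has_derivative_eq_rhs) auto
  moreover have "continuous_on UNIV (\<lambda>x. g' (h x) o\<^sub>L h' x)"
  proof (rule bounded_bilinear.continuous_on[OF bounded_bilinear_blinfun_compose])
    show "continuous_on UNIV (\<lambda>x. g' (h x))"
      using assms C1_deriv_continuous_on[OF assms(2)]
      by (intro continuous_on_compose2[of UNIV g' UNIV h]) (auto simp: C1_deriv_def)
    show "continuous_on UNIV h'" using assms by (simp add: C1_deriv_def)
  qed
  ultimately show ?thesis by (simp add: C1_deriv_def)
qed

lemma C1_deriv_real_compose:
  fixes g :: "'a::real_normed_vector \<Rightarrow> real"
  assumes "\<And>t. (S has_real_derivative S' t) (at t)" "continuous_on UNIV S'" "C1_deriv g g'"
  shows "C1_deriv (\<lambda>x. S (g x)) (\<lambda>x. S' (g x) *\<^sub>R g' x)"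
proof -
  have "((\<lambda>x. S (g x)) has_derivative blinfun_apply (S' (g x) *\<^sub>R g' x)) (at x)" for x
    using has_derivative_compose[OF C1_deriv_has_derivative[OF assms(3), of x]
        assms(1)[of "g x", unfolded has_field_derivative_def]]
    by (rule has_derivative_eq_rhs) (auto simp: blinfun.bilinear_simps)
  moreover have "continuous_on UNIV (\<lambda>x. S' (g x) *\<^sub>R g' x)"
    using assms C1_deriv_continuous_on[OF assms(3)]
    by (intro continuous_on_scaleR continuous_on_compose2[of UNIV S' UNIV g]) (auto simp: C1_deriv_def)
  ultimately show ?thesis by (simp add: C1_deriv_def)
qed

lemma C1_deriv_shift:
  assumes "C1_deriv g g'"
  shows "C1_deriv (\<lambda>x. g (x - c)) (\<lambda>x. g' (x - c))"
proof -
  have "C1_deriv (\<lambda>x. x - c) (\<lambda>x. id_blinfun - 0)"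
    by (rule C1_deriv_diff[OF C1_deriv_id C1_deriv_const])
  then have *: "C1_deriv (\<lambda>x. g (x - c)) (\<lambda>x. g' (x - c) o\<^sub>L (id_blinfun - 0))"
    by (rule C1_deriv_compose[OF assms])
  have "g' (x - c) o\<^sub>L (id_blinfun - 0) = g' (x - c)" for x
    by (rule blinfun_eqI) simp
  then show ?thesis using * by simp
qed

text \<open>Uniqueness of derivatives identifies the local ones. The predicate \<open>P\<close> lets
  a property of the local derivatives, such as surjectivity on a kernel, pass to the glued
  map.\<close>

lemma C1_deriv_local:
  assumes "\<And>x. \<exists>U k k'. open U \<and> x \<in> U \<and> C1_deriv k k' \<and> (\<forall>y\<in>U. h y = k y \<and> P y (k' y))"
  shows "\<exists>h'. C1_deriv h h' \<and> (\<forall>x. P x (h' x))"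
proof -
  have loc: "\<exists>U k'. open U \<and> x \<in> U \<and> continuous_on UNIV k' \<and>
      (\<forall>y\<in>U. (h has_derivative blinfun_apply (k' y)) (at y) \<and> P y (k' y))" for x
  proof -
    obtain U k k' where U: "open U" "x \<in> U" "C1_deriv k k'" "\<forall>y\<in>U. h y = k y \<and> P y (k' y)"
      using assms[of x] by blast
    have "(h has_derivative blinfun_apply (k' y)) (at y)" if "y \<in> U" for y
      by (rule has_derivative_transform_within_open[OF C1_deriv_has_derivative[OF U(3)] U(1) that])
        (use U(4) in auto)
    then show ?thesis using U by (auto simp: C1_deriv_def)
  qed
  then have "\<forall>x. \<exists>A. (h has_derivative blinfun_apply A) (at x)" by blast
  then obtain h' where h': "\<And>x. (h has_derivative blinfun_apply (h' x)) (at x)" by metis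
  have "isCont h' x \<and> P x (h' x)" for x
  proof -
    obtain U k' where U: "open U" "x \<in> U" "continuous_on UNIV k'"
      "\<And>y. y \<in> U \<Longrightarrow> (h has_derivative blinfun_apply (k' y)) (at y)" "\<And>y. y \<in> U \<Longrightarrow> P y (k' y)"
      using loc[of x] by blast
    have eq: "h' y = k' y" if "y \<in> U" for y using C1_deriv_unique[OF h' U(4)[OF that]] .
    have "isCont k' x" using U(3) by (simp add: continuous_on_eq_continuous_at)
    moreover have "\<forall>\<^sub>F y in nhds x. h' y = k' y"
      using eventually_nhds_in_open[OF U(1,2)] by (rule eventually_mono) (rule eq)
    ultimately have "isCont h' x" using isCont_cong[of h' k' x] by blast
    then show ?thesis using eq U(2,5) by auto
  qed
  then have "continuous_on UNIV h'" "\<forall>x. P x (h' x)"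
    by (auto intro: continuous_at_imp_continuous_on)
  then show ?thesis using h' unfolding C1_deriv_def by blast
qed

subsection \<open>A smooth step\<close>

text \<open>A quadratic spline from 0 to 1 whose derivative is the tent over the unit interval of
  height 2; this slope bound enters the constants of \<open>deletion_map\<close>.\<close>

definition step :: "real \<Rightarrow> real" where
  "step t = 2 * (max 0 t)\<^sup>2 - 4 * (max 0 (t - 1/2))\<^sup>2 + 2 * (max 0 (t - 1))\<^sup>2"
definition step' :: "real \<Rightarrow> real" where
  "step' t = 4 * max 0 t - 8 * max 0 (t - 1/2) + 4 * max 0 (t - 1)"

lemma has_real_derivative_max_square: "((\<lambda>t::real. (max 0 t)\<^sup>2) has_real_derivative 2 * max 0 t) (at t)"
  unfolding has_field_derivative_def
proof (rule has_derivativeI_sandwich[of 1])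
  show "bounded_linear ((*) (2 * max 0 t))" by (rule bounded_linear_mult_right)
  show "(\<lambda>y. \<bar>y - t\<bar>) \<midarrow>t\<rightarrow> 0"
    by (auto intro!: tendsto_eq_intros)
  fix y :: real assume "y \<noteq> t"
  have "\<bar>(max 0 y)\<^sup>2 - (max 0 t)\<^sup>2 - 2 * max 0 t * (y - t)\<bar> \<le> (y - t)\<^sup>2"
  proof (cases "t \<ge> 0")
    case True
    show ?thesis
    proof (cases "y \<ge> 0")
      case True
      then have "(max 0 y)\<^sup>2 - (max 0 t)\<^sup>2 - 2 * max 0 t * (y - t) = (y - t)\<^sup>2"
        using \<open>t \<ge> 0\<close> by (simp add: power2_eq_square algebra_simps)
      then show ?thesis by simp
    next
      case False
      then have "t * y \<le> 0" using True by (simp add: mult_nonneg_nonpos)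
      moreover have "(max 0 y)\<^sup>2 - (max 0 t)\<^sup>2 - 2 * max 0 t * (y - t) = t\<^sup>2 - 2 * (t * y)"
        using True False by (simp add: power2_eq_square algebra_simps)
      moreover have "(y - t)\<^sup>2 = y\<^sup>2 + t\<^sup>2 - 2 * (t * y)" by (simp add: power2_eq_square algebra_simps)
      ultimately show ?thesis using zero_le_power2[of t] zero_le_power2[of y] by linarith
    qed
  next
    case False
    show ?thesis
    proof (cases "y \<ge> 0")
      case True
      have "y\<^sup>2 \<le> (y - t)\<^sup>2" using True False by (intro power_mono) auto
      then show ?thesis using True False by simp
    qed (use False in simp)
  qed
  then have "\<bar>(max 0 y)\<^sup>2 - (max 0 t)\<^sup>2 - 2 * max 0 t * (y - t)\<bar> \<le> \<bar>y - t\<bar> * \<bar>y - t\<bar>"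
    by (simp add: power2_eq_square abs_mult_self_eq)
  then show "norm ((max 0 y)\<^sup>2 - (max 0 t)\<^sup>2 - 2 * max 0 t * (y - t)) / norm (y - t) \<le> \<bar>y - t\<bar>"
    using \<open>y \<noteq> t\<close> by (simp add: divide_le_eq)
qed simp

lemma has_real_derivative_max_square_shift:
  "((\<lambda>t::real. (max 0 (t - a))\<^sup>2) has_real_derivative 2 * max 0 (t - a)) (at t)"
proof -
  have "((\<lambda>t. t - a) has_real_derivative 1) (at t)" by (auto intro!: derivative_eq_intros)
  from DERIV_chain2[OF has_real_derivative_max_square this] show ?thesis by simp
qed

lemma step_has_derivative: "(step has_real_derivative step' t) (at t)"
  unfolding step_def step'_def
  by (rule derivative_eq_intros has_real_derivative_max_square has_real_derivative_max_square_shift refl | simp)+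

lemma continuous_step': "continuous_on UNIV step'"
  unfolding step'_def by (intro continuous_intros)

lemma step_eq_0: "t \<le> 0 \<Longrightarrow> step t = 0"
  by (simp add: step_def)

lemma step_eq_1: "t \<ge> 1 \<Longrightarrow> step t = 1" and step'_eq_0: "t \<ge> 1 \<Longrightarrow> step' t = 0"
  by (simp_all add: step_def step'_def power2_eq_square algebra_simps)

lemma step'_nonneg: "0 \<le> step' t" and step'_le: "step' t \<le> 2"
  by (auto simp: step'_def max_def)

lemma step_bounds: "0 \<le> step t" "step t \<le> 1"
proof -
  have "mono step"
    by (rule DERIV_nonneg_imp_nondecreasing[THEN monoI]) (use step_has_derivative step'_nonneg in auto)
  then have m: "step s \<le> step t" if "s \<le> t" for s t using that by (rule monoD)
  show "0 \<le> step t" using m[of "min t 0" t] step_eq_0[of "min t 0"] by simp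
  show "step t \<le> 1" using m[of t "max t 1"] step_eq_1[of "max t 1"] by simp
qed

subsection \<open>Pushing a neighbourhood of a finite-dimensional subspace off to infinity\<close>

lemma smooth_gauge_C1: "smooth_gauge E N N' \<Longrightarrow> C1_deriv N N'"
  by (simp add: smooth_gauge_def C1_deriv_def)

text \<open>As for basic sequences, each vector is taken from the kernel of functionals norming the
  span of \<open>E\<close> and its predecessors. Including one fixed set \<open>\<Psi>0\<close>
  norming \<open>span E\<close> in every choice makes the estimate against \<open>span E\<close>
  uniform over the whole infinite span.\<close>

lemma almost_orthogonal_sequence:
  fixes E :: "'a::real_normed_vector set"
  assumes inf: "infinite_dimensional TYPE('a)" and E: "finite E" and \<Phi>: "finite \<Phi>" and A: "A > 0"
  obtains b :: "nat \<Rightarrow> 'a" where "\<And>n. b n \<in> kern \<Phi>" "\<And>n. norm (b n) = A"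
    "\<And>e w. e \<in> span E \<Longrightarrow> w \<in> span (range b) \<Longrightarrow> norm w \<le> 3 * norm (e + w)"
    "\<And>n v s. v \<in> span (E \<union> b ` {..<n}) \<Longrightarrow> norm (s *\<^sub>R b n) \<le> 3 * norm (v + s *\<^sub>R b n)"
proof -
  obtain \<Psi>0 :: "('a \<Rightarrow>\<^sub>L real) set" where \<Psi>0: "finite \<Psi>0"
    "\<And>e w. e \<in> span E \<Longrightarrow> w \<in> kern \<Psi>0 \<Longrightarrow> norm w \<le> 3 * norm (e + w)"
    using finite_norming_functionals[OF E] by blast
  have "\<exists>x. x \<in> kern (\<Phi> \<union> \<Psi>0) \<and> norm x = A \<and>
      (\<forall>v s. v \<in> span (E \<union> S) \<longrightarrow> norm (s *\<^sub>R x) \<le> 3 * norm (v + s *\<^sub>R x))" if "finite S" for S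
  proof -
    obtain \<Psi> :: "('a \<Rightarrow>\<^sub>L real) set" where \<Psi>: "finite \<Psi>"
      "\<And>e w. e \<in> span (E \<union> S) \<Longrightarrow> w \<in> kern \<Psi> \<Longrightarrow> norm w \<le> 3 * norm (e + w)"
      using finite_norming_functionals[of "E \<union> S"] E \<open>finite S\<close> by auto
    obtain y where y: "y \<in> kern (\<Phi> \<union> \<Psi>0 \<union> \<Psi>)" "y \<noteq> 0"
      using kern_nontrivial[OF inf, of "\<Phi> \<union> \<Psi>0 \<union> \<Psi>"] \<Phi> \<Psi>0(1) \<Psi>(1) by auto
    define x where "x = (A / norm y) *\<^sub>R y"
    have "x \<in> kern (\<Phi> \<union> \<Psi>0 \<union> \<Psi>)" unfolding x_def by (rule subspace_scale[OF subspace_kern y(1)])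
    then have "x \<in> kern (\<Phi> \<union> \<Psi>0)" "x \<in> kern \<Psi>" by (auto simp: kern_def)
    moreover have "norm x = A" using y(2) A by (simp add: x_def)
    ultimately show ?thesis using \<Psi>(2) subspace_scale[OF subspace_kern] by blast
  qed
  then have "\<forall>S. \<exists>x. finite S \<longrightarrow> x \<in> kern (\<Phi> \<union> \<Psi>0) \<and> norm x = A \<and>
      (\<forall>v s. v \<in> span (E \<union> S) \<longrightarrow> norm (s *\<^sub>R x) \<le> 3 * norm (v + s *\<^sub>R x))" by blast
  from choice[OF this] obtain F where F: "\<And>S. finite S \<Longrightarrow> F S \<in> kern (\<Phi> \<union> \<Psi>0)" "\<And>S. finite S \<Longrightarrow> norm (F S) = A"
    "\<And>S v s. finite S \<Longrightarrow> v \<in> span (E \<union> S) \<Longrightarrow> norm (s *\<^sub>R F S) \<le> 3 * norm (v + s *\<^sub>R F S)"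
    by blast
  \<comment> \<open>The list collects the vectors chosen so far, which is the history the choice
    function \<open>F\<close> needs.\<close>
  define l where "l = rec_nat [] (\<lambda>_ xs. F (set xs) # xs)"
  have l: "l 0 = []" "l (Suc n) = F (set (l n)) # l n" for n by (simp_all add: l_def)
  define b where "b n = F (set (l n))" for n
  have lb: "set (l n) = b ` {..<n}" for n
    by (induction n) (auto simp: l b_def lessThan_Suc)
  have bk: "b n \<in> kern (\<Phi> \<union> \<Psi>0)" for n by (simp add: b_def F)
  show ?thesis
  proof (rule that)
    show "b n \<in> kern \<Phi>" for n using bk[of n] by (auto simp: kern_def)
    show "norm (b n) = A" for n by (simp add: b_def F)
    show "norm w \<le> 3 * norm (e + w)" if "e \<in> span E" "w \<in> span (range b)" for e w
    proof (rule \<Psi>0(2)[OF that(1)])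
      have "range b \<subseteq> kern \<Psi>0" using bk by (auto simp: kern_def)
      then show "w \<in> kern \<Psi>0" using that(2) span_minimal[OF _ subspace_kern] by blast
    qed
    show "norm (s *\<^sub>R b n) \<le> 3 * norm (v + s *\<^sub>R b n)" if "v \<in> span (E \<union> b ` {..<n})" for n v s
    proof -
      have "norm (s *\<^sub>R F (set (l n))) \<le> 3 * norm (v + s *\<^sub>R F (set (l n)))"
        by (rule F(3)) (use that lb in simp_all)
      then show ?thesis by (simp only: b_def)
    qed
  qed
qed

lemma infdist_span_greatest:
  assumes "\<And>e. e \<in> span E \<Longrightarrow> t \<le> dist x e"
  shows "t \<le> infdist (x::'a::real_normed_vector) (span E)"
proof -
  have ne: "span E \<noteq> {}" using span_zero by auto
  show ?thesis unfolding infdist_notempty[OF ne] by (rule cINF_greatest[OF ne assms])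
qed

text \<open>
  The path is polygonal with vertices of norm \<open>400 * r\<close>, each segment being divided into 8000 steps.
  Points whose segments are not adjacent then have distance at least \<open>22 * r\<close>, which exceeds twice the
  radius \<open>10 * r\<close> of the supports of the cut-off functions in the proof of \<open>deletion_map\<close>.
\<close>

lemma divergent_path:
  fixes E :: "'a::real_normed_vector set"
  assumes inf: "infinite_dimensional TYPE('a)" and E: "finite E" and \<Phi>: "finite \<Phi>" and r: "r > 0"
  obtains c :: "nat \<Rightarrow> 'a" and W m where "subspace W" "W \<subseteq> kern \<Phi>"
    "\<And>n. c n \<in> W" "c 0 = 0" "\<And>n. norm (c n) \<le> 800 * r" "\<And>n. norm (c n - c (Suc n)) \<le> r / 10"
    "m > 0" "\<And>i k. i + m \<le> k \<Longrightarrow> 22 * r \<le> infdist (c k - c i) (span E)"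
    "\<And>w. w \<in> W \<Longrightarrow> norm w \<le> 3 * infdist w (span E)"
proof -
  define A where "A = 400 * r"
  define M :: nat where "M = 8000"
  have A: "A > 0" using r by (simp add: A_def)
  obtain b :: "nat \<Rightarrow> 'a" where b: "\<And>n. b n \<in> kern \<Phi>" "\<And>n. norm (b n) = A"
    "\<And>e w. e \<in> span E \<Longrightarrow> w \<in> span (range b) \<Longrightarrow> norm w \<le> 3 * norm (e + w)"
    "\<And>n v s. v \<in> span (E \<union> b ` {..<n}) \<Longrightarrow> norm (s *\<^sub>R b n) \<le> 3 * norm (v + s *\<^sub>R b n)"
    by (rule almost_orthogonal_sequence[OF inf E \<Phi> A]) (rule that)
  define p where "p j t = (1 - t) *\<^sub>R b j + t *\<^sub>R b (Suc j)" for j and t :: real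
  define a where "a i = p (i div M) (real (i mod M) / real M)" for i
  define c where "c i = a i - b 0" for i
  define W where "W = span (range b)"
  have t: "0 \<le> real (i mod M) / real M" "real (i mod M) / real M \<le> 1" for i
    by (auto simp: M_def)
  \<comment> \<open>Holds also when \<open>Suc i\<close> opens a new segment, because
    \<open>p j 1 = p (Suc j) 0\<close>.\<close>
  have aSuc: "a (Suc i) = p (i div M) (real (i mod M) / real M + 1 / real M)" for i
  proof (cases "Suc (i mod M) = M")
    case True
    then have "Suc i mod M = 0" "Suc i div M = Suc (i div M)" by (auto simp: mod_Suc div_Suc)
    moreover have "real (i mod M) / real M + 1 / real M = 1"
    proof -
      have "real (i mod M) + 1 = real M" using True by linarith
      moreover have "real M \<noteq> 0" by (simp add: M_def)
      ultimately show ?thesis by (metis add_divide_distrib divide_self)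
    qed
    ultimately show ?thesis by (simp add: a_def p_def)
  next
    case False
    then have "Suc i mod M = Suc (i mod M)" "Suc i div M = i div M" by (auto simp: mod_Suc div_Suc)
    then show ?thesis by (simp add: a_def add_divide_distrib add.commute)
  qed
  have step: "norm (c i - c (Suc i)) \<le> r / 10" for i
  proof -
    have "c i - c (Suc i) = (1 / real M) *\<^sub>R (b (i div M) - b (Suc (i div M)))"
      unfolding c_def aSuc by (simp add: a_def p_def algebra_simps)
    then have "norm (c i - c (Suc i)) = norm (b (i div M) - b (Suc (i div M))) / real M" by simp
    also have "\<dots> \<le> (A + A) / real M"
      using norm_triangle_ineq4[of "b (i div M)" "b (Suc (i div M))"] b(2) by (intro divide_right_mono) auto
    finally show ?thesis by (simp add: A_def M_def)
  qed
  have aW: "a i \<in> W" for i unfolding a_def p_def W_def by (intro span_add span_scale span_base) auto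
  have na: "norm (a i) \<le> A" for i
  proof -
    have "norm (a i) \<le> (1 - real (i mod M) / real M) * A + (real (i mod M) / real M) * A"
      unfolding a_def p_def using t[of i] b(2) by (intro norm_triangle_le) simp
    then show ?thesis by (simp add: algebra_simps)
  qed
  have sep: "22 * r \<le> infdist (c k - c i) (span E)" if ik: "i + 2 * M \<le> k" for i k
  proof -
    define j where "j = k div M"
    define s where "s = real (k mod M) / real M"
    have s: "0 \<le> s" "s \<le> 1" using t[of k] by (simp_all add: s_def)
    \<comment> \<open>Both end points of the segment of \<open>k\<close> now have larger index than
      those of the segment of \<open>i\<close>.\<close>
    have ij: "Suc (i div M) < j"
    proof -
      have "(i + 2 * M) div M \<le> k div M" using ik by (rule div_le_mono)
      then show ?thesis by (simp add: j_def M_def)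
    qed
    have "22 * r \<le> dist (c k - c i) e" if e: "e \<in> span E" for e
    proof -
      define v where "v = - a i - e"
      have v: "v \<in> span (E \<union> b ` {..<j})"
      proof -
        have eS: "e \<in> span (E \<union> b ` {..<j})" using e span_mono[of E "E \<union> b ` {..<j}"] by blast
        then show ?thesis unfolding v_def a_def p_def using ij
          by (intro span_diff[OF _ eS] span_neg span_add span_scale span_base) auto
      qed
      define X where "X = norm (c k - c i - e)"
      have total: "c k - c i - e = v + (1 - s) *\<^sub>R b j + s *\<^sub>R b (Suc j)"
        by (simp add: c_def v_def a_def p_def j_def s_def)
      have v': "v + (1 - s) *\<^sub>R b j \<in> span (E \<union> b ` {..<Suc j})"
      proof -
        have "E \<union> b ` {..<j} \<subseteq> E \<union> b ` {..<Suc j}" by auto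
        then have "v \<in> span (E \<union> b ` {..<Suc j})" using v span_mono by blast
        then show ?thesis by (intro span_add[OF _ span_scale[OF span_base]]) auto
      qed
      \<comment> \<open>The last vertex is controlled first, then the one before it at the price of
        \<open>s * A\<close>. Together \<open>A \<le> 15 * X\<close>, and
        \<open>400 / 15 > 22\<close>.\<close>
      have "norm (s *\<^sub>R b (Suc j)) \<le> 3 * X" unfolding X_def total by (rule b(4)[OF v'])
      then have 1: "s * A \<le> 3 * X" using s b(2) by simp
      have "norm ((1 - s) *\<^sub>R b j) \<le> 3 * norm (v + (1 - s) *\<^sub>R b j)" by (rule b(4)[OF v])
      also have "norm (v + (1 - s) *\<^sub>R b j) = norm ((c k - c i - e) - s *\<^sub>R b (Suc j))" by (simp add: total)
      also have "\<dots> \<le> X + s * A" unfolding X_def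
        using norm_triangle_ineq4[of "c k - c i - e" "s *\<^sub>R b (Suc j)"] s b(2) by simp
      finally have "(1 - s) * A \<le> 3 * (X + s * A)" using s b(2) by simp
      then have "A \<le> 3 * X + 4 * (s * A)" by (simp add: algebra_simps)
      then have "A \<le> 15 * X" using 1 by linarith
      then show ?thesis using r by (simp add: X_def dist_norm A_def)
    qed
    then show ?thesis by (rule infdist_span_greatest)
  qed
  have WW: "norm w \<le> 3 * infdist w (span E)" if w: "w \<in> W" for w
  proof -
    have "norm w / 3 \<le> dist w e" if e: "e \<in> span E" for e
      using b(3)[of "-e" w] w e by (simp add: W_def span_neg dist_norm)
    then have "norm w / 3 \<le> infdist w (span E)"
      by (rule infdist_span_greatest)
    then show ?thesis by simp
  qed
  show ?thesis
  proof (rule that[of W c "2 * M"])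
    show "subspace W" by (simp add: W_def subspace_span)
    show "W \<subseteq> kern \<Phi>" unfolding W_def by (rule span_minimal[OF _ subspace_kern]) (use b(1) in auto)
    show "c n \<in> W" for n
      unfolding c_def W_def by (intro span_diff aW[unfolded W_def] span_base rangeI)
    show "c 0 = 0" by (simp add: c_def a_def p_def)
    show "norm (c n) \<le> 800 * r" for n
      using norm_triangle_ineq4[of "a n" "b 0"] na[of n] b(2)[of 0] by (simp add: c_def A_def)
    show "norm (c n - c (Suc n)) \<le> r / 10" for n by (rule step)
    show "2 * M > 0" by (simp add: M_def)
    show "22 * r \<le> infdist (c k - c i) (span E)" if "i + 2 * M \<le> k" for i k by (rule sep[OF that])
    show "norm w \<le> 3 * infdist w (span E)" if "w \<in> W" for w by (rule WW[OF that])
  qed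
qed

lemma infdist_span_uminus:
  fixes x :: "'a::real_normed_vector"
  shows "infdist (- x) (span E) = infdist x (span E)"
  using infdist_subspace_scale[OF subspace_span, of "-1" x E] by simp

lemma infdist_span_diff_le:
  fixes x y :: "'a::real_normed_vector"
  shows "infdist (x - y) (span E) \<le> infdist x (span E) + infdist y (span E)"
  using infdist_subspace_triangle[OF subspace_span, of x "-y" E] by (simp add: infdist_span_uminus)

lemma infdist_span_add_le:
  fixes x y :: "'a::real_normed_vector"
  shows "infdist (x + y) (span E) \<le> infdist x (span E) + infdist y (span E)"
  by (rule infdist_subspace_triangle[OF subspace_span])

definition onto_on :: "'a::real_normed_vector set \<Rightarrow> ('a \<Rightarrow>\<^sub>L 'a) \<Rightarrow> bool" where
  "onto_on L A \<longleftrightarrow> (\<forall>l\<in>L. \<exists>v\<in>L. blinfun_apply A v = l)"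

lemma onto_on_compose: "onto_on L A \<Longrightarrow> onto_on L B \<Longrightarrow> onto_on L (A o\<^sub>L B)"
  unfolding onto_on_def by (metis blinfun_apply_blinfun_compose)

text \<open>
  The gauge balls of radius \<open>r\<close> around the points \<open>c n\<close> are carried by the translations \<open>D n\<close>
  one onto the previous one, so a point whose image lies in the first ball would have to lie in all of
  them. This is impossible, as every point is far away from all but finitely many \<open>c n\<close>.
\<close>

theorem deletion_map:
  fixes E :: "'a::real_normed_vector set"
  assumes inf: "infinite_dimensional TYPE('a)" and E: "finite E" and \<Phi>: "finite \<Phi>" and r: "r > 0"
    and N: "smooth_gauge E N N'"
  obtains H H' where "C1_deriv H H'" "\<And>x. r\<^sup>2 \<le> N (H x)" "\<And>x. norm (H x - x) \<le> 5000 * r"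
    "\<And>x. onto_on (kern \<Phi>) (H' x)"
proof -
  define d where "d x = infdist x (span E)" for x :: 'a
  have d0: "0 \<le> d x" for x by (simp add: d_def infdist_nonneg)
  have dn: "d x \<le> norm x" for x by (simp add: d_def infdist_span_le_norm)
  have dadd: "d (x + y) \<le> d x + d y" and ddiff: "d (x - y) \<le> d x + d y" for x y
    by (simp_all add: d_def infdist_span_diff_le infdist_span_add_le)
  have Nlo: "(d x)\<^sup>2 / 4 \<le> N x" and Nhi: "N x \<le> (d x)\<^sup>2" and N'd: "norm (N' x) \<le> 4 * d x" for x
    using N by (auto simp: smooth_gauge_def d_def)
  have Nd: "d x < 2 * t" if "N x < t\<^sup>2" "t > 0" for x t
  proof -
    have "(d x)\<^sup>2 < (2 * t)\<^sup>2" using Nlo[of x] that(1) by (simp add: power_mult_distrib)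
    then show ?thesis using that(2) by (auto intro: power2_less_imp_less)
  qed
  obtain c :: "nat \<Rightarrow> 'a" and W and m :: nat where W: "subspace W" "W \<subseteq> kern \<Phi>"
    and cW: "\<And>n. c n \<in> W" and c0: "c 0 = 0" and cb: "\<And>n. norm (c n) \<le> 800 * r"
    and cs: "\<And>n. norm (c n - c (Suc n)) \<le> r / 10" and m: "m > 0"
    and sep': "\<And>i k. i + m \<le> k \<Longrightarrow> 22 * r \<le> infdist (c k - c i) (span E)"
    and Wd': "\<And>w. w \<in> W \<Longrightarrow> norm w \<le> 3 * infdist w (span E)"
    by (rule divergent_path[OF inf E \<Phi> r]) (rule that)
  note sep = sep'[folded d_def] and Wd = Wd'[folded d_def]
  define w where "w n = c n - c (Suc n)" for n
  have wW: "w n \<in> W" for n unfolding w_def by (intro subspace_diff W cW)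
  have wn: "norm (w n) \<le> r / 10" for n using cs by (simp add: w_def)
  \<comment> \<open>The cut-off falls from 1 to 0 while \<open>N\<close> runs from
    \<open>9 * r\<^sup>2\<close> to \<open>25 * r\<^sup>2\<close>. As \<open>N\<close> lies between
    a quarter of the squared distance and the squared distance, it is 1 up to distance
    \<open>3 * r\<close> and 0 from \<open>10 * r\<close> on.\<close>
  define z where "z n x = (N (x - c n) + (- 9 * r\<^sup>2)) * (1 / (16 * r\<^sup>2))" for n x
  define \<kappa> where "\<kappa> n x = 1 - step (z n x)" for n x
  define \<kappa>' where "\<kappa>' n x = - ((step' (z n x) / (16 * r\<^sup>2)) *\<^sub>R N' (x - c n))" for n x
  have \<kappa>C1: "C1_deriv (\<kappa> n) (\<kappa>' n)" for n
  proof -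
    have "C1_deriv (z n) (\<lambda>x. (1 / (16 * r\<^sup>2)) *\<^sub>R N' (x - c n))"
      using C1_deriv_mult[OF C1_deriv_add[OF C1_deriv_shift[OF smooth_gauge_C1[OF N]] C1_deriv_const] C1_deriv_const,
          of "c n" "- 9 * r\<^sup>2" "1 / (16 * r\<^sup>2)"]
      by (simp add: z_def[abs_def])
    from C1_deriv_diff[OF C1_deriv_const C1_deriv_real_compose[OF step_has_derivative continuous_step' this], of 1]
    show ?thesis by (simp add: \<kappa>_def[abs_def] \<kappa>'_def[abs_def])
  qed
  have \<kappa>01: "0 \<le> \<kappa> n x" "\<kappa> n x \<le> 1" for n x using step_bounds[of "z n x"] by (auto simp: \<kappa>_def)
  have \<kappa>1: "\<kappa> n x = 1" if "d (x - c n) \<le> 3 * r" for n x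
  proof -
    have "N (x - c n) \<le> (3 * r)\<^sup>2"
      using Nhi[of "x - c n"] power_mono[OF that d0, of 2] by linarith
    then have "z n x \<le> 0" unfolding z_def by (intro mult_nonpos_nonneg) (auto simp: power_mult_distrib)
    then show ?thesis by (simp add: \<kappa>_def step_eq_0)
  qed
  have z1: "z n x \<ge> 1" if "d (x - c n) \<ge> 10 * r" for n x
  proof -
    have "(10 * r)\<^sup>2 \<le> (d (x - c n))\<^sup>2" using that r by (intro power_mono) auto
    then have "25 * r\<^sup>2 \<le> N (x - c n)" using Nlo[of "x - c n"] by (simp add: power_mult_distrib)
    then show ?thesis using r by (simp add: z_def field_simps)
  qed
  have \<kappa>0: "\<kappa> n x = 0" if "d (x - c n) \<ge> 10 * r" for n x
    using z1[OF that] by (simp add: \<kappa>_def step_eq_1)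
  have \<kappa>'n: "norm (\<kappa>' n x) \<le> 5 / r" for n x
  proof (cases "d (x - c n) \<ge> 10 * r")
    case True
    then show ?thesis using step'_eq_0[OF z1[OF True]] r by (simp add: \<kappa>'_def)
  next
    case False
    have "norm (\<kappa>' n x) = step' (z n x) / (16 * r\<^sup>2) * norm (N' (x - c n))"
      using step'_nonneg[of "z n x"] by (simp add: \<kappa>'_def)
    also have "\<dots> \<le> 2 / (16 * r\<^sup>2) * (40 * r)"
      using False N'd[of "x - c n"] step'_le[of "z n x"]
      by (intro mult_mono divide_right_mono) auto
    also have "\<dots> = 5 / r" using r by (simp add: power2_eq_square field_simps)
    finally show ?thesis .
  qed
  \<comment> \<open>The reason for path steps of length \<open>r / 10\<close>: as
    \<open>\<kappa> n\<close> has slope at most \<open>5 / r\<close>, the perturbation of the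
    identity in \<open>D n\<close> has Lipschitz constant at most \<open>1/2\<close>, which gives
    injectivity and invertible derivatives.\<close>
  have \<kappa>w: "\<bar>\<kappa>' n x (w n)\<bar> \<le> 1 / 2" for n x
  proof -
    have "\<bar>\<kappa>' n x (w n)\<bar> \<le> norm (\<kappa>' n x) * norm (w n)" by (rule blinfun_abs_le)
    also have "\<dots> \<le> 5 / r * (r / 10)" using r by (intro mult_mono \<kappa>'n wn) auto
    finally show ?thesis using r by simp
  qed
  have \<kappa>lip: "\<bar>\<kappa> n x - \<kappa> n y\<bar> \<le> 5 / r * norm (x - y)" for n x y
    using differentiable_bound[of UNIV "\<kappa> n" "\<lambda>x. blinfun_apply (\<kappa>' n x)" "5 / r" x y]
      C1_deriv_has_derivative[OF \<kappa>C1] \<kappa>'n by (simp add: norm_blinfun.rep_eq)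
  define D where "D n x = x + \<kappa> n x *\<^sub>R w n" for n x
  define D' where "D' n x = id_blinfun + (blinfun_scaleR_left (w n) o\<^sub>L \<kappa>' n x)" for n x
  have DC1: "C1_deriv (D n) (D' n)" for n
    unfolding D_def[abs_def] D'_def[abs_def]
    by (intro C1_deriv_add C1_deriv_id C1_deriv_scaleR_left \<kappa>C1)
  have Donto: "onto_on (kern \<Phi>) (D' n x)" for n x
    unfolding onto_on_def
  proof
    fix l assume l: "l \<in> kern \<Phi>"
    define q where "q = 1 + \<kappa>' n x (w n)"
    have q: "q > 0" using \<kappa>w[of n x] by (auto simp: q_def)
    \<comment> \<open>The inverse of a rank-one perturbation of the identity; \<open>v\<close> stays
      in the kernel because \<open>w n\<close> lies there.\<close>
    define v where "v = l - (\<kappa>' n x l / q) *\<^sub>R w n"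
    have "v \<in> kern \<Phi>" unfolding v_def
      using l wW W(2) by (intro subspace_diff[OF subspace_kern] subspace_scale[OF subspace_kern]) auto
    moreover have "D' n x v = l"
    proof -
      have "\<kappa>' n x v = \<kappa>' n x l - \<kappa>' n x l / q * (q - 1)"
        by (simp add: v_def blinfun.bilinear_simps q_def)
      also have "\<dots> = \<kappa>' n x l / q" using q by (simp add: field_simps)
      finally show ?thesis by (simp add: D'_def blinfun.add_left v_def)
    qed
    ultimately show "\<exists>v\<in>kern \<Phi>. D' n x v = l" by blast
  qed
  have Dinj: "x = y" if "D n x = D n y" for n x y
  proof -
    have "x - y = (\<kappa> n y - \<kappa> n x) *\<^sub>R w n" using that by (simp add: D_def algebra_simps)
    then have "norm (x - y) = \<bar>\<kappa> n x - \<kappa> n y\<bar> * norm (w n)" by (simp add: abs_minus_commute)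
    also have "\<dots> \<le> (5 / r * norm (x - y)) * (r / 10)" using r by (intro mult_mono \<kappa>lip wn) auto
    also have "\<dots> = norm (x - y) / 2" using r by simp
    finally show ?thesis by simp
  qed
  \<comment> \<open>\<open>D n\<close> is applied before \<open>Hs n\<close>, so passing to
    \<open>Hs (Suc n)\<close> affects only points that are near \<open>c n\<close> modulo
    \<open>span E\<close>.\<close>
  define Hs where "Hs = rec_nat (\<lambda>x. x) (\<lambda>n h x. h (D n x))"
  have Hs: "Hs 0 x = x" "Hs (Suc n) x = Hs n (D n x)" for n x by (simp_all add: Hs_def)
  define Hs' where "Hs' = rec_nat (\<lambda>x. id_blinfun) (\<lambda>n h' x. h' (D n x) o\<^sub>L D' n x)"
  have Hs': "Hs' 0 = (\<lambda>x. id_blinfun)" "Hs' (Suc n) = (\<lambda>x. Hs' n (D n x) o\<^sub>L D' n x)" for n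
    by (simp_all add: Hs'_def)
  have HsC1: "C1_deriv (Hs n) (Hs' n)" for n
  proof (induction n)
    case 0
    have "Hs 0 = (\<lambda>x. x)" by (rule ext) (simp add: Hs)
    then show ?case by (simp add: Hs' C1_deriv_id)
  next
    case (Suc n)
    have "Hs (Suc n) = (\<lambda>x. Hs n (D n x))" by (rule ext) (simp add: Hs)
    then show ?case unfolding Hs'(2) using C1_deriv_compose[OF Suc DC1] by simp
  qed
  have Hsonto: "onto_on (kern \<Phi>) (Hs' n x)" for n x
  proof (induction n arbitrary: x)
    case 0
    then show ?case by (auto simp: Hs' onto_on_def)
  next
    case (Suc n)
    show ?case unfolding Hs'(2) by (rule onto_on_compose[OF Suc Donto])
  qed
  \<comment> \<open>If \<open>x\<close> is close to some \<open>c i0\<close>, the separation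
    \<open>22 * r\<close> exceeds \<open>10.5 * r + r / 2 + 10 * r\<close> for all late
    \<open>i\<close>; otherwise \<open>x\<close> is close to none.\<close>
  have far: "\<exists>n0. \<forall>i\<ge>n0. \<forall>y\<in>ball x (r/2). 10 * r \<le> d (y - c i)" for x
  proof (cases "\<exists>i. d (x - c i) < 10.5 * r")
    case True
    then obtain i0 where i0: "d (x - c i0) < 10.5 * r" by blast
    have "10 * r \<le> d (y - c i)" if i: "i \<ge> i0 + m" and y: "y \<in> ball x (r/2)" for i y
    proof -
      have "22 * r \<le> d (c i - c i0)" using sep i by simp
      also have "c i - c i0 = (x - c i0) - ((x - y) + (y - c i))" by simp
      also have "d \<dots> \<le> d (x - c i0) + (d (x - y) + d (y - c i))"
        using ddiff[of "x - c i0" "(x - y) + (y - c i)"] dadd[of "x - y" "y - c i"] by linarith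
      finally show ?thesis using i0 dn[of "x - y"] y r by (simp add: dist_norm)
    qed
    then show ?thesis by blast
  next
    case False
    have "10 * r \<le> d (y - c i)" if y: "y \<in> ball x (r/2)" for i y
    proof -
      have "10.5 * r \<le> d (x - c i)" using False by (auto simp: not_less)
      also have "x - c i = (x - y) + (y - c i)" by simp
      also have "d \<dots> \<le> d (x - y) + d (y - c i)" by (rule dadd)
      finally show ?thesis using dn[of "x - y"] y by (simp add: dist_norm)
    qed
    then show ?thesis by blast
  qed
  then obtain n0 where n0: "\<And>x i y. i \<ge> n0 x \<Longrightarrow> y \<in> ball x (r/2) \<Longrightarrow> 10 * r \<le> d (y - c i)" by metis
  have stab: "Hs n y = Hs (n0 x) y" if "n \<ge> n0 x" "y \<in> ball x (r/2)" for x n y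
    using that(1)
  proof (induction n rule: dec_induct)
    case (step n)
    have "D n y = y" using \<kappa>0[OF n0[OF step(1) that(2)]] by (simp add: D_def)
    then show ?case using step by (simp add: Hs)
  qed simp
  define H where "H x = Hs (n0 x) x" for x
  have Heq: "H y = Hs (n0 x) y" if y: "y \<in> ball x (r/2)" for x y
  proof -
    have "y \<in> ball y (r/2)" using r by simp
    then have "Hs (max (n0 x) (n0 y)) y = Hs (n0 y) y" by (intro stab) simp_all
    moreover have "Hs (max (n0 x) (n0 y)) y = Hs (n0 x) y" using y by (intro stab) simp_all
    ultimately show ?thesis by (simp add: H_def)
  qed
  have "\<exists>H'. C1_deriv H H' \<and> (\<forall>x. onto_on (kern \<Phi>) (H' x))"
  proof (rule C1_deriv_local)
    fix x
    show "\<exists>U k k'. open U \<and> x \<in> U \<and> C1_deriv k k' \<and> (\<forall>y\<in>U. H y = k y \<and> onto_on (kern \<Phi>) (k' y))"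
      by (intro exI[of _ "ball x (r/2)"] exI[of _ "Hs (n0 x)"] exI[of _ "Hs' (n0 x)"] conjI ballI
        Heq Hsonto HsC1) (use r in simp_all)
  qed
  then obtain H' where H': "C1_deriv H H'" "\<And>x. onto_on (kern \<Phi>) (H' x)" by blast
  have core: "N (x - c n) < r\<^sup>2" if "N (Hs n x) < r\<^sup>2" for n x
    using that
  proof (induction n arbitrary: x)
    case 0
    then show ?case by (simp add: Hs c0)
  next
    case (Suc n)
    define y where "y = D n x"
    \<comment> \<open>The explicit preimage of \<open>y\<close> under \<open>D n\<close>: it lies
      where the cut-off is 1, so that \<open>D n\<close> is the translation by \<open>w n\<close>
      there.\<close>
    define u where "u = y - w n"
    have y: "N (y - c n) < r\<^sup>2" by (rule Suc.IH) (use Suc.prems in \<open>simp only: Hs y_def\<close>)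
    have "d (u - c n) = d ((y - c n) - w n)" by (simp add: u_def algebra_simps)
    also have "\<dots> \<le> d (y - c n) + d (w n)" by (rule ddiff)
    also have "\<dots> \<le> 3 * r" using Nd[OF y r] dn[of "w n"] wn[of n] r by linarith
    finally have "\<kappa> n u = 1" by (rule \<kappa>1)
    then have "D n u = y" by (simp add: D_def u_def)
    then have "D n x = D n u" by (simp only: y_def)
    then have "x = u" by (rule Dinj)
    then show ?case using y by (simp add: u_def w_def)
  qed
  have del: "r\<^sup>2 \<le> N (H x)" for x
  proof (rule ccontr)
    assume "\<not> r\<^sup>2 \<le> N (H x)"
    then have "N (x - c (n0 x)) < r\<^sup>2" using core[of "n0 x" x] by (simp add: H_def)
    then have "d (x - c (n0 x)) < 2 * r" by (rule Nd[OF _ r])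
    moreover have "10 * r \<le> d (x - c (n0 x))" using n0[of x "n0 x" x] r by simp
    ultimately show False using r by simp
  qed
  \<comment> \<open>The number of translations met by a point has no useful bound, so the
    displacement is estimated modulo \<open>span E\<close>: a moved point has distance at most
    \<open>(800 + 10 + 1) * r\<close> from \<open>span E\<close> before and after. On
    \<open>W\<close> the norm is at most 3 times this distance, and
    \<open>3 * 2 * 811 \<le> 5000\<close>.\<close>
  have disp: "Hs n x - x \<in> W \<and> (Hs n x = x \<or> d (Hs n x) \<le> 811 * r \<and> d x \<le> 811 * r)" for n x
  proof (induction n arbitrary: x)
    case 0
    then show ?case using subspace_0[OF W(1)] by (simp add: Hs)
  next
    case (Suc n)
    have "Hs (Suc n) x - x = (Hs n (D n x) - D n x) + \<kappa> n x *\<^sub>R w n" by (simp add: Hs D_def)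
    also have "\<dots> \<in> W"
      by (intro subspace_add[OF W(1)] subspace_scale[OF W(1)] wW conjunct1[OF Suc])
    finally have 1: "Hs (Suc n) x - x \<in> W" .
    show ?case
    proof (cases "d (x - c n) \<ge> 10 * r")
      case True
      then have "D n x = x" by (simp add: D_def \<kappa>0)
      then show ?thesis using Suc[of x] by (simp only: Hs)
    next
      case False
      have "d x \<le> d (x - c n) + d (c n)" using dadd[of "x - c n" "c n"] by simp
      then have dx: "d x \<le> 810 * r" using False dn[of "c n"] cb[of n] by linarith
      have "norm (\<kappa> n x *\<^sub>R w n) \<le> 1 * norm (w n)"
        unfolding norm_scaleR using \<kappa>01[of n x] by (intro mult_right_mono) auto
      then have "d (\<kappa> n x *\<^sub>R w n) \<le> r" using dn[of "\<kappa> n x *\<^sub>R w n"] wn[of n] r by linarith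
      then have "d (D n x) \<le> 811 * r" using dadd[of x "\<kappa> n x *\<^sub>R w n"] dx by (simp add: D_def)
      then have "d (Hs (Suc n) x) \<le> 811 * r" unfolding Hs using conjunct2[OF Suc, of "D n x"] by auto
      moreover have "d x \<le> 811 * r" using dx r by linarith
      ultimately show ?thesis using 1 by blast
    qed
  qed
  have "norm (H x - x) \<le> 5000 * r" for x
  proof (cases "H x = x")
    case True
    then show ?thesis using r by simp
  next
    case False
    then have "d (H x) \<le> 811 * r" "d x \<le> 811 * r" "H x - x \<in> W" using disp[of "n0 x" x] by (auto simp: H_def)
    then show ?thesis using Wd[of "H x - x"] ddiff[of "H x" x] r by linarith
  qed
  then show ?thesis using that[OF H'(1) del _ H'(2)] by blast
qed

subsection \<open>Cut-off functions whose derivative never lies in a given finite-dimensional space\<close>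

lemma smooth_gauge_growth:
  assumes "smooth_gauge E N N'"
  shows "N x \<le> N y + 4 * norm x * norm (x - y)"
proof -
  have "N x + N' x (y - x) \<le> N y" using assms by (simp add: smooth_gauge_def)
  moreover have "\<bar>N' x (y - x)\<bar> \<le> norm (N' x) * norm (y - x)" by (rule blinfun_abs_le)
  moreover have "norm (N' x) \<le> 4 * norm x"
    using assms infdist_span_le_norm[of x E] by (force simp: smooth_gauge_def intro: order_trans)
  then have "norm (N' x) * norm (y - x) \<le> 4 * norm x * norm (x - y)"
    by (simp add: norm_minus_commute mult_right_mono)
  ultimately show ?thesis by linarith
qed

lemma smooth_gauge_nonneg: "smooth_gauge E N N' \<Longrightarrow> 0 \<le> N x"
  unfolding smooth_gauge_def by (meson order_trans zero_le_divide_iff zero_le_numeral zero_le_power2)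

lemma smooth_gauge_span_eq_0:
  assumes "smooth_gauge E N N'" "e \<in> span E"
  shows "N e = 0"
proof -
  have "N e \<le> (infdist e (span E))\<^sup>2" using assms(1) by (simp add: smooth_gauge_def)
  then show ?thesis using smooth_gauge_nonneg[OF assms(1), of e] infdist_zero[OF assms(2)] by simp
qed

lemma smooth_gauge_empty:
  assumes "smooth_gauge {} N N'"
  shows "(norm x)\<^sup>2 / 4 \<le> N x" "N x \<le> (norm x)\<^sup>2"
  using assms by (auto simp: smooth_gauge_def)

lemma smooth_gauge_empty_norm_le:
  assumes "smooth_gauge {} N N'" "N x \<le> \<beta>" "0 \<le> \<beta>"
  shows "norm x \<le> 2 * (\<beta> + 1)"
proof -
  have "(norm x)\<^sup>2 \<le> 4 * \<beta>" using smooth_gauge_empty(1)[OF assms(1), of x] assms(2) by simp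
  also have "\<dots> \<le> (2 * (\<beta> + 1))\<^sup>2" using assms(3) by (simp add: power2_eq_square algebra_simps)
  finally show ?thesis using assms(3) by (auto intro: power2_le_imp_le)
qed

text \<open>A finite net for \<Phi> and all \<open>N (y - x i)\<close> simultaneously yields a point
  \<open>z\<close> with nearly the same values; a small correction by \<open>dual_sum\<close>
  restores the functionals exactly. So every fibre of \<Phi> through the ball meets one fixed
  finite-dimensional space in a point at least as good for all \<open>i\<close>, up to
  \<eta>.\<close>

lemma near_minimizers:
  fixes x :: "'i \<Rightarrow> 'a::real_normed_vector"
  assumes N: "smooth_gauge {} N N'" and \<Phi>: "finite \<Phi>" and I: "finite I" and R: "R \<ge> 0" and \<eta>: "\<eta> > 0"
  obtains E where "finite E" "x ` I \<subseteq> E"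
    "\<And>y. norm y \<le> R \<Longrightarrow> \<exists>e\<in>span E. e - y \<in> kern \<Phi> \<and> (\<forall>i\<in>I. N (e - x i) \<le> N (y - x i) + \<eta>)"
proof -
  obtain v where "\<forall>x. \<forall>\<phi>\<in>\<Phi>. blinfun_apply \<phi> (dual_sum \<Phi> v x) = blinfun_apply \<phi> x"
    using finite_functionals_section[OF \<Phi>] ..
  then have v: "blinfun_apply \<phi> (dual_sum \<Phi> v x) = blinfun_apply \<phi> x" if "\<phi> \<in> \<Phi>" for x \<phi>
    using that by simp
  define \<rho> where "\<rho> = (\<Sum>i\<in>I. norm (x i))"
  have \<rho>: "norm (x i) \<le> \<rho>" if "i \<in> I" for i unfolding \<rho>_def by (rule member_le_sum) (use that I in auto)
  have \<rho>0: "\<rho> \<ge> 0" by (simp add: \<rho>_def sum_nonneg)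
  define s where "s = (\<Sum>\<phi>\<in>\<Phi>. norm (v \<phi>)) + 1"
  have s: "s \<ge> 1" by (simp add: s_def sum_nonneg)
  \<comment> \<open>Collects the losses: 1 for passing from \<open>y\<close> to the net point
    \<open>z\<close>, the rest from \<open>smooth_gauge_growth\<close> for the correction from
    \<open>z\<close> to \<open>e\<close>.\<close>
  define Q where "Q = 4 * (R + 1 + \<rho>) * s + 1"
  have Q: "Q \<ge> 1" using R \<rho>0 s by (simp add: Q_def)
  define \<delta> where "\<delta> = min (1 / s) (\<eta> / Q)"
  have \<delta>: "\<delta> > 0" using s Q \<eta> by (simp add: \<delta>_def)
  have \<delta>s: "\<delta> * s \<le> 1" "\<delta> * Q \<le> \<eta>" using s Q by (simp_all add: \<delta>_def min_def field_simps)
  define B where "B = cball (0::'a) R"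
  define \<Gamma> where "\<Gamma> = blinfun_apply ` \<Phi> \<union> (\<lambda>i y. N (y - x i)) ` I"
  have bdd: "bounded (\<gamma> ` B)" if \<gamma>: "\<gamma> \<in> \<Gamma>" for \<gamma> :: "'a \<Rightarrow> real"
  proof -
    consider \<phi> where "\<gamma> = blinfun_apply \<phi>" | i where "i \<in> I" "\<gamma> = (\<lambda>y. N (y - x i))"
      using \<gamma> by (auto simp: \<Gamma>_def)
    then show ?thesis
    proof cases
      case 1
      then show ?thesis by (simp add: B_def bounded_linear_image blinfun.bounded_linear_right)
    next
      case 2
      have "norm (N (y - x i)) \<le> (R + \<rho>)\<^sup>2" if "y \<in> B" for y :: 'a
      proof -
        have "norm (y - x i) \<le> R + \<rho>"
          using norm_triangle_ineq4[of y "x i"] that \<rho>[OF 2(1)] by (simp add: B_def)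
        then have "(norm (y - x i))\<^sup>2 \<le> (R + \<rho>)\<^sup>2" by (rule power_mono) simp
        then show ?thesis
          using smooth_gauge_empty(2)[OF N, of "y - x i"] smooth_gauge_nonneg[OF N, of "y - x i"] by simp
      qed
      then show ?thesis unfolding 2(2) bounded_iff by blast
    qed
  qed
  have fin: "finite \<Gamma>" using \<Phi> I by (simp add: \<Gamma>_def)
  obtain Y where Y: "finite Y" "Y \<subseteq> B" and net: "\<And>y :: 'a. y \<in> B \<Longrightarrow> \<exists>z\<in>Y. \<forall>\<gamma>\<in>\<Gamma>. \<bar>\<gamma> y - \<gamma> z\<bar> < \<delta>"
    using finite_net_bounded_functions[OF fin bdd \<delta>] by blast
  show ?thesis
  proof (rule that[of "x ` I \<union> v ` \<Phi> \<union> Y"])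
    show "finite (x ` I \<union> v ` \<Phi> \<union> Y)" using \<Phi> I Y by simp
    show "x ` I \<subseteq> x ` I \<union> v ` \<Phi> \<union> Y" by blast
    fix y :: 'a assume "norm y \<le> R"
    then have "y \<in> B" by (simp add: B_def)
    then obtain z where z: "z \<in> Y" "\<And>\<gamma>. \<gamma> \<in> \<Gamma> \<Longrightarrow> \<bar>\<gamma> y - \<gamma> z\<bar> < \<delta>" using net by blast
    define e where "e = z + dual_sum \<Phi> v (y - z)"
    have eE: "e \<in> span (x ` I \<union> v ` \<Phi> \<union> Y)"
      unfolding e_def by (intro span_add span_sum span_scale span_base) (use z(1) in auto)
    have ek: "e - y \<in> kern \<Phi>"
      using v[of _ "y - z"] by (auto simp: kern_def e_def blinfun.diff_right blinfun.add_right)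
    have "norm (e - z) \<le> (\<Sum>\<psi>\<in>\<Phi>. norm (blinfun_apply \<psi> (y - z) *\<^sub>R v \<psi>))"
      unfolding e_def by (simp only: add_diff_cancel_left') (rule norm_sum)
    also have "\<dots> \<le> (\<Sum>\<psi>\<in>\<Phi>. \<delta> * norm (v \<psi>))"
    proof (rule sum_mono)
      fix \<psi> assume "\<psi> \<in> \<Phi>"
      then have "\<bar>blinfun_apply \<psi> (y - z)\<bar> \<le> \<delta>"
        using z(2)[of "blinfun_apply \<psi>"] by (simp add: \<Gamma>_def blinfun.diff_right)
      then show "norm (blinfun_apply \<psi> (y - z) *\<^sub>R v \<psi>) \<le> \<delta> * norm (v \<psi>)"
        by (simp add: mult_right_mono)
    qed
    also have "\<dots> = \<delta> * (s - 1)" unfolding s_def by (simp only: sum_distrib_left add_diff_cancel_right')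
    also have "\<dots> \<le> \<delta> * s" using \<delta> by simp
    finally have ez: "norm (e - z) \<le> \<delta> * s" .
    have "N (e - x i) \<le> N (y - x i) + \<eta>" if i: "i \<in> I" for i
    proof -
      have "norm z \<le> R" using z(1) Y(2) by (auto simp: B_def)
      moreover have "norm (e - x i) \<le> norm (e - z) + norm z + norm (x i)" by norm
      ultimately have en: "norm (e - x i) \<le> R + 1 + \<rho>" using ez \<delta>s(1) \<rho>[OF i] by linarith
      have "N (e - x i) \<le> N (z - x i) + 4 * norm (e - x i) * norm (e - z)"
        using smooth_gauge_growth[OF N, of "e - x i" "z - x i"] by simp
      also have "4 * norm (e - x i) * norm (e - z) \<le> 4 * (R + 1 + \<rho>) * (\<delta> * s)"
        using en R \<rho>0 by (intro mult_mono ez) auto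
      also have "N (z - x i) \<le> N (y - x i) + \<delta>"
        using z(2)[of "\<lambda>y. N (y - x i)"] i by (auto simp: \<Gamma>_def abs_less_iff)
      also have "N (y - x i) + \<delta> + 4 * (R + 1 + \<rho>) * (\<delta> * s) = N (y - x i) + \<delta> * Q"
        by (simp add: Q_def algebra_simps)
      finally show ?thesis using \<delta>s(2) by linarith
    qed
    then show "\<exists>e\<in>span (x ` I \<union> v ` \<Phi> \<union> Y). e - y \<in> kern \<Phi> \<and> (\<forall>i\<in>I. N (e - x i) \<le> N (y - x i) + \<eta>)"
      using eE ek by blast
  qed
qed

lemma C1_deriv_prod:
  fixes p :: "'i \<Rightarrow> 'a::real_normed_vector \<Rightarrow> real"
  assumes "finite I" "\<And>i. i \<in> I \<Longrightarrow> C1_deriv (p i) (p' i)"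
  shows "C1_deriv (\<lambda>x. \<Prod>i\<in>I. p i x) (\<lambda>x. \<Sum>i\<in>I. (\<Prod>j\<in>I - {i}. p j x) *\<^sub>R p' i x)"
  using assms
proof (induction I rule: finite_induct)
  case empty
  then show ?case by (simp add: C1_deriv_const)
next
  case (insert k I)
  have "(\<Sum>i\<in>insert k I. (\<Prod>j\<in>insert k I - {i}. p j x) *\<^sub>R p' i x) =
      p k x *\<^sub>R (\<Sum>i\<in>I. (\<Prod>j\<in>I - {i}. p j x) *\<^sub>R p' i x) + (\<Prod>i\<in>I. p i x) *\<^sub>R p' k x" for x
  proof -
    have "insert k I - {i} = insert k (I - {i})" if "i \<in> I" for i using insert.hyps that by auto
    then have "(\<Sum>i\<in>I. (\<Prod>j\<in>insert k I - {i}. p j x) *\<^sub>R p' i x) = (\<Sum>i\<in>I. p k x *\<^sub>R ((\<Prod>j\<in>I - {i}. p j x) *\<^sub>R p' i x))"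
      using insert.hyps by (intro sum.cong) auto
    then show ?thesis using insert.hyps by (simp add: scaleR_sum_right)
  qed
  moreover have "C1_deriv (\<lambda>x. p k x * (\<Prod>i\<in>I. p i x)) (\<lambda>x. p k x *\<^sub>R (\<Sum>i\<in>I. (\<Prod>j\<in>I - {i}. p j x) *\<^sub>R p' i x) + (\<Prod>i\<in>I. p i x) *\<^sub>R p' k x)"
    using insert by (intro C1_deriv_mult) auto
  ultimately show ?case using insert.hyps by (simp add: add.commute)
qed

text \<open>
  On the fibres of \<open>\<Phi>\<close>, a critical point of a positive combination of the convex functions
  \<open>N (y - x i) + \<kappa> * N\<^sub>E y\<close> is a minimizer, hence close to \<open>span E\<close> by the choice of \<open>E\<close>. The map \<open>H\<close>
  has no values there, and composing with it destroys all critical points along \<open>kern \<Phi>\<close>.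
\<close>

theorem cutoff_without_critical_points:
  fixes x :: "'i \<Rightarrow> 'a::real_normed_vector"
  assumes inf: "infinite_dimensional TYPE('a)"
    and gauge: "\<And>E :: 'a set. \<exists>M M'. smooth_gauge E M M'"
    and N: "smooth_gauge {} N N'" and I: "finite I" and \<Phi>: "finite \<Phi>"
    and ab: "\<And>i. i \<in> I \<Longrightarrow> a i < b i"
  obtains \<theta> \<theta>' where "C1_deriv \<theta> \<theta>'" "\<And>y. 0 \<le> \<theta> y" "\<And>y. \<theta> y \<le> 1"
    "\<And>y i. i \<in> I \<Longrightarrow> N (y - x i) \<le> a i \<Longrightarrow> \<theta> y = 1"
    "\<And>y. (\<And>i. i \<in> I \<Longrightarrow> b i \<le> N (y - x i)) \<Longrightarrow> \<theta> y = (0::real)"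
    "\<And>y. (\<And>v. v \<in> kern \<Phi> \<Longrightarrow> \<theta>' y v = 0) \<Longrightarrow> \<theta>' y = 0"
proof -
  \<comment> \<open>A tolerance of \<gamma> at either end of each interval still leaves the positive
    width \<open>w i\<close> for the step.\<close>
  obtain \<gamma> where \<gamma>: "\<gamma> > 0" "\<And>i. i \<in> I \<Longrightarrow> 4 * \<gamma> \<le> b i - a i"
  proof (cases "I = {}")
    case True
    then show ?thesis using that[of 1] by simp
  next
    case False
    define g where "g = Min ((\<lambda>i. (b i - a i) / 4) ` I)"
    have "g > 0" unfolding g_def using ab I False by (subst Min_gr_iff) auto
    moreover have "g \<le> (b i - a i) / 4" if "i \<in> I" for i unfolding g_def using I that by (intro Min_le) auto
    ultimately show ?thesis using that[of g] by fastforce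
  qed
  define \<rho> where "\<rho> = (\<Sum>i\<in>I. norm (x i))"
  have \<rho>: "norm (x i) \<le> \<rho>" if "i \<in> I" for i unfolding \<rho>_def by (rule member_le_sum) (use that I in auto)
  have \<rho>0: "\<rho> \<ge> 0" by (simp add: \<rho>_def sum_nonneg)
  define \<beta> where "\<beta> = (\<Sum>i\<in>I. \<bar>b i\<bar>)"
  have \<beta>': "\<bar>b i\<bar> \<le> \<beta>" if "i \<in> I" for i
    unfolding \<beta>_def by (rule member_le_sum[where f = "\<lambda>i. \<bar>b i\<bar>"]) (use that I in auto)
  then have \<beta>: "b i \<le> \<beta>" if "i \<in> I" for i using that by (meson abs_le_D1)
  have \<beta>0: "\<beta> \<ge> 0" by (simp add: \<beta>_def sum_nonneg)
  \<comment> \<open>The first tolerance is shared equally: \<open>\<kappa> * M\<close> costs at most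
    \<open>\<gamma> / 2\<close> where \<open>N (y - x i) \<le> a i\<close>, since there
    \<open>M (H y) \<le> 4 * \<beta>\<close>, and the displacement by \<open>H\<close>, at most
    \<mu>, costs another \<open>\<gamma> / 2\<close>.\<close>
  define \<kappa> where "\<kappa> = \<gamma> / (8 * (\<beta> + 1))"
  have \<kappa>: "\<kappa> > 0" using \<gamma> \<beta>0 by (simp add: \<kappa>_def)
  have \<kappa>\<beta>: "\<kappa> * (4 * \<beta>) \<le> \<gamma> / 2"
  proof -
    have "\<kappa> * (4 * \<beta>) \<le> \<kappa> * (4 * (\<beta> + 1))" using \<kappa> by simp
    also have "\<dots> = \<gamma> / 2" using \<beta>0 by (simp add: \<kappa>_def field_simps)
    finally show ?thesis .
  qed
  define \<mu> where "\<mu> = min 1 (\<gamma> / (8 * (2 * \<beta> + 3)))"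
  have \<mu>: "\<mu> > 0" "\<mu> \<le> 1" using \<gamma> \<beta>0 by (simp_all add: \<mu>_def)
  have \<mu>\<beta>: "4 * (2 * \<beta> + 3) * \<mu> \<le> \<gamma> / 2"
  proof -
    have "4 * (2 * \<beta> + 3) * \<mu> \<le> 4 * (2 * \<beta> + 3) * (\<gamma> / (8 * (2 * \<beta> + 3)))"
      using \<beta>0 by (intro mult_left_mono) (auto simp: \<mu>_def)
    also have "\<dots> = \<gamma> / 2" using \<beta>0 by (simp add: field_simps)
    finally show ?thesis .
  qed
  \<comment> \<open>The order of choice matters: \<open>r\<close> and \<eta> are fixed before
    \<open>E\<close> and \<open>M\<close>, which is possible because the displacement bound of
    \<open>deletion_map\<close> involves \<open>r\<close> alone.\<close>
  define r where "r = \<mu> / 5000"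
  have r: "r > 0" using \<mu> by (simp add: r_def)
  \<comment> \<open>Half of what \<open>\<kappa> * M\<close> gains on the way from a value of
    \<open>H\<close>, where \<open>M \<ge> r\<^sup>2\<close>, to \<open>span E\<close>, where
    \<open>M = 0\<close>; the other half outweighs the loss in \<open>N\<close>.\<close>
  define \<eta> where "\<eta> = \<kappa> * r\<^sup>2 / 2"
  have \<eta>: "\<eta> > 0" using \<kappa> r by (simp add: \<eta>_def)
  define R where "R = 2 * (\<beta> + 1) + \<rho>"
  have R: "R \<ge> 0" using \<beta>0 \<rho>0 by (simp add: R_def)
  obtain E where E: "finite E" "x ` I \<subseteq> E"
    and near: "\<And>y. norm y \<le> R \<Longrightarrow> \<exists>e\<in>span E. e - y \<in> kern \<Phi> \<and> (\<forall>i\<in>I. N (e - x i) \<le> N (y - x i) + \<eta>)"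
    using near_minimizers[OF N \<Phi> I R \<eta>, of x] by blast
  obtain M M' where M: "smooth_gauge E M M'" using gauge by blast
  obtain H H' where H: "C1_deriv H H'" and del: "\<And>y. r\<^sup>2 \<le> M (H y)"
    and mv: "\<And>y. norm (H y - y) \<le> 5000 * r" and onto: "\<And>y. onto_on (kern \<Phi>) (H' y)"
    using deletion_map[OF inf E(1) \<Phi> r M] by blast
  have move: "norm (H y - y) \<le> \<mu>" for y using mv[of y] by (simp add: r_def)
  define s where "s i y = N (y - x i) + \<kappa> * M y" for i y
  define s' where "s' i y = N' (y - x i) + \<kappa> *\<^sub>R M' y" for i y
  have sC1: "C1_deriv (s i) (s' i)" for i
  proof -
    have "C1_deriv (\<lambda>y. \<kappa> * M y) (\<lambda>y. \<kappa> *\<^sub>R M' y)"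
      using C1_deriv_mult[OF C1_deriv_const smooth_gauge_C1[OF M], of \<kappa>] by simp
    then show ?thesis unfolding s_def[abs_def] s'_def[abs_def]
      by (intro C1_deriv_add C1_deriv_shift smooth_gauge_C1[OF N])
  qed
  define w where "w i = b i - a i - 2 * \<gamma>" for i
  have w: "w i > 0" if "i \<in> I" for i using \<gamma>(1) \<gamma>(2)[OF that] by (simp add: w_def)
  define z where "z i y = (s i (H y) - (a i + \<gamma>)) * (1 / w i)" for i y
  define z' where "z' i y = (1 / w i) *\<^sub>R (s' i (H y) o\<^sub>L H' y)" for i y
  have zC1: "C1_deriv (z i) (z' i)" for i
    using C1_deriv_mult[OF C1_deriv_diff[OF C1_deriv_compose[OF sC1 H] C1_deriv_const] C1_deriv_const,
        of i "a i + \<gamma>" "1 / w i"]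
    by (simp add: z_def[abs_def] z'_def[abs_def])
  define p where "p i y = step (z i y)" for i y
  have pC1: "C1_deriv (p i) (\<lambda>y. step' (z i y) *\<^sub>R z' i y)" for i
    unfolding p_def[abs_def] by (rule C1_deriv_real_compose[OF step_has_derivative continuous_step' zC1])
  have p01: "0 \<le> p i y" "p i y \<le> 1" for i y by (simp_all add: p_def step_bounds)
  define \<theta> where "\<theta> y = 1 - (\<Prod>i\<in>I. p i y)" for y
  define c where "c i y = (\<Prod>j\<in>I - {i}. p j y) * step' (z i y) / w i" for i y
  define \<theta>' where "\<theta>' y = 0 - (\<Sum>i\<in>I. (\<Prod>j\<in>I - {i}. p j y) *\<^sub>R (step' (z i y) *\<^sub>R z' i y))" for y
  have \<theta>C1: "C1_deriv \<theta> \<theta>'"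
    unfolding \<theta>_def[abs_def] \<theta>'_def[abs_def]
    by (intro C1_deriv_diff C1_deriv_const C1_deriv_prod I pC1)
  have \<theta>'_apply: "\<theta>' y v = - (\<Sum>i\<in>I. c i y * s' i (H y) (H' y v))" for y v
    by (simp add: \<theta>'_def c_def z'_def blinfun.bilinear_simps blinfun.sum_left mult.assoc)
  have c0: "c i y \<ge> 0" if "i \<in> I" for i y
    using w[OF that] p01 by (auto simp: c_def step'_nonneg intro!: prod_nonneg divide_nonneg_pos mult_nonneg_nonneg)
  show ?thesis
  proof (rule that[OF \<theta>C1])
    have pr: "0 \<le> (\<Prod>i\<in>I. p i y)" "(\<Prod>i\<in>I. p i y) \<le> 1" for y
      using p01 by (auto intro: prod_nonneg prod_le_1)
    show "0 \<le> \<theta> y" "\<theta> y \<le> 1" for y using pr[of y] by (simp_all add: \<theta>_def)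
    show "\<theta> y = 1" if i: "i \<in> I" and le: "N (y - x i) \<le> a i" for y i
    proof -
      have a\<beta>: "a i + 4 * \<gamma> \<le> \<beta>" using \<beta>[OF i] \<gamma>(2)[OF i] by linarith
      have "norm (y - x i) \<le> 2 * (\<beta> + 1)"
        by (rule smooth_gauge_empty_norm_le[OF N _ \<beta>0]) (use le a\<beta> \<gamma>(1) in linarith)
      then have nH: "norm (H y - x i) \<le> 2 * \<beta> + 3"
        using norm_triangle_ineq[of "H y - y" "y - x i"] move[of y] \<mu>(2) by simp
      have "N (H y - x i) \<le> N (y - x i) + 4 * norm (H y - x i) * norm (H y - y)"
        using smooth_gauge_growth[OF N, of "H y - x i" "y - x i"] by simp
      also have "4 * norm (H y - x i) * norm (H y - y) \<le> 4 * (2 * \<beta> + 3) * \<mu>"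
        using nH move[of y] \<beta>0 by (intro mult_mono) auto
      finally have NH: "N (H y - x i) \<le> a i + \<gamma> / 2" using le \<mu>\<beta> by linarith
      have "M (H y) \<le> (infdist (H y) (span E))\<^sup>2" using M by (simp add: smooth_gauge_def)
      also have "\<dots> \<le> (norm (H y - x i))\<^sup>2"
        using infdist_le[of "x i" "span E" "H y"] E(2) i
        by (intro power_mono) (auto simp: dist_norm infdist_nonneg span_base)
      also have "\<dots> \<le> 4 * N (H y - x i)" using smooth_gauge_empty(1)[OF N, of "H y - x i"] by simp
      also have "\<dots> \<le> 4 * \<beta>" using NH a\<beta> \<gamma>(1) by linarith
      finally have "\<kappa> * M (H y) \<le> \<kappa> * (4 * \<beta>)" using \<kappa> by simp
      then have "s i (H y) \<le> a i + \<gamma>" using NH \<kappa>\<beta> by (simp add: s_def)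
      then have "z i y \<le> 0" unfolding z_def using w[OF i] by (intro mult_nonpos_nonneg) auto
      then have "p i y = 0" by (simp add: p_def step_eq_0)
      then show ?thesis using i I by (auto simp: \<theta>_def)
    qed
    show "\<theta> y = 0" if ge: "\<And>i. i \<in> I \<Longrightarrow> b i \<le> N (y - x i)" for y
    proof -
      have "p i y = 1" if i: "i \<in> I" for i
      proof -
        have "b i - \<gamma> \<le> N (H y - x i)"
        proof (rule ccontr)
          assume "\<not> b i - \<gamma> \<le> N (H y - x i)"
          then have less: "N (H y - x i) < b i - \<gamma>" by simp
          have "norm (H y - x i) \<le> 2 * (\<beta> + 1)"
            by (rule smooth_gauge_empty_norm_le[OF N _ \<beta>0]) (use less \<beta>[OF i] \<gamma>(1) in linarith)
          then have ny: "norm (y - x i) \<le> 2 * \<beta> + 3"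
            using norm_triangle_ineq4[of "H y - x i" "H y - y"] move[of y] \<mu>(2) by simp
          have "N (y - x i) \<le> N (H y - x i) + 4 * norm (y - x i) * norm (H y - y)"
            using smooth_gauge_growth[OF N, of "y - x i" "H y - x i"] by (simp add: norm_minus_commute)
          also have "4 * norm (y - x i) * norm (H y - y) \<le> 4 * (2 * \<beta> + 3) * \<mu>"
            using ny move[of y] \<beta>0 by (intro mult_mono) auto
          finally show False using less \<mu>\<beta> \<gamma>(1) ge[OF i] by linarith
        qed
        moreover have "0 \<le> \<kappa> * M (H y)" using \<kappa> smooth_gauge_nonneg[OF M, of "H y"] by simp
        ultimately have "w i \<le> s i (H y) - (a i + \<gamma>)" by (simp add: s_def w_def)
        then have "1 \<le> z i y" using w[OF i] by (simp add: z_def)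
        then show ?thesis by (simp add: p_def step_eq_1)
      qed
      then show ?thesis by (simp add: \<theta>_def)
    qed
    show "\<theta>' y = 0" if van: "\<And>v. v \<in> kern \<Phi> \<Longrightarrow> \<theta>' y v = 0" for y
    proof (cases "\<forall>i\<in>I. c i y = 0")
      case True
      then show ?thesis by (intro blinfun_eqI) (simp add: \<theta>'_apply)
    next
      case False
      then obtain k where k: "k \<in> I" "c k y \<noteq> 0" by blast
      define q where "q = H y"
      \<comment> \<open>A nonzero weight means that the step \<open>k\<close> is not yet complete,
        which bounds \<open>q\<close> and makes \<open>near\<close> applicable.\<close>
      have "step' (z k y) \<noteq> 0" using k by (auto simp: c_def)
      then have "z k y < 1" using step'_eq_0[of "z k y"] by fastforce
      then have "s k q < b k - \<gamma>" using w[OF k(1)] by (simp add: z_def w_def q_def divide_less_eq)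
      moreover have "0 \<le> \<kappa> * M q" using \<kappa> smooth_gauge_nonneg[OF M, of q] by simp
      ultimately have "N (q - x k) \<le> \<beta>" using \<beta>[OF k(1)] \<gamma>(1) by (simp add: s_def)
      then have "norm (q - x k) \<le> 2 * (\<beta> + 1)" by (rule smooth_gauge_empty_norm_le[OF N _ \<beta>0])
      then have "norm q \<le> R"
        using norm_triangle_ineq[of "q - x k" "x k"] \<rho>[OF k(1)] by (simp add: R_def)
      then obtain e where e: "e \<in> span E" "e - q \<in> kern \<Phi>" "\<And>i. i \<in> I \<Longrightarrow> N (e - x i) \<le> N (q - x i) + \<eta>"
        using near by blast
      obtain v where v: "v \<in> kern \<Phi>" "H' y v = e - q"
        using onto[of y] e(2) by (auto simp: onto_on_def)
      have "(\<Sum>i\<in>I. c i y * s' i q (e - q)) = 0"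
        using van[OF v(1)] by (simp add: \<theta>'_apply v(2) q_def[symmetric])
      \<comment> \<open>By convexity \<open>e - q\<close> is a common descent direction of all
        \<open>s i\<close>, so no nonnegative combination of their derivatives with a positive
        weight can vanish on it.\<close>
      moreover have neg: "s' i q (e - q) \<le> - \<eta>" if i: "i \<in> I" for i
      proof -
        have "N (q - x i) + N' (q - x i) ((e - x i) - (q - x i)) \<le> N (e - x i)"
          using N unfolding smooth_gauge_def by blast
        then have 1: "N' (q - x i) (e - q) \<le> \<eta>" using e(3)[OF i] by simp
        have "M q + M' q (e - q) \<le> M e" using M unfolding smooth_gauge_def by blast
        then have "M' q (e - q) \<le> - r\<^sup>2"
          using smooth_gauge_span_eq_0[OF M e(1)] del[of y] by (simp add: q_def)
        then have "\<kappa> * M' q (e - q) \<le> \<kappa> * (- r\<^sup>2)" using \<kappa> by (intro mult_left_mono) auto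
        also have "\<dots> = - 2 * \<eta>" by (simp add: \<eta>_def)
        finally show ?thesis using 1 by (simp add: s'_def blinfun.add_left blinfun.scaleR_left)
      qed
      have "(\<Sum>i\<in>I. c i y * s' i q (e - q)) \<le> (\<Sum>i\<in>I. c i y * (- \<eta>))"
        using neg c0 by (intro sum_mono mult_left_mono) auto
      moreover have "(\<Sum>i\<in>I. c i y * (- \<eta>)) = - (\<eta> * (\<Sum>i\<in>I. c i y))"
        by (simp add: sum_negf sum_distrib_left mult.commute)
      moreover have "0 < (\<Sum>i\<in>I. c i y)"
      proof (rule sum_pos2[OF I k(1)])
        show "0 < c k y" using k(2) c0[OF k(1), of y] by linarith
      qed (rule c0)
      ultimately have False using \<eta> by (simp add: mult_le_0_iff)
      then show ?thesis ..
    qed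
  qed
qed

subsection \<open>Variational principle and separability of the dual\<close>

text \<open>The sets \<open>S x\<close> are the lower sets of an order. Choosing almost minimal
  points in successive ones makes their diameters shrink to 0, and the limit is minimal in the
  order.\<close>

lemma Ekeland_variational_principle:
  fixes G :: "'a::complete_space \<Rightarrow> real"
  assumes cont: "continuous_on UNIV G" and bdd: "\<And>y. B \<le> G y" and \<delta>: "\<delta> > 0"
  obtains x where "\<And>y. G x \<le> G y + \<delta> * dist x y"
proof -
  define S where "S x = {y. G y + \<delta> * dist x y \<le> G x}" for x
  have self: "x \<in> S x" for x by (simp add: S_def)
  have trans: "S y \<subseteq> S x" if "y \<in> S x" for x y
  proof
    fix z assume "z \<in> S y"
    then have "G z + \<delta> * dist x z \<le> G z + \<delta> * (dist x y + dist y z)"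
      using \<delta> dist_triangle[of x z y] by simp
    also have "\<dots> \<le> G x" using \<open>z \<in> S y\<close> that by (simp add: S_def distrib_left)
    finally show "z \<in> S x" by (simp add: S_def)
  qed
  have "\<exists>y. y \<in> S x \<and> (\<forall>z\<in>S x. G y \<le> G z + (1/2) ^ n)" for x and n :: nat
  proof -
    have bb: "bdd_below (G ` S x)" using bdd by (auto intro!: bdd_belowI[of _ B])
    have ne: "G ` S x \<noteq> {}" using self by blast
    have "Inf (G ` S x) < Inf (G ` S x) + (1/2) ^ n" by simp
    then obtain y where y: "y \<in> S x" "G y < Inf (G ` S x) + (1/2) ^ n"
      using cInf_less_iff[OF ne bb] by blast
    have "G y \<le> G z + (1/2) ^ n" if "z \<in> S x" for z
      using cInf_lower[OF imageI[OF that] bb] y(2) by linarith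
    then show ?thesis using y(1) by blast
  qed
  then obtain nx where nx: "\<And>x n. nx x n \<in> S x" "\<And>x n z. z \<in> S x \<Longrightarrow> G (nx x n) \<le> G z + (1/2) ^ n"
    by metis
  \<comment> \<open>The starting point is arbitrary, hence \<open>undefined\<close>.\<close>
  define s where "s = rec_nat undefined (\<lambda>n x. nx x n)"
  have s: "s (Suc n) = nx (s n) n" for n by (simp add: s_def)
  have mono: "S (s m) \<subseteq> S (s n)" if "n \<le> m" for n m
    using that
  proof (induction m rule: dec_induct)
    case (step k)
    then show ?case using trans[OF nx(1)[of "s k" k]] by (auto simp: s)
  qed simp
  have small: "dist (s (Suc n)) y \<le> (1/2) ^ n / \<delta>" if "y \<in> S (s (Suc n))" for n y
  proof -
    have "y \<in> S (s n)" using mono[of n "Suc n"] that by auto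
    then have "G (s (Suc n)) \<le> G y + (1/2) ^ n" unfolding s by (rule nx(2))
    moreover have "G y + \<delta> * dist (s (Suc n)) y \<le> G (s (Suc n))" using that by (simp add: S_def)
    ultimately show ?thesis using \<delta> by (simp add: pos_le_divide_eq mult.commute)
  qed
  have lim0: "(\<lambda>n. (1/2) ^ n / \<delta>) \<longlonglongrightarrow> 0"
    using tendsto_divide[OF LIMSEQ_realpow_zero[of "1/2::real"] tendsto_const[of \<delta>]] \<delta> by simp
  have "Cauchy s"
  proof (rule metric_CauchyI)
    fix e :: real assume "e > 0"
    then obtain n where n: "(1/2) ^ n / \<delta> < e / 2"
      using order_tendstoD(2)[OF lim0, of "e / 2"] by (auto simp: eventually_sequentially)
    have half: "dist (s (Suc n)) (s m) < e / 2" if "m \<ge> Suc n" for m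
    proof -
      have "s m \<in> S (s (Suc n))" using mono[OF that] self[of "s m"] by blast
      from small[OF this] n show ?thesis by linarith
    qed
    have "dist (s i) (s j) < e" if "i \<ge> Suc n" "j \<ge> Suc n" for i j
      by (rule dist_triangle_half_r[OF half[OF that(1)] half[OF that(2)]])
    then show "\<exists>M. \<forall>i\<ge>M. \<forall>j\<ge>M. dist (s i) (s j) < e" by blast
  qed
  then have "convergent s" by (rule Cauchy_convergent)
  then obtain x where x: "s \<longlonglongrightarrow> x" unfolding convergent_def ..
  have xS: "x \<in> S (s n)" for n
  proof -
    have "(\<lambda>m. G (s m)) \<longlonglongrightarrow> G x"
      using continuous_on_tendsto_compose[OF cont x] by simp
    then have lim: "(\<lambda>m. G (s m) + \<delta> * dist (s n) (s m)) \<longlonglongrightarrow> G x + \<delta> * dist (s n) x"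
      by (intro tendsto_intros x)
    have "G (s m) + \<delta> * dist (s n) (s m) \<le> G (s n)" if "m \<ge> n" for m
    proof -
      have "s m \<in> S (s n)" using mono[OF that] self[of "s m"] by blast
      then show ?thesis by (simp add: S_def)
    qed
    then have "\<exists>M. \<forall>m\<ge>M. G (s m) + \<delta> * dist (s n) (s m) \<le> G (s n)" by blast
    from LIMSEQ_le_const2[OF lim this] have "G x + \<delta> * dist (s n) x \<le> G (s n)" .
    then show ?thesis by (simp add: S_def)
  qed
  have "G x \<le> G y + \<delta> * dist x y" for y
  proof (rule ccontr)
    assume less: "\<not> ?thesis"
    then have "y \<in> S x" by (simp add: S_def)
    then have "y \<in> S (s (Suc n))" for n by (rule subsetD[OF trans[OF xS]])
    then have le: "dist (s (Suc n)) y \<le> (1/2) ^ n / \<delta>" for n by (rule small)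
    have "(\<lambda>n. dist (s (Suc n)) y) \<longlonglongrightarrow> 0"
      by (rule tendsto_sandwich[OF _ _ tendsto_const lim0]) (intro always_eventually allI le zero_le_dist)+
    then have "(\<lambda>n. s (Suc n)) \<longlonglongrightarrow> y" by (rule iffD2[OF tendsto_dist_iff])
    from LIMSEQ_unique[OF LIMSEQ_Suc[OF x] this] have "x = y" .
    then show False using less by simp
  qed
  then show ?thesis using that by blast
qed

lemma derivative_lower_bound:
  fixes G :: "'a::real_normed_vector \<Rightarrow> real"
  assumes der: "(G has_derivative blinfun_apply A) (at x)" and le: "\<And>y. G x \<le> G y + e * dist x y" and e: "e > 0"
  shows "norm A \<le> e"
proof -
  have lower: "- (e * norm v) \<le> A v" for v
  proof (rule field_le_epsilon)
    fix \<eta>' :: real assume \<eta>': "\<eta>' > 0"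
    define \<eta> where "\<eta> = \<eta>' / (norm v + 1)"
    have nv: "norm v + 1 > 0" by (simp add: add_nonneg_pos)
    have \<eta>: "\<eta> > 0" "\<eta> * norm v \<le> \<eta>'" using \<eta>' nv by (auto simp: \<eta>_def field_simps)
    obtain d where d: "d > 0" "\<And>y. norm (y - x) < d \<Longrightarrow> norm (G y - G x - A (y - x)) \<le> \<eta> * norm (y - x)"
      using der \<eta>(1) unfolding has_derivative_at_alt by blast
    define t where "t = d / (2 * (norm v + 1))"
    have t: "t > 0" using d nv by (simp add: t_def)
    have "norm (t *\<^sub>R v) < d"
    proof -
      have "norm (t *\<^sub>R v) = d * (norm v / (2 * (norm v + 1)))" using d(1) nv by (simp add: t_def)
      also have "\<dots> < d * 1" using d nv by (intro mult_strict_left_mono) (auto simp: divide_less_eq)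
      finally show ?thesis by simp
    qed
    then have "\<bar>G (x + t *\<^sub>R v) - G x - A (t *\<^sub>R v)\<bar> \<le> \<eta> * (t * norm v)"
      using d(2)[of "x + t *\<^sub>R v"] t by simp
    moreover have "G x \<le> G (x + t *\<^sub>R v) + e * (t * norm v)"
      using le[of "x + t *\<^sub>R v"] t by (simp add: dist_norm)
    ultimately have "- (e * (t * norm v)) - \<eta> * (t * norm v) \<le> t * A v"
      by (simp add: blinfun.scaleR_right)
    then have "t * (- (e * norm v) - \<eta> * norm v) \<le> t * A v"
      by (simp add: algebra_simps)
    then have "- (e * norm v) - \<eta> * norm v \<le> A v" using t by simp
    then show "- (e * norm v) \<le> A v + \<eta>'" using \<eta>(2) by linarith
  qed
  show ?thesis
  proof (rule norm_blinfun_bound)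
    show "norm (A v) \<le> e * norm v" for v
      using lower[of v] lower[of "-v"] by (simp add: blinfun.minus_right abs_le_iff)
  qed (use e in simp)
qed

theorem separable_dual_if_smooth_approximation:
  fixes g :: "'a::banach \<Rightarrow> real"
  assumes sep: "separable_space (euclidean :: 'a topology)"
    and g: "C1_smooth g" and approx: "\<And>y. \<bar>(norm y)\<^sup>2 - g y\<bar> \<le> 1"
  shows "separable_space (euclidean :: ('a \<Rightarrow>\<^sub>L real) topology)"
proof -
  obtain g' where g': "C1_deriv g g'" using g by (auto simp: C1_smooth_iff)
  have dense: "\<exists>x. norm (g' x - \<phi>) \<le> e" if e: "e > 0" for \<phi> e
  proof -
    have d: "C1_deriv (\<lambda>y. g y - \<phi> y) (\<lambda>y. g' y - \<phi>)"
      by (rule C1_deriv_diff[OF g' C1_deriv_blinfun])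
    have "- 1 - (norm \<phi>)\<^sup>2 \<le> g y - \<phi> y" for y
    proof -
      have "\<phi> y \<le> norm \<phi> * norm y" using blinfun_abs_le[of \<phi> y] by simp
      moreover have "(norm y)\<^sup>2 - 1 \<le> g y" using approx[of y] by linarith
      moreover have "0 \<le> (norm y - norm \<phi> / 2)\<^sup>2" by simp
      then have "norm \<phi> * norm y \<le> (norm y)\<^sup>2 + (norm \<phi>)\<^sup>2 / 4"
        by (simp add: power2_diff power_divide algebra_simps)
      moreover have "(norm \<phi>)\<^sup>2 / 4 \<le> (norm \<phi>)\<^sup>2" by simp
      ultimately show ?thesis by linarith
    qed
    from Ekeland_variational_principle[OF C1_deriv_continuous_on[OF d] this e]
    obtain x where "\<And>y. g x - \<phi> x \<le> g y - \<phi> y + e * dist x y" by blast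
    from derivative_lower_bound[OF C1_deriv_has_derivative[OF d] this e] show ?thesis by blast
  qed
  obtain d :: "nat \<Rightarrow> 'a" where d: "\<And>y e. e > 0 \<Longrightarrow> \<exists>n. dist y (d n) < e"
    using separable_sequence[OF sep] by blast
  have "\<exists>\<psi>\<in>range (\<lambda>n. g' (d n)). dist \<psi> \<phi> < e" if e: "e > 0" for \<phi> e
  proof -
    obtain x where x: "norm (g' x - \<phi>) \<le> e / 2" using dense[of "e / 2"] e by auto
    have "isCont g' x" using g' by (simp add: C1_deriv_def continuous_on_eq_continuous_at)
    then obtain \<eta> where \<eta>: "\<eta> > 0" "\<And>y. dist y x < \<eta> \<Longrightarrow> dist (g' y) (g' x) < e / 2"
      using half_gt_zero[OF e] unfolding continuous_at_eps_delta by blast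
    obtain n where "dist x (d n) < \<eta>" using d[OF \<eta>(1)] by blast
    then have "dist (g' (d n)) (g' x) < e / 2" by (intro \<eta>(2)) (simp add: dist_commute)
    then have "dist (g' (d n)) \<phi> < e"
      using x dist_triangle[of "g' (d n)" \<phi> "g' x"] by (simp add: dist_norm)
    then show ?thesis by blast
  qed
  then have "closure (range (\<lambda>n. g' (d n))) = UNIV" by (auto simp: closure_approachable)
  then show ?thesis unfolding separable_space_def
    by (intro exI[of _ "range (\<lambda>n. g' (d n))"]) auto
qed

subsection \<open>Approximation\<close>

lemma C1_smooth_const: "C1_smooth (\<lambda>x. c)"
  unfolding C1_smooth_iff using C1_deriv_const by blast

lemma C1_smooth_add: "C1_smooth f \<Longrightarrow> C1_smooth g \<Longrightarrow> C1_smooth (\<lambda>x. f x + g x)"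
  unfolding C1_smooth_iff using C1_deriv_add by blast

lemma C1_smooth_diff: "C1_smooth f \<Longrightarrow> C1_smooth g \<Longrightarrow> C1_smooth (\<lambda>x. f x - g x)"
  unfolding C1_smooth_iff using C1_deriv_diff by blast

lemma C1_smooth_mult: "C1_smooth f \<Longrightarrow> C1_smooth g \<Longrightarrow> C1_smooth (\<lambda>x. f x * g x)"
  unfolding C1_smooth_iff using C1_deriv_mult by blast

lemma C1_smooth_step: "C1_smooth f \<Longrightarrow> C1_smooth (\<lambda>x. step (f x))"
  unfolding C1_smooth_iff using C1_deriv_real_compose[OF step_has_derivative continuous_step'] by blast

lemma C1_smooth_prod: "finite I \<Longrightarrow> (\<And>i. i \<in> I \<Longrightarrow> C1_smooth (p i)) \<Longrightarrow> C1_smooth (\<lambda>x. \<Prod>i\<in>I. p i x)"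
  by (induction I rule: finite_induct) (auto intro: C1_smooth_const C1_smooth_mult)

lemma C1_smooth_blinfun_shift: "C1_smooth (\<lambda>x. blinfun_apply \<phi> (x - c))"
  unfolding C1_smooth_iff using C1_deriv_shift[OF C1_deriv_blinfun] by blast

lemma derivative_eq_0_if_invariant:
  fixes g :: "'a::real_normed_vector \<Rightarrow> real"
  assumes "(g has_derivative blinfun_apply A) (at x)" "\<And>t. g (x + t *\<^sub>R v) = g x"
  shows "blinfun_apply A v = 0"
proof -
  have "((\<lambda>t::real. x + t *\<^sub>R v) has_derivative (\<lambda>t. t *\<^sub>R v)) (at 0)"
    by (auto intro!: derivative_eq_intros)
  moreover have "(g has_derivative blinfun_apply A) (at (x + 0 *\<^sub>R v))" using assms(1) by simp
  ultimately have "((\<lambda>t. g (x + t *\<^sub>R v)) has_derivative (\<lambda>t. blinfun_apply A (t *\<^sub>R v))) (at 0)"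
    by (rule has_derivative_compose)
  moreover have "(\<lambda>t. g (x + t *\<^sub>R v)) = (\<lambda>t. g x)" using assms(2) by auto
  ultimately have "((\<lambda>t::real. g x) has_derivative (\<lambda>t. blinfun_apply A (t *\<^sub>R v))) (at 0)" by simp
  then have "(\<lambda>t::real. blinfun_apply A (t *\<^sub>R v)) = (\<lambda>t. 0)"
    using has_derivative_unique[OF _ has_derivative_const] by blast
  from fun_cong[OF this, of 1] show ?thesis by simp
qed

text \<open>A Lindelof argument: countably many small balls around the dense sequence, each lying in
  a gauge ball, already cover the space. The factor 20 leaves room for comparing different centres
  later.\<close>

lemma countable_gauge_ball_cover:
  fixes f \<epsilon> :: "'a::real_normed_vector \<Rightarrow> real"
  assumes sep: "separable_space (euclidean :: 'a topology)" and N: "smooth_gauge {} N N'"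
    and f: "continuous_on UNIV f" and \<epsilon>: "continuous_on UNIV \<epsilon>" "\<And>x. \<epsilon> x > 0"
  obtains x :: "nat \<Rightarrow> 'a" and \<rho> where "\<And>i. \<rho> i > 0"
    "\<And>i y. norm (y - x i) \<le> 20 * \<rho> i \<Longrightarrow> \<bar>f y - f (x i)\<bar> < \<epsilon> (x i) / 8"
    "\<And>i y. norm (y - x i) \<le> 20 * \<rho> i \<Longrightarrow> \<epsilon> (x i) / 2 < \<epsilon> y"
    "\<And>y. \<exists>i. N (y - x i) < (\<rho> i)\<^sup>2"
proof -
  have "\<exists>r>0. \<forall>y. norm (y - p) \<le> 20 * r \<longrightarrow> \<bar>f y - f p\<bar> < \<epsilon> p / 8 \<and> \<epsilon> p / 2 < \<epsilon> y" for p
  proof -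
    have "isCont f p" "isCont \<epsilon> p" using f \<epsilon> by (simp_all add: continuous_on_eq_continuous_at)
    moreover have "\<epsilon> p / 8 > 0" "\<epsilon> p / 2 > 0" using \<epsilon>(2)[of p] by simp_all
    ultimately obtain d1 d2 where d: "d1 > 0" "\<And>y. dist y p < d1 \<Longrightarrow> dist (f y) (f p) < \<epsilon> p / 8"
      "d2 > 0" "\<And>y. dist y p < d2 \<Longrightarrow> dist (\<epsilon> y) (\<epsilon> p) < \<epsilon> p / 2"
      unfolding continuous_at_eps_delta by blast
    define r where "r = min d1 d2 / 21"
    have r: "r > 0" "20 * r < d1" "20 * r < d2" using d(1,3) by (auto simp: r_def min_def)
    have "\<bar>f y - f p\<bar> < \<epsilon> p / 8 \<and> \<epsilon> p / 2 < \<epsilon> y" if "norm (y - p) \<le> 20 * r" for y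
    proof -
      have "dist y p < d1" "dist y p < d2" using that r by (simp_all add: dist_norm)
      then show ?thesis using d(2)[of y] d(4)[of y] unfolding dist_real_def by (intro conjI) linarith+
    qed
    then show ?thesis using r(1) by blast
  qed
  then obtain R where R: "\<And>p. R p > 0"
    "\<And>p y. norm (y - p) \<le> 20 * R p \<Longrightarrow> \<bar>f y - f p\<bar> < \<epsilon> p / 8 \<and> \<epsilon> p / 2 < \<epsilon> y" by metis
  define U where "U p = {y. N (y - p) < (R p)\<^sup>2}" for p
  have Uo: "open (U p)" for p
    unfolding U_def using C1_deriv_continuous_on[OF C1_deriv_shift[OF smooth_gauge_C1[OF N]]]
    by (intro open_Collect_less continuous_intros) auto
  have Up: "p \<in> U p" for p using smooth_gauge_span_eq_0[OF N, of 0] R(1)[of p] by (simp add: U_def)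
  obtain d :: "nat \<Rightarrow> 'a" where d: "\<And>y e. e > 0 \<Longrightarrow> \<exists>n. dist y (d n) < e"
    using separable_sequence[OF sep] by blast
  \<comment> \<open>If no gauge ball contains the given ball, the choice is an arbitrary point. This
    does no harm, as every point carries a radius with the required oscillation bounds.\<close>
  define P where "P n k = (SOME p. ball (d n) (1 / real (Suc k)) \<subseteq> U p)" for n k
  define x where "x i = P (fst (prod_decode i)) (snd (prod_decode i))" for i
  show ?thesis
  proof (rule that[of "\<lambda>i. R (x i)" x])
    fix y
    obtain s where s: "s > 0" "ball y s \<subseteq> U y" using Uo Up open_contains_ball by blast
    obtain k where k: "1 / real (Suc k) < s / 2" using nat_approx_posE[of "s / 2"] s(1) by auto
    obtain n where n: "dist y (d n) < 1 / real (Suc k)" using d[of "1 / real (Suc k)"] by auto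
    have "ball (d n) (1 / real (Suc k)) \<subseteq> ball y s"
    proof
      fix z assume "z \<in> ball (d n) (1 / real (Suc k))"
      then have "dist y z < s" using dist_triangle[of y z "d n"] n k by simp
      then show "z \<in> ball y s" by simp
    qed
    then have "\<exists>p. ball (d n) (1 / real (Suc k)) \<subseteq> U p" using s(2) by blast
    then have "ball (d n) (1 / real (Suc k)) \<subseteq> U (P n k)" unfolding P_def by (rule someI_ex)
    moreover have "y \<in> ball (d n) (1 / real (Suc k))" using n by (simp add: dist_commute)
    ultimately have "y \<in> U (x (prod_encode (n, k)))" by (auto simp: x_def)
    then show "\<exists>i. N (y - x i) < (R (x i))\<^sup>2" by (auto simp: U_def)
  qed (use R in blast)+
qed

text \<open>
  A substitute for a partition of unity that needs no normalization: the weights of the \<open>c i\<close> sum up to 1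
  wherever one of the \<open>\<psi> i\<close> equals 1.
\<close>

primrec blend :: "(nat \<Rightarrow> 'a \<Rightarrow> real) \<Rightarrow> (nat \<Rightarrow> real) \<Rightarrow> nat \<Rightarrow> 'a \<Rightarrow> real" where
  "blend \<psi> c 0 y = 0"
| "blend \<psi> c (Suc i) y = \<psi> i y * c i + (1 - \<psi> i y) * blend \<psi> c i y"

lemma convex_combination_bound:
  fixes t a b c e :: real
  assumes "0 \<le> t" "t \<le> 1" "t \<noteq> 0 \<Longrightarrow> \<bar>a - c\<bar> \<le> e" "t \<noteq> 1 \<Longrightarrow> \<bar>b - c\<bar> \<le> e"
  shows "\<bar>t * a + (1 - t) * b - c\<bar> \<le> e"
proof (cases "t = 0 \<or> t = 1")
  case False
  have "\<bar>t * a + (1 - t) * b - c\<bar> = \<bar>t * (a - c) + (1 - t) * (b - c)\<bar>" by (simp add: algebra_simps)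
  also have "\<dots> \<le> t * \<bar>a - c\<bar> + (1 - t) * \<bar>b - c\<bar>"
    using assms(1,2) abs_triangle_ineq[of "t * (a - c)" "(1 - t) * (b - c)"] by (simp add: abs_mult)
  also have "\<dots> \<le> t * e + (1 - t) * e" using assms False by (intro add_mono mult_left_mono) auto
  finally show ?thesis by (simp add: algebra_simps)
qed (use assms in auto)

text \<open>At index \<open>k\<close> the recursion forgets everything before, including the start
  value 0; from there on it forms convex combinations of admissible values.\<close>

lemma blend_approx:
  assumes \<psi>: "\<And>i. 0 \<le> \<psi> i y" "\<And>i. \<psi> i y \<le> 1"
    and near: "\<And>i. i < m \<Longrightarrow> \<psi> i y \<noteq> 0 \<Longrightarrow> \<bar>c i - r\<bar> \<le> e" and k: "k < m" "\<psi> k y = 1"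
  shows "\<bar>blend \<psi> c m y - r\<bar> \<le> e"
proof -
  have "n \<le> m \<Longrightarrow> \<bar>blend \<psi> c n y - r\<bar> \<le> e" if "Suc k \<le> n" for n
    using that
  proof (induction n rule: dec_induct)
    case base
    then show ?case using near[OF k(1)] k(2) by simp
  next
    case (step n)
    then show ?case unfolding blend.simps
      by (intro convex_combination_bound \<psi> near) auto
  qed
  then show ?thesis using k(1) by simp
qed

lemma C1_smooth_blend: "(\<And>i. C1_smooth (\<psi> i)) \<Longrightarrow> C1_smooth (blend \<psi> c m)"
proof (induction m)
  case 0
  have "blend \<psi> c 0 = (\<lambda>y. 0)" by auto
  then show ?case by (simp add: C1_smooth_const)
next
  case (Suc m)
  have "blend \<psi> c (Suc m) = (\<lambda>y. \<psi> m y * c m + (1 - \<psi> m y) * blend \<psi> c m y)" by auto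
  then show ?case using Suc by (auto intro!: C1_smooth_add C1_smooth_mult C1_smooth_diff C1_smooth_const)
qed

lemma kern_invariant:
  assumes "v \<in> kern F" "\<phi> \<in> F"
  shows "blinfun_apply \<phi> (y + t *\<^sub>R v - c) = blinfun_apply \<phi> (y - c)"
  using assms by (simp add: kern_def blinfun.bilinear_simps)

text \<open>
  Functionals that norm the differences \<open>x i - x j\<close> suffice: balls that they do not separate have nearby
  centres.
\<close>

lemma finitely_determined_approximation:
  fixes f \<epsilon> :: "'a::real_normed_vector \<Rightarrow> real"
  assumes N: "smooth_gauge {} N N'"
    and \<rho>: "\<And>i. \<rho> i > 0"
    and f: "\<And>i y. norm (y - x i) \<le> 20 * \<rho> i \<Longrightarrow> \<bar>f y - f (x i)\<bar> < \<epsilon> (x i) / 8"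
    and \<epsilon>: "\<And>i y. norm (y - x i) \<le> 20 * \<rho> i \<Longrightarrow> \<epsilon> (x i) / 2 < \<epsilon> y"
  obtains F :: "nat \<Rightarrow> ('a \<Rightarrow>\<^sub>L real) set" and G where
    "\<And>n. finite (F n)" "\<And>n. F n \<subseteq> F (Suc n)" "\<And>n. C1_smooth (G n)"
    "\<And>n y v t. v \<in> kern (F n) \<Longrightarrow> G n (y + t *\<^sub>R v) = G n y"
    "\<And>n k y. k \<le> n \<Longrightarrow> N (y - x k) < 2 * (\<rho> k)\<^sup>2 \<Longrightarrow> \<bar>G n y - f y\<bar> \<le> \<epsilon> y / 2"
proof -
  have "\<exists>\<phi> :: 'a \<Rightarrow>\<^sub>L real. norm \<phi> \<le> 1 \<and> blinfun_apply \<phi> (x i - x j) = norm (x i - x j)" for i j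
    using norming_functional[of "x i - x j"] by blast
  then obtain \<phi> :: "nat \<Rightarrow> nat \<Rightarrow> ('a \<Rightarrow>\<^sub>L real)" where \<phi>: "\<And>i j. norm (\<phi> i j) \<le> 1"
    "\<And>i j. \<phi> i j (x i - x j) = norm (x i - x j)" by metis
  have \<phi>le: "\<bar>\<phi> i j y\<bar> \<le> norm y" for i j y
  proof -
    have "\<bar>\<phi> i j y\<bar> \<le> norm (\<phi> i j) * norm y" by (rule blinfun_abs_le)
    also have "\<dots> \<le> 1 * norm y" by (intro mult_right_mono \<phi>) simp
    finally show ?thesis by simp
  qed
  define F where "F n = (\<lambda>(i, j). \<phi> i j) ` ({..n} \<times> {..n})" for n
  \<comment> \<open>The step runs from \<open>4 * \<rho> i\<close> to \<open>8 * \<rho> i\<close> in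
    the absolute value of the functional; \<open>48 = 64 - 16\<close>.\<close>
  define z where "z i j y = (\<phi> i j (y - x i) * \<phi> i j (y - x i) - 16 * (\<rho> i)\<^sup>2) * (1 / (48 * (\<rho> i)\<^sup>2))" for i j y
  define \<psi> where "\<psi> n i y = (\<Prod>j\<in>{..n}. 1 - step (z i j y))" for n i y
  define G where "G n y = blend (\<lambda>i. if i \<le> n then \<psi> n i else (\<lambda>y. 0)) (\<lambda>i. f (x i)) (Suc n) y" for n y
  have \<psi>C1: "C1_smooth (\<psi> n i)" for n i
    unfolding \<psi>_def[abs_def] z_def
    by (intro C1_smooth_prod C1_smooth_diff C1_smooth_const C1_smooth_step C1_smooth_mult C1_smooth_blinfun_shift) simp
  have \<psi>01: "0 \<le> \<psi> n i y" "\<psi> n i y \<le> 1" for n i y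
    unfolding \<psi>_def using step_bounds by (auto intro!: prod_nonneg prod_le_1)
  have \<psi>1: "\<psi> n k y = 1" if "norm (y - x k) \<le> 4 * \<rho> k" for n k y
  proof -
    have "step (z k j y) = 0" for j
    proof -
      have "(\<phi> k j (y - x k))\<^sup>2 \<le> (4 * \<rho> k)\<^sup>2"
        using \<phi>le[of k j "y - x k"] that \<rho>[of k] by (intro abs_le_square_iff[THEN iffD1]) auto
      then have "z k j y \<le> 0"
        unfolding z_def by (intro mult_nonpos_nonneg) (auto simp: power2_eq_square algebra_simps)
      then show ?thesis by (rule step_eq_0)
    qed
    then show ?thesis by (simp add: \<psi>_def)
  qed
  have \<psi>0: "norm (x i - x k) \<le> 4 * \<rho> k + 8 * \<rho> i"
    if "\<psi> n i y \<noteq> 0" "k \<le> n" "norm (y - x k) \<le> 4 * \<rho> k" for n i k y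
  proof -
    have "step (z i k y) \<noteq> 1" using that(1,2) by (auto simp: \<psi>_def)
    then have "z i k y < 1" using step_eq_1[of "z i k y"] by fastforce
    then have "(\<phi> i k (y - x i))\<^sup>2 < 64 * (\<rho> i)\<^sup>2"
      using \<rho>[of i] by (simp add: z_def divide_less_eq power2_eq_square)
    also have "\<dots> = (8 * \<rho> i)\<^sup>2" by (simp add: power_mult_distrib)
    finally have "\<bar>\<phi> i k (y - x i)\<bar> < \<bar>8 * \<rho> i\<bar>"
      using abs_le_square_iff not_le by blast
    moreover have "norm (x i - x k) = \<phi> i k (y - x k) - \<phi> i k (y - x i)"
      using \<phi>(2)[of i k] by (simp add: blinfun.diff_right)
    ultimately show ?thesis using \<phi>le[of i k "y - x k"] that(3) \<rho>[of i] by linarith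
  qed
  show ?thesis
  proof (rule that[of F G])
    show "finite (F n)" for n by (simp add: F_def)
    show "F n \<subseteq> F (Suc n)" for n by (auto simp: F_def image_iff)
    show "C1_smooth (G n)" for n
      unfolding G_def[abs_def] by (rule C1_smooth_blend) (use \<psi>C1 C1_smooth_const in auto)
    show "G n (y + t *\<^sub>R v) = G n y" if v: "v \<in> kern (F n)" for n y v t
    proof -
      have "\<phi> i j \<in> F n" if "i \<le> n" "j \<le> n" for i j using that by (force simp: F_def)
      then have "z i j (y + t *\<^sub>R v) = z i j y" if "i \<le> n" "j \<le> n" for i j
        using kern_invariant[OF v] that by (simp add: z_def)
      then have \<psi>eq: "\<psi> n i (y + t *\<^sub>R v) = \<psi> n i y" if "i \<le> n" for i
        using that by (auto simp: \<psi>_def intro!: prod.cong)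
      have "blend (\<lambda>i. if i \<le> n then \<psi> n i else (\<lambda>y. 0)) c m (y + t *\<^sub>R v) = blend (\<lambda>i. if i \<le> n then \<psi> n i else (\<lambda>y. 0)) c m y" for c m
        by (induction m) (auto simp: \<psi>eq)
      then show ?thesis by (simp only: G_def)
    qed
    show "\<bar>G n y - f y\<bar> \<le> \<epsilon> y / 2" if k: "k \<le> n" and Nk: "N (y - x k) < 2 * (\<rho> k)\<^sup>2" for n k y
    proof -
      have "(norm (y - x k))\<^sup>2 \<le> (4 * \<rho> k)\<^sup>2"
      proof -
        have "(norm (y - x k))\<^sup>2 \<le> 16 * (\<rho> k)\<^sup>2"
          using smooth_gauge_empty(1)[OF N, of "y - x k"] Nk zero_le_power2[of "\<rho> k"] by linarith
        then show ?thesis by (simp add: power_mult_distrib)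
      qed
      then have yk: "norm (y - x k) \<le> 4 * \<rho> k" using \<rho>[of k] by (auto intro: power2_le_imp_le)
      have near: "\<bar>f (x i) - f y\<bar> \<le> \<epsilon> y / 2" if "\<psi> n i y \<noteq> 0" for i
      \<comment> \<open>The comparison takes place in the ball with the larger radius: either
        \<open>y\<close> is within \<open>16 * \<rho> i\<close> of \<open>x i\<close>, or both
        \<open>x i\<close> and \<open>y\<close> are within \<open>12 * \<rho> k\<close> of
        \<open>x k\<close>.\<close>
      proof (cases "\<rho> k \<le> \<rho> i")
        case True
        have "norm (y - x i) \<le> norm (y - x k) + norm (x i - x k)"
          using norm_triangle_ineq4[of "y - x k" "x i - x k"] by simp
        then have "norm (y - x i) \<le> 20 * \<rho> i" using \<psi>0[OF that k yk] yk True \<rho>[of i] by linarith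
        from f[OF this] \<epsilon>[OF this] show ?thesis by linarith
      next
        case False
        then have "norm (x i - x k) \<le> 20 * \<rho> k" using \<psi>0[OF that k yk] \<rho>[of k] by linarith
        note 1 = f[OF this]
        have "norm (y - x k) \<le> 20 * \<rho> k" using yk \<rho>[of k] by linarith
        from f[OF this] \<epsilon>[OF this] 1 show ?thesis by linarith
      qed
      show ?thesis unfolding G_def
      proof (rule blend_approx)
        show "k < Suc n" using k by simp
        show "(if k \<le> n then \<psi> n k else (\<lambda>y. 0)) y = 1" using k \<psi>1[OF yk] by simp
      qed (use \<psi>01 near in \<open>auto split: if_splits\<close>)
    qed
  qed
qed

text \<open>Near a point only one cut-off is active, and the derivative there is \<open>t *\<^sub>R
  h' n y + (1 - t) *\<^sub>R h' (Suc n) y + c *\<^sub>R \<theta>' n y\<close>. If it vanishes,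
  testing on \<open>kern (\<Phi> n)\<close> removes the last term, and the extra functionals
  \<open>l n\<close> rule out cancellation between the first two.\<close>

theorem approximation_without_critical_points:
  fixes f \<epsilon> :: "'a::real_normed_vector \<Rightarrow> real"
  assumes inf: "infinite_dimensional TYPE('a)"
    and sep: "separable_space (euclidean :: 'a topology)"
    and dual: "separable_space (euclidean :: ('a \<Rightarrow>\<^sub>L real) topology)"
    and f: "continuous_on UNIV f" and \<epsilon>: "continuous_on UNIV \<epsilon>" "\<And>x. \<epsilon> x > 0"
  obtains g g' where "C1_deriv g g'" "\<And>y. \<bar>f y - g y\<bar> \<le> \<epsilon> y" "\<And>y. g' y \<noteq> 0"
proof -
  have gauge: "\<exists>M M'. smooth_gauge E M M'" for E :: "'a set"
    by (rule smooth_gauge_exists[OF sep dual])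
  obtain N N' where N: "smooth_gauge ({} :: 'a set) N N'" using gauge by blast
  obtain x :: "nat \<Rightarrow> 'a" and \<rho> where \<rho>: "\<And>i. \<rho> i > 0"
    and xf: "\<And>i y. norm (y - x i) \<le> 20 * \<rho> i \<Longrightarrow> \<bar>f y - f (x i)\<bar> < \<epsilon> (x i) / 8"
    and x\<epsilon>: "\<And>i y. norm (y - x i) \<le> 20 * \<rho> i \<Longrightarrow> \<epsilon> (x i) / 2 < \<epsilon> y"
    and cover: "\<And>y. \<exists>i. N (y - x i) < (\<rho> i)\<^sup>2"
    by (rule countable_gauge_ball_cover[OF sep N f \<epsilon>]) (rule that)
  obtain F :: "nat \<Rightarrow> ('a \<Rightarrow>\<^sub>L real) set" and G where F: "\<And>n. finite (F n)" "\<And>n. F n \<subseteq> F (Suc n)"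
    and GC1: "\<And>n. C1_smooth (G n)"
    and Ginv: "\<And>n y v t. v \<in> kern (F n) \<Longrightarrow> G n (y + t *\<^sub>R v) = G n y"
    and Gapp: "\<And>n k y. k \<le> n \<Longrightarrow> N (y - x k) < 2 * (\<rho> k)\<^sup>2 \<Longrightarrow> \<bar>G n y - f y\<bar> \<le> \<epsilon> y / 2"
    by (rule finitely_determined_approximation[where x = x and f = f and \<rho> = \<rho> and \<epsilon> = \<epsilon>, OF N \<rho>])
      (rule xf, assumption, rule x\<epsilon>, assumption, rule that)
  \<comment> \<open>Each new functional is chosen independent of the previous one modulo
    \<open>F (Suc n)\<close>, so that neighbouring pieces cannot cancel in a convex
    combination.\<close>
  have "\<exists>l :: nat \<Rightarrow> 'a \<Rightarrow>\<^sub>L real. \<forall>n. (\<exists>v\<in>kern (F n). l n v \<noteq> 0) \<and>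
      (\<exists>v\<in>kern (F (Suc n)). l n v = 0 \<and> l (Suc n) v \<noteq> 0)"
  proof (rule dependent_nat_choice)
    have new: "\<exists>l :: 'a \<Rightarrow>\<^sub>L real. \<exists>v\<in>kern \<Phi>. blinfun_apply l v \<noteq> 0" if fin: "finite \<Phi>" for \<Phi> :: "('a \<Rightarrow>\<^sub>L real) set"
    proof -
      obtain v where v: "v \<in> kern \<Phi>" "v \<noteq> 0" using kern_nontrivial[OF inf fin] by blast
      obtain l :: "'a \<Rightarrow>\<^sub>L real" where "blinfun_apply l v = norm v" using norming_functional[of v] by blast
      then show ?thesis using v by (metis norm_eq_zero)
    qed
    show "\<exists>l :: 'a \<Rightarrow>\<^sub>L real. \<exists>v\<in>kern (F 0). blinfun_apply l v \<noteq> 0" by (rule new[OF F(1)])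
    fix l :: "'a \<Rightarrow>\<^sub>L real" and n
    obtain l' v where lv: "v \<in> kern (insert l (F (Suc n)))" "blinfun_apply (l' :: 'a \<Rightarrow>\<^sub>L real) v \<noteq> 0"
      using new[of "insert l (F (Suc n))"] F(1) by auto
    then have "v \<in> kern (F (Suc n))" "blinfun_apply l v = 0" by (auto simp: kern_def)
    then show "\<exists>l' :: 'a \<Rightarrow>\<^sub>L real. (\<exists>v\<in>kern (F (Suc n)). blinfun_apply l' v \<noteq> 0) \<and>
        (\<exists>v\<in>kern (F (Suc n)). blinfun_apply l v = 0 \<and> blinfun_apply l' v \<noteq> 0)"
      using lv(2) by blast
  qed
  then obtain l :: "nat \<Rightarrow> 'a \<Rightarrow>\<^sub>L real" where l: "\<And>n. \<exists>v\<in>kern (F n). l n v \<noteq> 0"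
    "\<And>n. \<exists>v\<in>kern (F (Suc n)). l n v = 0 \<and> l (Suc n) v \<noteq> 0" by blast
  \<comment> \<open>As \<open>arctan\<close> is bounded by 2, the perturbation costs at most
    \<open>\<epsilon> (x k) / 4 < \<epsilon> y / 2\<close>, the half left over by
    \<open>Gapp\<close>. It is bounded, yet its derivative is a nonzero multiple of
    \<open>l n\<close> everywhere.\<close>
  define \<delta> where "\<delta> n = Min ((\<lambda>k. \<epsilon> (x k) / 8) ` {..n})" for n
  have \<delta>: "\<delta> n > 0" for n unfolding \<delta>_def using \<epsilon>(2) by (subst Min_gr_iff) auto
  have \<delta>le: "\<delta> n \<le> \<epsilon> (x k) / 8" if "k \<le> n" for n k unfolding \<delta>_def using that by (intro Min_le) auto
  define h where "h n y = G n y + \<delta> n * arctan (l n y)" for n y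
  have "\<exists>G'. C1_deriv (G n) G'" for n using GC1 by (simp add: C1_smooth_iff)
  then obtain G' where G': "\<And>n. C1_deriv (G n) (G' n)" by metis
  define h' where "h' n y = G' n y + \<delta> n *\<^sub>R (inverse (1 + (l n y)\<^sup>2) *\<^sub>R l n)" for n y
  have hC1: "C1_deriv (h n) (h' n)" for n
  proof -
    have "C1_deriv (\<lambda>y. arctan (l n y)) (\<lambda>y. inverse (1 + (l n y)\<^sup>2) *\<^sub>R l n)"
    proof (rule C1_deriv_real_compose[OF DERIV_arctan _ C1_deriv_blinfun])
      have "1 + t\<^sup>2 \<noteq> 0" for t :: real using zero_le_power2[of t] by linarith
      then show "continuous_on UNIV (\<lambda>t::real. inverse (1 + t\<^sup>2))" by (intro continuous_intros) auto
    qed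
    from C1_deriv_add[OF G'[of n] C1_deriv_mult[OF C1_deriv_const this, of "\<delta> n"]]
    show ?thesis by (simp add: h_def[abs_def] h'_def[abs_def])
  qed
  have G'0: "G' n y v = 0" if "v \<in> kern (F n)" for n y v
    by (rule derivative_eq_0_if_invariant[OF C1_deriv_has_derivative[OF G']]) (rule Ginv[OF that])
  have h'0: "h' n y v = \<delta> n * (inverse (1 + (l n y)\<^sup>2) * l n v)"
    if "v \<in> kern (F n)" for n y v
    using G'0[OF that, of y] by (simp add: h'_def blinfun.bilinear_simps)
  have happ: "\<bar>h n y - f y\<bar> \<le> \<epsilon> y" if k: "k \<le> n" "N (y - x k) < 2 * (\<rho> k)\<^sup>2" for n k y
  proof -
    have "(norm (y - x k))\<^sup>2 \<le> (20 * \<rho> k)\<^sup>2"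
    proof -
      have "(norm (y - x k))\<^sup>2 \<le> 400 * (\<rho> k)\<^sup>2"
        using smooth_gauge_empty(1)[OF N, of "y - x k"] k(2) zero_le_power2[of "\<rho> k"] by linarith
      then show ?thesis by (simp add: power_mult_distrib)
    qed
    then have "norm (y - x k) \<le> 20 * \<rho> k" using \<rho>[of k] by (auto intro: power2_le_imp_le)
    then have 1: "\<epsilon> (x k) / 2 < \<epsilon> y" by (rule x\<epsilon>)
    have "\<bar>arctan (l n y)\<bar> \<le> 2"
      using arctan_lbound[of "l n y"] arctan_ubound[of "l n y"] pi_less_4 by linarith
    then have "\<bar>\<delta> n * arctan (l n y)\<bar> \<le> \<delta> n * 2"
      using \<delta>[of n] by (simp add: abs_mult)
    then show ?thesis using Gapp[OF k] \<delta>le[OF k(1)] 1 unfolding h_def by linarith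
  qed
  \<comment> \<open>Levels increasing strictly from \<open>(\<rho> i)\<^sup>2\<close> towards
    \<open>2 * (\<rho> i)\<^sup>2\<close>: every cut-off has room between consecutive levels, and
    all balls remain in the range of \<open>Gapp\<close>.\<close>
  define a where "a n i = (2 - 1 / real (Suc n)) * (\<rho> i)\<^sup>2" for n i
  have aSuc: "a n i < a (Suc n) i" for n i
    unfolding a_def using \<rho>[of i] by (intro mult_strict_right_mono) (auto simp: frac_less2)
  have amono: "a n i \<le> a m i" if "n \<le> m" for n m i
    using lift_Suc_mono_le[of "\<lambda>n. a n i", OF less_imp_le[OF aSuc] that] .
  have a1: "(\<rho> i)\<^sup>2 \<le> a n i" for n i
  proof -
    have "1 * (\<rho> i)\<^sup>2 \<le> (2 - 1 / real (Suc n)) * (\<rho> i)\<^sup>2" by (intro mult_right_mono) auto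
    then show ?thesis by (simp add: a_def)
  qed
  have a2: "a n i < 2 * (\<rho> i)\<^sup>2" for n i
    unfolding a_def using \<rho>[of i] by (intro mult_strict_right_mono) auto
  \<comment> \<open>All functionals on which \<open>h' n\<close> and \<open>h' (Suc n)\<close> can
    depend; \<open>F n\<close> is contained in \<open>F (Suc n)\<close>.\<close>
  define \<Phi> where "\<Phi> n = {l n, l (Suc n)} \<union> F (Suc n)" for n
  define Q where "Q n \<theta> \<theta>' \<longleftrightarrow> C1_deriv \<theta> \<theta>' \<and> (\<forall>y. 0 \<le> \<theta> y \<and> \<theta> y \<le> 1) \<and>
      (\<forall>y i. i \<le> n \<longrightarrow> N (y - x i) \<le> a n i \<longrightarrow> \<theta> y = 1) \<and>
      (\<forall>y. (\<forall>i\<le>n. a (Suc n) i \<le> N (y - x i)) \<longrightarrow> \<theta> y = 0) \<and>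
      (\<forall>y. (\<forall>v\<in>kern (\<Phi> n). \<theta>' y v = 0) \<longrightarrow> \<theta>' y = 0)" for n and \<theta> :: "'a \<Rightarrow> real" and \<theta>'
  have "\<exists>\<theta> \<theta>'. Q n \<theta> \<theta>'" for n
  proof -
    have fin: "finite (\<Phi> n)" using F(1) by (simp add: \<Phi>_def)
    show ?thesis
    proof (rule cutoff_without_critical_points[OF inf gauge N finite_atMost[of n] fin aSuc, of x])
      fix \<theta> :: "'a \<Rightarrow> real" and \<theta>'
      assume *: "C1_deriv \<theta> \<theta>'" "\<And>y. 0 \<le> \<theta> y" "\<And>y. \<theta> y \<le> 1"
        "\<And>y i. i \<in> {..n} \<Longrightarrow> N (y - x i) \<le> a n i \<Longrightarrow> \<theta> y = 1"
        "\<And>y. (\<And>i. i \<in> {..n} \<Longrightarrow> a (Suc n) i \<le> N (y - x i)) \<Longrightarrow> \<theta> y = 0"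
        "\<And>y. (\<And>v. v \<in> kern (\<Phi> n) \<Longrightarrow> \<theta>' y v = 0) \<Longrightarrow> \<theta>' y = 0"
      have "Q n \<theta> \<theta>'" unfolding Q_def by (intro conjI allI impI) (use * in auto)
      then show ?thesis by blast
    qed
  qed
  then obtain \<theta> \<theta>' where Q: "\<And>n. Q n (\<theta> n) (\<theta>' n)" by metis
  have \<theta>C1: "C1_deriv (\<theta> n) (\<theta>' n)" and \<theta>01: "0 \<le> \<theta> n y \<and> \<theta> n y \<le> 1"
    and \<theta>1: "i \<le> n \<Longrightarrow> N (y - x i) \<le> a n i \<Longrightarrow> \<theta> n y = 1"
    and \<theta>0: "(\<And>i. i \<le> n \<Longrightarrow> a (Suc n) i \<le> N (y - x i)) \<Longrightarrow> \<theta> n y = 0"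
    and \<theta>': "(\<And>v. v \<in> kern (\<Phi> n) \<Longrightarrow> \<theta>' n y v = 0) \<Longrightarrow> \<theta>' n y = 0" for n y i
    using Q[of n] unfolding Q_def by blast+
  define W where "W n = {y. \<exists>i\<le>n. N (y - x i) < a (Suc n) i}" for n
  have Wopen: "open (W n)" for n
  proof -
    have "open {y. N (y - x i) < a (Suc n) i}" for i
      using C1_deriv_continuous_on[OF C1_deriv_shift[OF smooth_gauge_C1[OF N]]]
      by (intro open_Collect_less continuous_intros) auto
    moreover have "W n = (\<Union>i\<in>{..n}. {y. N (y - x i) < a (Suc n) i})" by (auto simp: W_def)
    ultimately show ?thesis by auto
  qed
  have \<theta>W: "y \<in> W n" if "\<theta> n y \<noteq> 0" for n y
    using \<theta>0[of n y] that by (force simp: W_def)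
  have W1: "\<theta> m y = 1" if "y \<in> W n" "Suc n \<le> m" for n m y
  proof -
    obtain i where i: "i \<le> n" "N (y - x i) < a (Suc n) i" using \<open>y \<in> W n\<close> by (auto simp: W_def)
    then show ?thesis using amono[OF that(2), of i] that(2) by (intro \<theta>1[of i]) auto
  qed
  have Wapp: "\<bar>h m y - f y\<bar> \<le> \<epsilon> y" if "y \<in> W n" "n \<le> m" for n m y
  proof -
    obtain i where "i \<le> n" "N (y - x i) < a (Suc n) i" using \<open>y \<in> W n\<close> by (auto simp: W_def)
    then show ?thesis using a2[of "Suc n" i] that(2) by (intro happ[of i]) auto
  qed
  define gs where "gs = rec_nat (h 0) (\<lambda>n g y. \<theta> n y * g y + (1 - \<theta> n y) * h (Suc n) y)"
  have gs: "gs 0 = h 0" "gs (Suc n) = (\<lambda>y. \<theta> n y * gs n y + (1 - \<theta> n y) * h (Suc n) y)" for n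
    by (simp_all add: gs_def)
  define gs' where "gs' = rec_nat (h' 0) (\<lambda>n d y. (\<theta> n y *\<^sub>R d y + gs n y *\<^sub>R \<theta>' n y)
      + ((1 - \<theta> n y) *\<^sub>R h' (Suc n) y + h (Suc n) y *\<^sub>R (0 - \<theta>' n y)))"
  have gs': "gs' 0 = h' 0" "gs' (Suc n) = (\<lambda>y. (\<theta> n y *\<^sub>R gs' n y + gs n y *\<^sub>R \<theta>' n y)
      + ((1 - \<theta> n y) *\<^sub>R h' (Suc n) y + h (Suc n) y *\<^sub>R (0 - \<theta>' n y)))" for n
    by (simp_all add: gs'_def)
  have gsC1: "C1_deriv (gs n) (gs' n)" for n
  proof (induction n)
    case (Suc n)
    show ?case unfolding gs(2) gs'(2)
      by (intro C1_deriv_add C1_deriv_mult C1_deriv_diff C1_deriv_const Suc \<theta>C1 hC1)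
  qed (simp add: gs gs' hC1)
  \<comment> \<open>On \<open>W n\<close> all later cut-offs are 1, so the recursion is stationary
    there.\<close>
  have stable: "gs m y = gs (Suc n) y" if "y \<in> W n" "Suc n \<le> m" for n m y
    using that(2)
  proof (induction m rule: dec_induct)
    case (step m)
    then show ?case using W1[OF that(1) step(1)] by (simp add: gs(2))
  qed simp
  have ex: "\<exists>n. \<theta> n y \<noteq> 0" for y
  proof -
    obtain i where "N (y - x i) < (\<rho> i)\<^sup>2" using cover by blast
    then have "\<theta> i y = 1" using a1[of i i] by (intro \<theta>1[of i]) auto
    then show ?thesis by (metis zero_neq_one)
  qed
  define m where "m y = (LEAST n. \<theta> n y \<noteq> 0)" for y
  have m: "\<theta> (m y) y \<noteq> 0" and mless: "\<And>n. n < m y \<Longrightarrow> \<theta> n y = 0" for y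
    unfolding m_def using LeastI_ex[OF ex[of y]] not_less_Least by blast+
  have mW: "y \<in> W (m y)" for y by (rule \<theta>W[OF m])
  define g where "g y = gs (Suc (m y)) y" for y
  have geq: "g y = gs (Suc n) y" if "y \<in> W n" for n y
    using stable[OF that, where m = "max (Suc n) (Suc (m y))"]
      stable[OF mW[of y], where m = "max (Suc n) (Suc (m y))"]
    by (simp add: g_def)
  have "\<exists>g'. C1_deriv g g' \<and> (\<forall>y :: 'a. True)"
  proof (rule C1_deriv_local[where P = "\<lambda>_ _. True"])
    fix y
    show "\<exists>U k k'. open U \<and> y \<in> U \<and> C1_deriv k k' \<and> (\<forall>z\<in>U. g z = k z \<and> True)"
      by (intro exI[of _ "W (m y)"] exI[of _ "gs (Suc (m y))"] exI[of _ "gs' (Suc (m y))"] conjI ballI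
          Wopen mW gsC1 geq TrueI)
  qed
  then obtain g' where g': "C1_deriv g g'" by blast
  \<comment> \<open>At \<open>y\<close> the preceding cut-off has value 0, which is its minimum, so
    its derivative vanishes as well and the recursion reduces to \<open>h (m y)\<close> up to first
    order.\<close>
  have gsm: "gs (m y) y = h (m y) y \<and> gs' (m y) y = h' (m y) y" for y
  proof (cases "m y")
    case (Suc n)
    have t0: "\<theta> n y = 0" using mless[of n y] Suc by simp
    have "blinfun_apply (\<theta>' n y) = (\<lambda>v. 0)"
      by (rule differential_zero_maxmin[of y UNIV "\<theta> n"])
        (use t0 \<theta>01 C1_deriv_has_derivative[OF \<theta>C1] in auto)
    then have "\<theta>' n y = 0" by (intro blinfun_eqI) simp
    then show ?thesis using t0 by (simp add: Suc gs(2) gs'(2))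
  qed (simp add: gs gs')
  have gapp: "\<bar>f y - g y\<bar> \<le> \<epsilon> y" for y
  proof -
    have "\<bar>\<theta> (m y) y * h (m y) y + (1 - \<theta> (m y) y) * h (Suc (m y)) y - f y\<bar> \<le> \<epsilon> y"
      using \<theta>01[of "m y" y] by (intro convex_combination_bound Wapp[OF mW]) auto
    then show ?thesis using gsm[of y] by (simp add: g_def gs(2) abs_minus_commute)
  qed
  have nocrit: "g' y \<noteq> 0" for y
  proof
    assume zero: "g' y = 0"
    define n where "n = m y"
    define t where "t = \<theta> n y"
    define c where "c = h n y - h (Suc n) y"
    have yW: "y \<in> W n" by (simp add: n_def mW)
    have "(g has_derivative blinfun_apply (gs' (Suc n) y)) (at y)"
      by (rule has_derivative_transform_within_open[OF C1_deriv_has_derivative[OF gsC1] Wopen yW])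
        (simp add: geq)
    then have "gs' (Suc n) y = 0"
      using C1_deriv_unique[OF C1_deriv_has_derivative[OF g']] zero by metis
    then have eq: "t *\<^sub>R h' n y + (1 - t) *\<^sub>R h' (Suc n) y + c *\<^sub>R \<theta>' n y = 0"
      using gsm[of y] by (simp add: gs'(2) n_def[symmetric] t_def c_def algebra_simps)
    have kF: "v \<in> kern (F n)" if "v \<in> kern (F (Suc n))" for v
      using kern_anti_mono[OF F(2)] that by blast
    have c\<theta>: "c *\<^sub>R \<theta>' n y = 0"
    proof (cases "c = 0")
      case False
      have "\<theta>' n y v = 0" if v: "v \<in> kern (\<Phi> n)" for v
      proof -
        have vF: "v \<in> kern (F (Suc n))" "l n v = 0" "l (Suc n) v = 0"
          using v by (auto simp: kern_def \<Phi>_def)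
        have "h' n y v = 0" "h' (Suc n) y v = 0"
          using vF kF by (simp_all add: h'0)
        then show ?thesis using arg_cong[OF eq, of "\<lambda>A. blinfun_apply A v"] False
          by (simp add: blinfun.bilinear_simps)
      qed
      then have "\<theta>' n y = 0" by (rule \<theta>')
      then show ?thesis by simp
    qed simp
    have inv: "inverse (1 + s\<^sup>2) \<noteq> 0" for s :: real
    proof -
      have "1 + s\<^sup>2 > 0" using zero_le_power2[of s] by linarith
      then show ?thesis by simp
    qed
    have eq': "t * h' n y v + (1 - t) * h' (Suc n) y v = 0" for v
      using arg_cong[OF eq, of "\<lambda>A. blinfun_apply A v"] c\<theta> by (simp add: blinfun.bilinear_simps)
    \<comment> \<open>For \<open>t = 1\<close> only \<open>l n\<close> remains. Otherwise a vector
      killed by \<open>l n\<close> but not by \<open>l (Suc n)\<close> isolates the term with factor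
      \<open>1 - t\<close>.\<close>
    show False
    proof (cases "t = 1")
      case True
      obtain v where v: "v \<in> kern (F n)" "l n v \<noteq> 0" using l(1) by blast
      then show False using eq'[of v] True \<delta>[of n] inv by (simp add: h'0)
    next
      case False
      obtain v where v: "v \<in> kern (F (Suc n))" "l n v = 0" "l (Suc n) v \<noteq> 0"
        using l(2) by blast
      then show False using eq'[of v] False \<delta>[of "Suc n"] inv kF by (simp add: h'0)
    qed
  qed
  show ?thesis by (rule that[OF g' gapp nocrit])
qed

theorem corollary1p3:
  assumes "infinite_dimensional TYPE('a::banach)"
    and "separable_space (euclidean :: 'a topology)"
  shows "separable_space (euclidean :: ('a \<Rightarrow>\<^sub>L real) topology) \<longleftrightarrow>
    (\<forall>(f :: 'a \<Rightarrow> real) (\<epsilon> :: 'a \<Rightarrow> real).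
       continuous_on UNIV f \<longrightarrow> continuous_on UNIV \<epsilon> \<longrightarrow> (\<forall>x. \<epsilon> x > 0) \<longrightarrow>
       (\<exists>g :: 'a \<Rightarrow> real. C1_smooth g \<and> (\<forall>x. \<bar>f x - g x\<bar> \<le> \<epsilon> x) \<and>
          (\<forall>x. \<not> critical_point g x)))"
proof (intro iffI allI impI)
  fix f \<epsilon> :: "'a \<Rightarrow> real"
  assume dual: "separable_space (euclidean :: ('a \<Rightarrow>\<^sub>L real) topology)"
    and "continuous_on UNIV f" "continuous_on UNIV \<epsilon>" "\<forall>x. \<epsilon> x > 0"
  then obtain g g' where g: "C1_deriv g g'" "\<And>y. \<bar>f y - g y\<bar> \<le> \<epsilon> y" "\<And>y. g' y \<noteq> 0"
    using approximation_without_critical_points[OF assms dual, of f \<epsilon>] by blast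
  have "\<not> critical_point g x" for x
  proof
    assume "critical_point g x"
    then have "(g has_derivative blinfun_apply 0) (at x)"
      by (simp add: critical_point_def zero_blinfun.rep_eq)
    then show False using C1_deriv_unique[OF C1_deriv_has_derivative[OF g(1)]] g(3) by blast
  qed
  then show "\<exists>g. C1_smooth g \<and> (\<forall>x. \<bar>f x - g x\<bar> \<le> \<epsilon> x) \<and> (\<forall>x. \<not> critical_point g x)"
    using g by (auto simp: C1_smooth_iff)
next
  assume approx: "\<forall>(f :: 'a \<Rightarrow> real) (\<epsilon> :: 'a \<Rightarrow> real).
       continuous_on UNIV f \<longrightarrow> continuous_on UNIV \<epsilon> \<longrightarrow> (\<forall>x. \<epsilon> x > 0) \<longrightarrow>
       (\<exists>g :: 'a \<Rightarrow> real. C1_smooth g \<and> (\<forall>x. \<bar>f x - g x\<bar> \<le> \<epsilon> x) \<and> (\<forall>x. \<not> critical_point g x))"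
  have "continuous_on UNIV (\<lambda>y :: 'a. (norm y)\<^sup>2)" by (intro continuous_intros)
  moreover have "continuous_on UNIV (\<lambda>y :: 'a. 1 :: real)" by (rule continuous_on_const)
  ultimately obtain g :: "'a \<Rightarrow> real" where "C1_smooth g" "\<And>y. \<bar>(norm y)\<^sup>2 - g y\<bar> \<le> 1"
    using approx by fastforce
  then show "separable_space (euclidean :: ('a \<Rightarrow>\<^sub>L real) topology)"
    by (rule separable_dual_if_smooth_approximation[OF assms(2)])
qed

end
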